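(* For every $1<p<\infty$, with $1/p+1/q=1$, there exists an Orlicz function $\Phi_p$ such that $L_{\Phi_p}$ is $(p-DH)$, while the space $L_{\Psi_q}$, where $\Psi_q$ is the Young conjugate of $\Phi_p$, is restricted $(q-DH)$ but is neither $DH$ nor $DC$.
   Context: An Orlicz function is an increasing convex function on $[0,\infty)$ vanishing at $0$ and tending to $\infty$; its Young conjugate is $\Psi(u)=\sup_{t>0}(ut-\Phi(t))$. $L_\Phi$ is the Orlicz space on $[0,1]$ with Luxemburg norm $\|f\|=\inf\{\lambda>0:\int_0^1\Phi(|f|/\lambda)\le1\}$. A Banach lattice is $(r-DH)$ if every sequence of pairwise disjoint norm-one elements has a subsequence equivalent to the unit vector basis of $\ell_r$; it is $DH$ if any two sequences of pairwise disjoint norm-one elements have equivalent subsequences (along a common index sequence). A symmetric space $X$ on $[0,1]$ is restricted $(r-DH)$ if for every sequence of pairwise disjoint measurable sets $A_n$ of positive measure some subsequence $(\chi_{A_{n_k}}/\|\chi_{A_{n_k}}\|_X)$ is equivalent to the unit vector basis of $\ell_r$. $X$ is $DC$ if every disjoint sequence has a subsequence whose closed span is complemented in $X$. *)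

theory Defs
  imports "HOL-Analysis.Analysis"
begin

definition orlicz_function :: "(real \<Rightarrow> real) \<Rightarrow> bool" where
  "orlicz_function \<Phi> \<longleftrightarrow> mono_on {0..} \<Phi> \<and> convex_on {0..} \<Phi> \<and> \<Phi> 0 = 0
     \<and> filterlim \<Phi> at_top at_top"

text \<open>Young conjugate (meaningful when the sets below are bounded above).\<close>
definition young_conjugate :: "(real \<Rightarrow> real) \<Rightarrow> real \<Rightarrow> real" where
  "young_conjugate \<Phi> u = Sup {u * t - \<Phi> t | t. t > 0}"

definition modular :: "(real \<Rightarrow> real) \<Rightarrow> (real \<Rightarrow> real) \<Rightarrow> ennreal" where
  "modular \<Phi> f = (\<integral>\<^sup>+ x \<in> {0..1}. ennreal (\<Phi> \<bar>f x\<bar>) \<partial>lebesgue)"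

text \<open>Orlicz space L_Phi on [0,1] (functions, identified up to null sets through the norm).\<close>
definition orlicz_space :: "(real \<Rightarrow> real) \<Rightarrow> (real \<Rightarrow> real) set" where
  "orlicz_space \<Phi> = {f. set_borel_measurable lebesgue {0..1} f
      \<and> (\<exists>l>0. modular \<Phi> (\<lambda>x. f x / l) \<le> 1)}"

definition lux_norm :: "(real \<Rightarrow> real) \<Rightarrow> (real \<Rightarrow> real) \<Rightarrow> real" where
  "lux_norm \<Phi> f = Inf {l. l > 0 \<and> modular \<Phi> (\<lambda>x. f x / l) \<le> 1}"

definition disjoint_fun :: "(real \<Rightarrow> real) \<Rightarrow> (real \<Rightarrow> real) \<Rightarrow> bool" where
  "disjoint_fun f g \<longleftrightarrow> emeasure lebesgue {x \<in> {0..1}. f x \<noteq> 0 \<and> g x \<noteq> 0} = 0"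

definition disjoint_seq :: "(nat \<Rightarrow> real \<Rightarrow> real) \<Rightarrow> bool" where
  "disjoint_seq x \<longleftrightarrow> (\<forall>m n. m \<noteq> n \<longrightarrow> disjoint_fun (x m) (x n))"

definition lin_comb :: "(nat \<Rightarrow> real) \<Rightarrow> (nat \<Rightarrow> real \<Rightarrow> real) \<Rightarrow> nat \<Rightarrow> real \<Rightarrow> real" where
  "lin_comb a x N = (\<lambda>t. \<Sum>i<N. a i * x i t)"

definition equiv_lr :: "(real \<Rightarrow> real) \<Rightarrow> real \<Rightarrow> (nat \<Rightarrow> real \<Rightarrow> real) \<Rightarrow> bool" where
  "equiv_lr \<Phi> r x \<longleftrightarrow> (\<exists>c C. 0 < c \<and> 0 < C \<and> (\<forall>N a.
      c * (\<Sum>i<N. \<bar>a i\<bar> powr r) powr (1/r) \<le> lux_norm \<Phi> (lin_comb a x N) \<and>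
      lux_norm \<Phi> (lin_comb a x N) \<le> C * (\<Sum>i<N. \<bar>a i\<bar> powr r) powr (1/r)))"

definition equiv_seq :: "(real \<Rightarrow> real) \<Rightarrow> (nat \<Rightarrow> real \<Rightarrow> real) \<Rightarrow> (nat \<Rightarrow> real \<Rightarrow> real) \<Rightarrow> bool" where
  "equiv_seq \<Phi> x y \<longleftrightarrow> (\<exists>c C. 0 < c \<and> 0 < C \<and> (\<forall>N a.
      c * lux_norm \<Phi> (lin_comb a y N) \<le> lux_norm \<Phi> (lin_comb a x N) \<and>
      lux_norm \<Phi> (lin_comb a x N) \<le> C * lux_norm \<Phi> (lin_comb a y N)))"

definition normalized_disjoint_seq :: "(real \<Rightarrow> real) \<Rightarrow> (nat \<Rightarrow> real \<Rightarrow> real) \<Rightarrow> bool" where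
  "normalized_disjoint_seq \<Phi> x \<longleftrightarrow>
     (\<forall>n. x n \<in> orlicz_space \<Phi> \<and> lux_norm \<Phi> (x n) = 1) \<and> disjoint_seq x"

definition r_DH :: "(real \<Rightarrow> real) \<Rightarrow> real \<Rightarrow> bool" where
  "r_DH \<Phi> r \<longleftrightarrow> (\<forall>x. normalized_disjoint_seq \<Phi> x \<longrightarrow>
      (\<exists>\<sigma>. strict_mono \<sigma> \<and> equiv_lr \<Phi> r (x \<circ> \<sigma>)))"

definition DH :: "(real \<Rightarrow> real) \<Rightarrow> bool" where
  "DH \<Phi> \<longleftrightarrow> (\<forall>x y. normalized_disjoint_seq \<Phi> x \<longrightarrow> normalized_disjoint_seq \<Phi> y \<longrightarrow>
      (\<exists>\<sigma>. strict_mono \<sigma> \<and> equiv_seq \<Phi> (x \<circ> \<sigma>) (y \<circ> \<sigma>)))"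

definition restricted_r_DH :: "(real \<Rightarrow> real) \<Rightarrow> real \<Rightarrow> bool" where
  "restricted_r_DH \<Phi> r \<longleftrightarrow> (\<forall>A :: nat \<Rightarrow> real set.
      (\<forall>n. A n \<in> sets lebesgue \<and> A n \<subseteq> {0..1} \<and> emeasure lebesgue (A n) > 0) \<and>
      disjoint_family A \<longrightarrow>
      (\<exists>\<sigma>. strict_mono \<sigma> \<and>
         equiv_lr \<Phi> r (\<lambda>k t. indicator (A (\<sigma> k)) t / lux_norm \<Phi> (indicator (A (\<sigma> k))))))"

definition closed_span :: "(real \<Rightarrow> real) \<Rightarrow> (nat \<Rightarrow> real \<Rightarrow> real) \<Rightarrow> (real \<Rightarrow> real) set" where
  "closed_span \<Phi> x = {f \<in> orlicz_space \<Phi>. \<forall>\<epsilon>>0. \<exists>N a.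
      lux_norm \<Phi> (\<lambda>t. f t - lin_comb a x N t) < \<epsilon>}"

text \<open>A subset Y of L_Phi is complemented: there is a bounded linear projection onto it
  (equalities understood up to null sets, i.e. modulo norm zero).\<close>
definition complemented :: "(real \<Rightarrow> real) \<Rightarrow> (real \<Rightarrow> real) set \<Rightarrow> bool" where
  "complemented \<Phi> Y \<longleftrightarrow> (\<exists>P M. (\<forall>f \<in> orlicz_space \<Phi>. P f \<in> Y \<and>
        lux_norm \<Phi> (P f) \<le> M * lux_norm \<Phi> f) \<and>
      (\<forall>f \<in> orlicz_space \<Phi>. \<forall>g \<in> orlicz_space \<Phi>. \<forall>a b.
        lux_norm \<Phi> (\<lambda>t. P (\<lambda>s. a * f s + b * g s) t - (a * P f t + b * P g t)) = 0) \<and>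
      (\<forall>g \<in> Y. lux_norm \<Phi> (\<lambda>t. P g t - g t) = 0))"

definition DC :: "(real \<Rightarrow> real) \<Rightarrow> bool" where
  "DC \<Phi> \<longleftrightarrow> (\<forall>x. (\<forall>n. x n \<in> orlicz_space \<Phi>) \<and> disjoint_seq x \<longrightarrow>
      (\<exists>\<sigma>. strict_mono \<sigma> \<and> complemented \<Phi> (closed_span \<Phi> (x \<circ> \<sigma>))))"

end

(* Take Phi(t) comparable to t^p 2^(h(log t)) with h nondecreasing, built from isolated ramps of slope
   1/(N+1) and total rise N+1, each N occurring infinitely often and the gaps between ramps growing.
   Seen from a high level, Phi(ts)/Phi(s) is at most C t^p, and at least c t^p with c depending only on N;
   as N grows the ramps become so flat that every bounded window again looks like t^p.  A normalized
   disjoint sequence distributes mass one over such levels, and an average of functions that are at most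
   C t^p and at least c_N t^p is still equivalent to t^p: hence (p-DH).
   For the conjugate Psi the inequalities reverse: Psi(ts)/Psi(s) is at least c t^q, and at most C_N t^q,
   where C_N grows geometrically in N.  Indicators see a single level, so they span l_q after passing to a
   subsequence, but mixing the levels of all N with summable weights destroys the upper q-estimate.
   Such mixtures X_k are not equivalent to sequences living on one N, so DH fails.  If the span of X_k were
   complemented, the diagonal of the projection would be bounded too; applied to the truncations of X_k
   to the first K types, which do satisfy an upper q-estimate, it would give back more than half of
   X_k, so X_k would satisfy the estimate as well. *)
theory Submission
  imports Defs
begin

section \<open>Modulars and the Luxemburg norm\<close>

text \<open>Everything is reduced to inequalities for the modular. By disjointness the modular of a
  linear combination is the sum of the modulars of its terms, and the k-th term of a subsequence
  need only be tested at scalars between 1 / 2 ^ k and 1: smaller scalars contribute at most a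
  multiple of 1 / 2 ^ k, which is summable. So estimates on finite windows of levels suffice,
  provided that their constants do not depend on the window. The asymmetry between the two spaces
  starts here. A lower estimate survives throwing away most of a function, so a fixed share of mass
  on kinds with one constant is enough; an upper estimate must hold for all of the mass, and fails
  when the constants outgrow the weights. A ramp of kind N has length (N + 1)^2 to meet two demands:
  an unbounded total rise N + 1, and a rise of at most 1 over any N + 1 steps. The doubling
  condition, which holds globally for both functions, replaces continuity of the modular: at the
  norm its value lies between 1 / D and D.\<close>

abbreviation mb :: "(real \<Rightarrow> real) \<Rightarrow> bool" where
  "mb f \<equiv> set_borel_measurable lebesgue {0..1} f"

lemma mb_add: "mb f \<Longrightarrow> mb g \<Longrightarrow> mb (\<lambda>x. f x + g x)"
  unfolding set_borel_measurable_def scaleR_add_right by simp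

lemma mb_cmult: "mb f \<Longrightarrow> mb (\<lambda>x. c * f x)"
  unfolding set_borel_measurable_def by (simp add: mult.left_commute)

lemma mb_divide: "mb f \<Longrightarrow> mb (\<lambda>x. f x / c)"
  using mb_cmult[of f "1 / c"] by simp

lemma mb_zero: "mb (\<lambda>x. 0)"
  unfolding set_borel_measurable_def by simp

lemma mb_sum: "(\<And>i. i \<in> I \<Longrightarrow> mb (f i)) \<Longrightarrow> mb (\<lambda>x. \<Sum>i\<in>I. f i x)"
  by (induction I rule: infinite_finite_induct) (simp_all add: mb_zero mb_add)

lemma mb_indicator: "S \<in> sets lebesgue \<Longrightarrow> mb f \<Longrightarrow> mb (\<lambda>x. indicator S x * f x)"
  unfolding set_borel_measurable_def by (simp add: mult.left_commute)

lemma mb_vimage: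
  assumes "mb f" "B \<in> sets borel"
  shows "{x \<in> {0..1}. f x \<in> B} \<in> sets lebesgue"
proof -
  have "{x \<in> {0..1}. f x \<in> B} = {0..1} \<inter> ((\<lambda>x. indicator {0..1} x *\<^sub>R f x) -` B \<inter> space lebesgue)"
    by (auto simp: indicator_def)
  moreover have "(\<lambda>x. indicator {0..1} x *\<^sub>R f x) -` B \<inter> space lebesgue \<in> sets lebesgue"
    using assms unfolding set_borel_measurable_def by (rule measurable_sets)
  ultimately show ?thesis by (auto intro!: sets.Int)
qed

lemma overlap_measurable:
  assumes "mb f" "mb g"
  shows "{x \<in> {0..1}. f x \<noteq> 0 \<and> g x \<noteq> 0} \<in> sets lebesgue"
proof -
  have "{x \<in> {0..1}. f x \<noteq> 0 \<and> g x \<noteq> 0} = {x \<in> {0..1}. f x \<in> - {0}} \<inter> {x \<in> {0..1}. g x \<in> - {0}}" by blast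
  also have "\<dots> \<in> sets lebesgue" by (intro sets.Int mb_vimage assms) simp_all
  finally show ?thesis .
qed

text \<open>\<open>emeasure\<close> is 0 on every non-measurable set, so \<open>disjoint_fun\<close>
  alone does not say that the overlap is negligible; measurability of both functions closes that
  gap.\<close>

lemma disjoint_fun_iff_null:
  assumes "mb f" "mb g"
  shows "disjoint_fun f g \<longleftrightarrow> {x \<in> {0..1}. f x \<noteq> 0 \<and> g x \<noteq> 0} \<in> null_sets lebesgue"
  using overlap_measurable[OF assms] unfolding disjoint_fun_def null_sets_def by blast

text \<open>The global Delta_2 condition. It will hold for Phi and for its conjugate, so one
  development serves both; a factor 2 in the argument can always be traded for a factor D in the
  modular.\<close>

locale orlicz_delta2 =
  fixes G :: "real \<Rightarrow> real" and D :: real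
  assumes orlicz: "orlicz_function G"
    and double: "0 \<le> t \<Longrightarrow> G (2 * t) \<le> D * G t"
begin

lemma G_mono: "0 \<le> a \<Longrightarrow> a \<le> b \<Longrightarrow> G a \<le> G b"
  using orlicz unfolding orlicz_function_def mono_on_def by auto

lemma G_0 [simp]: "G 0 = 0"
  using orlicz unfolding orlicz_function_def by auto

lemma G_nonneg [simp]: "0 \<le> a \<Longrightarrow> 0 \<le> G a"
  using G_mono[of 0 a] by simp

lemma G_convex:
  assumes "0 \<le> a" "0 \<le> b" "0 \<le> u" "u \<le> 1"
  shows "G (u * a + (1 - u) * b) \<le> u * G a + (1 - u) * G b"
proof -
  have "convex_on {0..} G" using orlicz unfolding orlicz_function_def by auto
  from convex_onD[OF this, of u b a] assms show ?thesis by (simp add: algebra_simps)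
qed

lemma G_scale: "0 \<le> a \<Longrightarrow> 0 \<le> u \<Longrightarrow> u \<le> 1 \<Longrightarrow> G (u * a) \<le> u * G a"
  using G_convex[of a 0 u] by simp

lemma G_large: "\<exists>s\<ge>s0. b \<le> G s"
proof -
  have "filterlim G at_top at_top" using orlicz unfolding orlicz_function_def by auto
  then have "eventually (\<lambda>s. b \<le> G s) at_top" by (simp add: filterlim_at_top)
  then obtain s1 where "\<And>s. s1 \<le> s \<Longrightarrow> b \<le> G s" by (auto simp: eventually_at_top_linorder)
  then show ?thesis by (intro exI[of _ "max s0 s1"]) auto
qed

lemma G_pos: "0 < t \<Longrightarrow> 0 < G t"
proof -
  assume t: "0 < t"
  obtain s where s: "s \<ge> t" "1 \<le> G s" using G_large by blast
  \<comment> \<open>If G vanished at t, doubling would propagate the zero to arbitrarily large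
    arguments. The base is \<open>max 0 D\<close> because \<open>D_ge_1\<close> is itself derived
    from this lemma.\<close>
  have pow: "G (2 ^ n * t) \<le> (max 0 D) ^ n * G t" for n
  proof (induction n)
    case (Suc n)
    have "G (2 ^ Suc n * t) \<le> D * G (2 ^ n * t)" using double[of "2 ^ n * t"] t by (simp add: mult.assoc)
    also have "\<dots> \<le> max 0 D * G (2 ^ n * t)" using t by (intro mult_right_mono) auto
    also have "\<dots> \<le> max 0 D * ((max 0 D) ^ n * G t)" using Suc by (intro mult_left_mono) auto
    finally show ?case by simp
  qed simp
  obtain n where "s / t < 2 ^ n" using real_arch_pow[of 2 "s / t"] by auto
  then have "G s \<le> G (2 ^ n * t)" using s t by (intro G_mono) (auto simp: field_simps)
  with s pow[of n] have "0 < (max 0 D) ^ n * G t" by linarith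
  then have "G t \<noteq> 0" by auto
  then show "0 < G t" using G_nonneg[of t] t by linarith
qed

lemma D_ge_1: "1 \<le> D"
proof -
  have "1 * G 1 \<le> D * G 1" using double[of 1] G_mono[of 1 2] by simp
  then show ?thesis using G_pos[of 1] by (simp add: mult_le_cancel_right)
qed

lemma G_measurable:
  assumes "mb f"
  shows "(\<lambda>x. ennreal (G \<bar>f x\<bar>) * indicator {0..1} x) \<in> borel_measurable lebesgue"
proof -
  \<comment> \<open>G is monotone only on the half-line; extending it by G 0 to the left gives a
    function that is monotone everywhere, hence Borel.\<close>
  define H where "H t = G (max 0 t)" for t
  have "mono H" unfolding H_def by (intro monoI G_mono) auto
  then have H: "H \<in> borel_measurable borel" by (rule borel_measurable_mono)
  have "(\<lambda>x. \<bar>indicator {0..1} x *\<^sub>R f x\<bar>) \<in> borel_measurable lebesgue"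
    using assms unfolding set_borel_measurable_def by (rule borel_measurable_abs)
  then have "(\<lambda>x. H \<bar>indicator {0..1} x *\<^sub>R f x\<bar>) \<in> borel_measurable lebesgue"
    using H by (rule measurable_compose)
  then have "(\<lambda>x. ennreal (H \<bar>indicator {0..1} x *\<^sub>R f x\<bar>)) \<in> borel_measurable lebesgue"
    by (rule measurable_compose) simp
  moreover have "ennreal (H \<bar>indicator {0..1} x *\<^sub>R f x\<bar>) = ennreal (G \<bar>f x\<bar>) * indicator {0..1} x" for x
    by (auto simp: H_def indicator_def)
  ultimately show ?thesis by simp
qed

lemma modular_mono:
  "(\<And>x. x \<in> {0..1} \<Longrightarrow> \<bar>f x\<bar> \<le> \<bar>g x\<bar>) \<Longrightarrow> modular G f \<le> modular G g"
  unfolding modular_def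
  by (intro nn_integral_mono) (auto simp: indicator_def intro!: ennreal_leI G_mono)

lemma modular_convex:
  assumes "mb f" "mb g" "0 \<le> u" "u \<le> 1"
  shows "modular G (\<lambda>x. u * f x + (1 - u) * g x) \<le> ennreal u * modular G f + ennreal (1 - u) * modular G g"
proof -
  have "ennreal (G \<bar>u * f x + (1 - u) * g x\<bar>) * indicator {0..1} x
      \<le> ennreal u * (ennreal (G \<bar>f x\<bar>) * indicator {0..1} x)
        + ennreal (1 - u) * (ennreal (G \<bar>g x\<bar>) * indicator {0..1} x)" for x
  proof (cases "x \<in> {0..1::real}")
    case True
    have "\<bar>u * f x + (1 - u) * g x\<bar> \<le> u * \<bar>f x\<bar> + (1 - u) * \<bar>g x\<bar>"
      using abs_triangle_ineq[of "u * f x" "(1 - u) * g x"] assms by (simp add: abs_mult)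
    then have "G \<bar>u * f x + (1 - u) * g x\<bar> \<le> u * G \<bar>f x\<bar> + (1 - u) * G \<bar>g x\<bar>"
      using G_mono[of "\<bar>u * f x + (1 - u) * g x\<bar>" "u * \<bar>f x\<bar> + (1 - u) * \<bar>g x\<bar>"]
        G_convex[of "\<bar>f x\<bar>" "\<bar>g x\<bar>" u] assms by simp
    then show ?thesis using True assms
      by (simp add: ennreal_mult[symmetric] ennreal_plus[symmetric] del: ennreal_plus)
  qed simp
  then have "modular G (\<lambda>x. u * f x + (1 - u) * g x) \<le>
     (\<integral>\<^sup>+x. ennreal u * (ennreal (G \<bar>f x\<bar>) * indicator {0..1} x)
        + ennreal (1 - u) * (ennreal (G \<bar>g x\<bar>) * indicator {0..1} x) \<partial>lebesgue)"
    unfolding modular_def by (rule nn_integral_mono)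
  also have "\<dots> = ennreal u * modular G f + ennreal (1 - u) * modular G g"
    unfolding modular_def using G_measurable[OF assms(1)] G_measurable[OF assms(2)]
    by (simp add: nn_integral_add nn_integral_cmult)
  finally show ?thesis .
qed

lemma modular_zero [simp]: "modular G (\<lambda>x. 0) = 0"
  unfolding modular_def by simp

lemma modular_scale:
  "mb f \<Longrightarrow> 0 \<le> u \<Longrightarrow> u \<le> 1 \<Longrightarrow> modular G (\<lambda>x. u * f x) \<le> ennreal u * modular G f"
  using modular_convex[of f "\<lambda>x. 0" u] mb_zero by simp

lemma modular_double: "mb f \<Longrightarrow> modular G (\<lambda>x. 2 * f x) \<le> ennreal D * modular G f"
proof -
  assume f: "mb f"
  have "modular G (\<lambda>x. 2 * f x) \<le> (\<integral>\<^sup>+x. ennreal D * (ennreal (G \<bar>f x\<bar>) * indicator {0..1} x) \<partial>lebesgue)"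
    unfolding modular_def
  proof (rule nn_integral_mono)
    fix x
    have "G \<bar>2 * f x\<bar> \<le> D * G \<bar>f x\<bar>" using double[of "\<bar>f x\<bar>"] by (simp add: abs_mult)
    then have "ennreal (G \<bar>2 * f x\<bar>) \<le> ennreal D * ennreal (G \<bar>f x\<bar>)"
      using D_ge_1 by (simp add: ennreal_mult[symmetric] ennreal_leI)
    then show "ennreal (G \<bar>2 * f x\<bar>) * indicator {0..1} x \<le> ennreal D * (ennreal (G \<bar>f x\<bar>) * indicator {0..1} x)"
      by (auto simp: indicator_def)
  qed
  also have "\<dots> = ennreal D * modular G f"
    unfolding modular_def using G_measurable[OF f] by (simp add: nn_integral_cmult)
  finally show ?thesis .
qed

lemma modular_disjoint_add:
  assumes "mb f" "mb g" "disjoint_fun f g"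
  shows "modular G (\<lambda>x. f x + g x) = modular G f + modular G g"
proof -
  let ?S = "{x \<in> {0..1}. f x \<noteq> 0 \<and> g x \<noteq> 0}"
  have "?S \<in> null_sets lebesgue" using disjoint_fun_iff_null[OF assms(1,2)] assms(3) by blast
  then have "AE x in lebesgue. x \<notin> ?S" by (rule AE_not_in)
  then have ae: "AE x in lebesgue. ennreal (G \<bar>f x + g x\<bar>) * indicator {0..1} x =
      ennreal (G \<bar>f x\<bar>) * indicator {0..1} x + ennreal (G \<bar>g x\<bar>) * indicator {0..1} x"
    by (rule AE_mp) (rule AE_I2, auto simp: indicator_def)
  show ?thesis unfolding modular_def nn_integral_cong_AE[OF ae]
    using G_measurable[OF assms(1)] G_measurable[OF assms(2)] by (rule nn_integral_add)
qed

lemma disjoint_fun_sum: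
  assumes "finite I" "\<And>i. i \<in> I \<Longrightarrow> mb (f i)" "mb g" "\<And>i. i \<in> I \<Longrightarrow> disjoint_fun (f i) g"
  shows "disjoint_fun (\<lambda>x. \<Sum>i\<in>I. f i x) g"
proof -
  let ?S = "\<lambda>f. {x \<in> {0..1}. f x \<noteq> 0 \<and> g x \<noteq> 0}"
  have "?S (f i) \<in> null_sets lebesgue" if "i \<in> I" for i
    using disjoint_fun_iff_null[OF assms(2,3)] assms(4) that by blast
  then have "(\<Union>i\<in>I. ?S (f i)) \<in> null_sets lebesgue" using assms(1) by (intro null_sets.finite_UN) auto
  moreover have "?S (\<lambda>x. \<Sum>i\<in>I. f i x) \<subseteq> (\<Union>i\<in>I. ?S (f i))" 
    using sum.not_neutral_contains_not_neutral by fastforce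
  moreover have "?S (\<lambda>x. \<Sum>i\<in>I. f i x) \<in> sets lebesgue"
    by (intro overlap_measurable mb_sum assms(2,3))
  ultimately have "?S (\<lambda>x. \<Sum>i\<in>I. f i x) \<in> null_sets lebesgue" by (blast intro: null_sets_subset)
  then show ?thesis unfolding disjoint_fun_def by (rule null_setsD1)
qed

lemma modular_disjoint_sum:
  assumes "finite I" "\<And>i. i \<in> I \<Longrightarrow> mb (f i)"
    "\<And>i j. i \<in> I \<Longrightarrow> j \<in> I \<Longrightarrow> i \<noteq> j \<Longrightarrow> disjoint_fun (f i) (f j)"
  shows "modular G (\<lambda>x. \<Sum>i\<in>I. f i x) = (\<Sum>i\<in>I. modular G (f i))"
  using assms
proof (induction I rule: finite_induct)
  case (insert i I)
  have "disjoint_fun (\<lambda>x. \<Sum>i\<in>I. f i x) (f i)"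
    using insert by (intro disjoint_fun_sum) auto
  then have "disjoint_fun (f i) (\<lambda>x. \<Sum>i\<in>I. f i x)"
    unfolding disjoint_fun_def by (simp add: conj_commute)
  then have "modular G (\<lambda>x. f i x + (\<Sum>i\<in>I. f i x)) = modular G (f i) + modular G (\<lambda>x. \<Sum>i\<in>I. f i x)"
    using insert by (intro modular_disjoint_add mb_sum) auto
  then show ?case using insert by simp
qed simp

section \<open>The Luxemburg norm as a lattice seminorm\<close>

lemma lux_le: "0 < l \<Longrightarrow> modular G (\<lambda>x. f x / l) \<le> 1 \<Longrightarrow> lux_norm G f \<le> l"
  unfolding lux_norm_def by (rule cInf_lower) (auto intro: bdd_belowI[of _ 0])

lemma orlicz_mb: "f \<in> orlicz_space G \<Longrightarrow> mb f"
  unfolding orlicz_space_def by auto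

lemma lux_less:
  assumes "f \<in> orlicz_space G" "lux_norm G f < l"
  shows "0 < l \<and> modular G (\<lambda>x. f x / l) \<le> 1"
proof -
  let ?L = "{l. l > 0 \<and> modular G (\<lambda>x. f x / l) \<le> 1}"
  have "?L \<noteq> {}" using assms(1) unfolding orlicz_space_def by auto
  then obtain l' where l': "l' \<in> ?L" "l' < l"
    using assms(2) cInf_lessD[of ?L l] unfolding lux_norm_def by blast
  have "modular G (\<lambda>x. f x / l) \<le> modular G (\<lambda>x. f x / l')"
    using l' by (intro modular_mono) (simp add: abs_divide frac_le)
  then show ?thesis using l' by auto
qed

lemma lux_ge:
  assumes "f \<in> orlicz_space G" "\<And>l. 0 < l \<Longrightarrow> modular G (\<lambda>x. f x / l) \<le> 1 \<Longrightarrow> c \<le> l"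
  shows "c \<le> lux_norm G f"
proof (rule ccontr)
  assume "\<not> c \<le> lux_norm G f"
  then have less: "lux_norm G f < (lux_norm G f + c) / 2" "(lux_norm G f + c) / 2 < c" by auto
  from lux_less[OF assms(1) less(1)] assms(2) less(2) show False by fastforce
qed

lemma lux_nonneg: "f \<in> orlicz_space G \<Longrightarrow> 0 \<le> lux_norm G f"
  by (rule lux_ge) auto

lemma orlicz_spaceI: "mb f \<Longrightarrow> 0 < l \<Longrightarrow> modular G (\<lambda>x. f x / l) \<le> 1 \<Longrightarrow> f \<in> orlicz_space G"
  unfolding orlicz_space_def by auto

lemma orlicz_obtain:
  assumes "f \<in> orlicz_space G"
  obtains l where "0 < l" "modular G (\<lambda>x. f x / l) \<le> 1" "lux_norm G f \<le> l"
  using assms lux_le unfolding orlicz_space_def by auto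

lemma orlicz_zero [simp]: "(\<lambda>x. 0) \<in> orlicz_space G"
  by (rule orlicz_spaceI[of _ 1]) (auto simp: mb_zero)

lemma lux_zero [simp]: "lux_norm G (\<lambda>x. 0) = 0"
proof -
  have "lux_norm G (\<lambda>x. 0) \<le> e" if "0 < e" for e by (rule lux_le) (auto simp: that)
  then show ?thesis using lux_nonneg[OF orlicz_zero] by (metis dense_ge order_antisym)
qed

lemma orlicz_dominated:
  assumes "f \<in> orlicz_space G" "mb g" "\<And>x. x \<in> {0..1} \<Longrightarrow> \<bar>g x\<bar> \<le> \<bar>f x\<bar>"
  shows "g \<in> orlicz_space G" "lux_norm G g \<le> lux_norm G f"
proof -
  have *: "modular G (\<lambda>x. g x / l) \<le> modular G (\<lambda>x. f x / l)" if "0 < l" for l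
    using assms(3) that by (intro modular_mono) (auto intro!: divide_right_mono)
  obtain l where l: "0 < l" "modular G (\<lambda>x. f x / l) \<le> 1" using orlicz_obtain[OF assms(1)] .
  show "g \<in> orlicz_space G" using orlicz_spaceI[OF assms(2) l(1)] *[OF l(1)] l(2) by auto
  show "lux_norm G g \<le> lux_norm G f"
  proof (rule lux_ge[OF assms(1)])
    fix l :: real assume "0 < l" "modular G (\<lambda>x. f x / l) \<le> 1"
    then show "lux_norm G g \<le> l" using *[of l] by (intro lux_le) auto
  qed
qed

lemma orlicz_scale:
  assumes "f \<in> orlicz_space G"
  shows "(\<lambda>x. c * f x) \<in> orlicz_space G"
    and "lux_norm G (\<lambda>x. c * f x) = \<bar>c\<bar> * lux_norm G f"
proof -
  have mod_eq: "modular G (\<lambda>x. c * f x / (\<bar>c\<bar> * l)) = modular G (\<lambda>x. f x / l)" if "c \<noteq> 0" for c l f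
    using that unfolding modular_def by (simp add: abs_mult)
  have in_space: "(\<lambda>x. c * f x) \<in> orlicz_space G" if f: "f \<in> orlicz_space G" for c f
  proof (cases "c = 0")
    case False
    obtain l where l: "0 < l" "modular G (\<lambda>x. f x / l) \<le> 1" using orlicz_obtain[OF f] .
    then have "modular G (\<lambda>x. c * f x / (\<bar>c\<bar> * l)) \<le> 1" using mod_eq[OF False, of f l] by simp
    then show ?thesis using False l(1)
      by (intro orlicz_spaceI[OF mb_cmult[OF orlicz_mb[OF f]], of "\<bar>c\<bar> * l"]) auto
  qed simp
  have le: "lux_norm G (\<lambda>x. c * f x) \<le> \<bar>c\<bar> * lux_norm G f" if "c \<noteq> 0" "f \<in> orlicz_space G" for c f
  proof -
    have "lux_norm G (\<lambda>x. c * f x) / \<bar>c\<bar> \<le> lux_norm G f"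
    proof (rule lux_ge[OF that(2)])
      fix l :: real assume l: "0 < l" "modular G (\<lambda>x. f x / l) \<le> 1"
      then have "lux_norm G (\<lambda>x. c * f x) \<le> \<bar>c\<bar> * l"
        using that mod_eq[OF that(1), of f l] by (intro lux_le) auto
      then show "lux_norm G (\<lambda>x. c * f x) / \<bar>c\<bar> \<le> l" using that by (simp add: field_simps)
    qed
    then show ?thesis using that by (simp add: field_simps)
  qed
  show "(\<lambda>x. c * f x) \<in> orlicz_space G" by (rule in_space[OF assms])
  show "lux_norm G (\<lambda>x. c * f x) = \<bar>c\<bar> * lux_norm G f"
  proof (cases "c = 0")
    case False
    then have "lux_norm G f \<le> \<bar>1 / c\<bar> * lux_norm G (\<lambda>x. c * f x)"
      using le[of "1 / c" "\<lambda>x. c * f x"] in_space[OF assms, of c] by simp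
    then show ?thesis using le[OF False assms] False by (simp add: field_simps abs_divide)
  qed simp
qed

lemma orlicz_add:
  assumes "f \<in> orlicz_space G" "g \<in> orlicz_space G"
  shows "(\<lambda>x. f x + g x) \<in> orlicz_space G"
    and "lux_norm G (\<lambda>x. f x + g x) \<le> lux_norm G f + lux_norm G g"
proof -
  have sum: "modular G (\<lambda>x. (f x + g x) / (a + b)) \<le> 1"
    if "0 < a" "modular G (\<lambda>x. f x / a) \<le> 1" "0 < b" "modular G (\<lambda>x. g x / b) \<le> 1" for a b
  proof -
    \<comment> \<open>The convex weight that writes (f + g) / (a + b) as a mean of f / a and g / b,
      as for any gauge.\<close>
    define u where "u = a / (a + b)"
    have u: "0 \<le> u" "u \<le> 1" "1 - u = b / (a + b)" using that by (auto simp: u_def field_simps)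
    have "modular G (\<lambda>x. (f x + g x) / (a + b)) = modular G (\<lambda>x. u * (f x / a) + (1 - u) * (g x / b))"
      using that unfolding u(3) unfolding u_def by (simp add: add_divide_distrib)
    also have "\<dots> \<le> ennreal u * modular G (\<lambda>x. f x / a) + ennreal (1 - u) * modular G (\<lambda>x. g x / b)"
      using u by (intro modular_convex mb_divide orlicz_mb assms) auto
    also have "\<dots> \<le> ennreal u * 1 + ennreal (1 - u) * 1"
      using that by (intro add_mono mult_left_mono) auto
    also have "\<dots> = 1" using u by (simp add: ennreal_plus[symmetric] del: ennreal_plus)
    finally show ?thesis .
  qed
  obtain a where a: "0 < a" "modular G (\<lambda>x. f x / a) \<le> 1" using orlicz_obtain[OF assms(1)] .
  obtain b where b: "0 < b" "modular G (\<lambda>x. g x / b) \<le> 1" using orlicz_obtain[OF assms(2)] .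
  show "(\<lambda>x. f x + g x) \<in> orlicz_space G"
    using sum[OF a b] a b
    by (intro orlicz_spaceI[OF mb_add[OF orlicz_mb[OF assms(1)] orlicz_mb[OF assms(2)]], of "a + b"]) auto
  show "lux_norm G (\<lambda>x. f x + g x) \<le> lux_norm G f + lux_norm G g"
  proof (rule field_le_epsilon)
    fix e :: real assume "0 < e"
    then have "lux_norm G f < lux_norm G f + e / 2" "lux_norm G g < lux_norm G g + e / 2" by auto
    from sum[OF lux_less[OF assms(1) this(1), THEN conjunct1] lux_less[OF assms(1) this(1), THEN conjunct2]
        lux_less[OF assms(2) this(2), THEN conjunct1] lux_less[OF assms(2) this(2), THEN conjunct2]]
      lux_less[OF assms(1) this(1)] lux_less[OF assms(2) this(2)]
    have "lux_norm G (\<lambda>x. f x + g x) \<le> (lux_norm G f + e / 2) + (lux_norm G g + e / 2)"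
      by (intro lux_le) auto
    then show "lux_norm G (\<lambda>x. f x + g x) \<le> lux_norm G f + lux_norm G g + e" by simp
  qed
qed

lemma orlicz_diff:
  assumes "f \<in> orlicz_space G" "g \<in> orlicz_space G"
  shows "(\<lambda>x. f x - g x) \<in> orlicz_space G"
    and "lux_norm G (\<lambda>x. f x - g x) \<le> lux_norm G f + lux_norm G g"
  using orlicz_add[OF assms(1) orlicz_scale(1)[OF assms(2), of "-1"]] orlicz_scale(2)[OF assms(2), of "-1"]
  by auto

lemma orlicz_sum:
  assumes "finite I" "\<And>i. i \<in> I \<Longrightarrow> f i \<in> orlicz_space G"
  shows "(\<lambda>x. \<Sum>i\<in>I. f i x) \<in> orlicz_space G"
    and "lux_norm G (\<lambda>x. \<Sum>i\<in>I. f i x) \<le> (\<Sum>i\<in>I. lux_norm G (f i))"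
  using assms
proof (induction I rule: finite_induct)
  case (insert i I)
  { case 1 show ?case using insert 1 orlicz_add(1)[of "f i" "\<lambda>x. \<Sum>i\<in>I. f i x"] by simp
  next case 2 show ?case using insert 2 orlicz_add(2)[of "f i" "\<lambda>x. \<Sum>i\<in>I. f i x"] by force }
qed auto

lemma orlicz_lin_comb: "(\<And>i. i < N \<Longrightarrow> y i \<in> orlicz_space G) \<Longrightarrow> lin_comb a y N \<in> orlicz_space G"
  unfolding lin_comb_def by (intro orlicz_sum(1) orlicz_scale(1)) auto

lemma modular_bound_lux:
  assumes "mb f" "modular G f \<le> ennreal E" "1 \<le> E"
  shows "f \<in> orlicz_space G" "lux_norm G f \<le> E"
proof -
  have "modular G (\<lambda>x. (1 / E) * f x) \<le> ennreal (1 / E) * modular G f"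
    using assms by (intro modular_scale) auto
  also have "\<dots> \<le> ennreal (1 / E) * ennreal E" using assms by (intro mult_left_mono) auto
  also have "\<dots> = 1" using assms by (simp add: ennreal_mult[symmetric])
  finally have "modular G (\<lambda>x. f x / E) \<le> 1" by simp
  then show "f \<in> orlicz_space G" "lux_norm G f \<le> E"
    using assms orlicz_spaceI[of f E] lux_le[of E f] by auto
qed

text \<open>Attainment of the infimum is avoided: twice the norm is admissible and half the norm is
  not, and doubling transfers both facts to the norm itself at the cost of D.\<close>

lemma modular_at_norm:
  assumes "f \<in> orlicz_space G" "0 < lux_norm G f"
  shows "modular G (\<lambda>x. f x / lux_norm G f) \<le> ennreal D"
    and "1 \<le> ennreal D * modular G (\<lambda>x. f x / lux_norm G f)"
proof -
  let ?l = "lux_norm G f"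
  have "modular G (\<lambda>x. f x / ?l) = modular G (\<lambda>x. 2 * (f x / (2 * ?l)))" by simp
  also have "\<dots> \<le> ennreal D * modular G (\<lambda>x. f x / (2 * ?l))"
    by (intro modular_double mb_divide orlicz_mb assms)
  also have "\<dots> \<le> ennreal D * 1"
    using lux_less[OF assms(1), of "2 * ?l"] assms(2) by (intro mult_left_mono) auto
  finally show "modular G (\<lambda>x. f x / ?l) \<le> ennreal D" by simp
  have "\<not> modular G (\<lambda>x. f x / (?l / 2)) \<le> 1" using lux_le[of "?l / 2" f] assms(2) by auto
  moreover have "(\<lambda>x. f x / (?l / 2)) = (\<lambda>x. 2 * (f x / ?l))" by (simp add: fun_eq_iff)
  ultimately have "1 \<le> modular G (\<lambda>x. 2 * (f x / ?l))" by simp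
  also have "\<dots> \<le> ennreal D * modular G (\<lambda>x. f x / ?l)"
    by (intro modular_double mb_divide orlicz_mb assms)
  finally show "1 \<le> ennreal D * modular G (\<lambda>x. f x / ?l)" .
qed

end

section \<open>Power estimates and the diagonal principle\<close>

lemma sum_half_powers_le: "(\<Sum>i<N. 1 / 2 ^ i :: real) \<le> 2"
proof -
  have "(\<Sum>i<N. 1 / 2 ^ i :: real) = 2 - 2 / 2 ^ N" by (induction N) (auto simp: field_simps)
  then show ?thesis by simp
qed

text \<open>Only null overlaps are assumed, which is what supports of disjoint functions satisfy;
  the measures are then summable with total at most 1.\<close>

lemma measure_disjoint_tendsto_0:
  fixes B :: "nat \<Rightarrow> real set"
  assumes "\<And>n. B n \<in> sets lebesgue" "\<And>n. B n \<subseteq> {0..1}"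
    and "\<And>m n. m \<noteq> n \<Longrightarrow> emeasure lebesgue (B m \<inter> B n) = 0"
  shows "(\<lambda>n. measure lebesgue (B n)) \<longlonglongrightarrow> 0"
proof -
  have fm: "B n \<in> lmeasurable" for n
    using assms(1,2) by (meson bounded_set_imp_lmeasurable bounded_closed_interval bounded_subset)
  have "sum (\<lambda>n. measure lebesgue (B n)) {..<N} \<le> 1" for N
  proof -
    have "measure lebesgue (\<Union>n<N. B n) = (\<Sum>n<N. measure lebesgue (B n))"
    proof (rule measure_negligible_finite_Union_image)
      show "pairwise (\<lambda>m n. negligible (B m \<inter> B n)) {..<N}"
        using assms fm by (auto simp: pairwise_def negligible_iff_null_sets null_sets_def)
    qed (use fm in auto)
    moreover have "measure lebesgue (\<Union>n<N. B n) \<le> measure lebesgue {0..1::real}"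
      using assms(1,2) by (intro measure_mono_fmeasurable) auto
    ultimately show ?thesis by simp
  qed
  then have "summable (\<lambda>n. measure lebesgue (B n))"
    by (intro summableI_nonneg_bounded) auto
  then show ?thesis by (rule summable_LIMSEQ_zero)
qed

section \<open>Estimates in l_r from modular bounds, and the diagonal of an operator\<close>

context orlicz_delta2
begin

lemma modular_abs_scale: "modular G (\<lambda>x. c * f x) = modular G (\<lambda>x. \<bar>c\<bar> * f x)"
  unfolding modular_def by (simp add: abs_mult)

lemma disjoint_fun_scale: "disjoint_fun f g \<Longrightarrow> disjoint_fun (\<lambda>x. a * f x) (\<lambda>x. b * g x)"
proof -
  assume "disjoint_fun f g"
  moreover have "{x \<in> {0..1}. a * f x \<noteq> 0 \<and> b * g x \<noteq> 0}
      = (if a = 0 \<or> b = 0 then {} else {x \<in> {0..1}. f x \<noteq> 0 \<and> g x \<noteq> 0})"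
    by (simp add: set_eq_iff)
  ultimately show ?thesis unfolding disjoint_fun_def by (simp split: if_split)
qed

lemma modular_lin_comb:
  assumes "\<And>i. mb (y i)" "disjoint_seq y"
  shows "modular G (lin_comb a y N) = (\<Sum>i<N. modular G (\<lambda>x. \<bar>a i\<bar> * y i x))"
proof -
  have "modular G (lin_comb a y N) = (\<Sum>i<N. modular G (\<lambda>x. a i * y i x))"
    unfolding lin_comb_def
    using assms by (intro modular_disjoint_sum mb_cmult disjoint_fun_scale) (auto simp: disjoint_seq_def)
  then show ?thesis using modular_abs_scale by simp
qed

lemma modular_lin_comb_divide:
  assumes "\<And>i. mb (y i)" "disjoint_seq y" "0 < l"
  shows "modular G (\<lambda>x. lin_comb a y N x / l) = (\<Sum>i<N. modular G (\<lambda>x. \<bar>a i\<bar> / l * y i x))"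
proof -
  have "(\<lambda>x. lin_comb a y N x / l) = lin_comb (\<lambda>i. a i / l) y N"
    by (auto simp: lin_comb_def sum_divide_distrib)
  then show ?thesis using modular_lin_comb[OF assms(1,2), of "\<lambda>i. a i / l" N] assms(3) by simp
qed

lemma modular_scale_mono: "0 \<le> s \<Longrightarrow> s \<le> t \<Longrightarrow> modular G (\<lambda>x. s * f x) \<le> modular G (\<lambda>x. t * f x)"
  by (rule modular_mono) (auto simp: abs_mult intro: mult_right_mono)

text \<open>After normalisation to l_r norm 1 the coefficients have modulus at most 1. Those of
  modulus at least 1 / 2 ^ i fall in the tested window; a smaller i-th one is replaced by 1 / 2 ^ i
  at the cost C / 2 ^ i. The modular is thus at most C + 2 C, the 3 C of the conclusion.\<close>

lemma powr_upper_estimate: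
  assumes "1 \<le> r" "0 \<le> C" "\<And>i. mb (y i)" "disjoint_seq y"
    and le: "\<And>k t. 1 / 2 ^ k \<le> t \<Longrightarrow> t \<le> 1 \<Longrightarrow> modular G (\<lambda>x. t * y k x) \<le> ennreal (C * t powr r)"
  shows "lux_norm G (lin_comb a y N) \<le> max 1 (3 * C) * (\<Sum>i<N. \<bar>a i\<bar> powr r) powr (1 / r)"
proof -
  define R where "R = (\<Sum>i<N. \<bar>a i\<bar> powr r) powr (1 / r)"
  have Rr: "R powr r = (\<Sum>i<N. \<bar>a i\<bar> powr r)"
    unfolding R_def using assms(1) by (simp add: powr_powr sum_nonneg)
  show ?thesis
  proof (cases "R = 0")
    case True
    then have "(\<Sum>i<N. \<bar>a i\<bar> powr r) = 0" using Rr by simp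
    then have "\<And>i. i < N \<Longrightarrow> a i = 0" by (subst (asm) sum_nonneg_eq_0_iff) auto
    then have "lin_comb a y N = (\<lambda>x. 0)" by (auto simp: lin_comb_def)
    then show ?thesis by simp
  next
    case False
    then have R: "0 < R" by (simp add: R_def less_le)
    have b_le: "\<bar>a i\<bar> / R \<le> 1" if "i < N" for i
    proof -
      have "\<bar>a i\<bar> powr r \<le> R powr r"
        unfolding Rr using that by (intro member_le_sum) auto
      then have "\<bar>a i\<bar> \<le> R" using R assms(1) powr_less_mono2[of r R "\<bar>a i\<bar>"] by fastforce
      then show ?thesis using R by simp
    qed
    have bsum: "(\<Sum>i<N. (\<bar>a i\<bar> / R) powr r) = 1"
      using R Rr[symmetric] by (simp add: powr_divide sum_divide_distrib[symmetric])
    have part: "modular G (\<lambda>x. \<bar>a i\<bar> / R * y i x) \<le> ennreal (C * (\<bar>a i\<bar> / R) powr r + C * (1 / 2 ^ i))"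
      if "i < N" for i
    proof (cases "1 / 2 ^ i \<le> \<bar>a i\<bar> / R")
      case True
      then have "modular G (\<lambda>x. \<bar>a i\<bar> / R * y i x) \<le> ennreal (C * (\<bar>a i\<bar> / R) powr r)"
        by (rule le) (rule b_le[OF that])
      also have "\<dots> \<le> ennreal (C * (\<bar>a i\<bar> / R) powr r + C * (1 / 2 ^ i))"
        using assms(2) by (intro ennreal_leI) auto
      finally show ?thesis .
    next
      case False
      then have "modular G (\<lambda>x. \<bar>a i\<bar> / R * y i x) \<le> modular G (\<lambda>x. 1 / 2 ^ i * y i x)"
        using R by (intro modular_scale_mono) auto
      also have "\<dots> \<le> ennreal (C * (1 / 2 ^ i) powr r)" by (rule le) (auto simp: divide_le_eq)
      also have "\<dots> \<le> ennreal (C * (1 / 2 ^ i))"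
      proof -
        have "(1 / 2 ^ i :: real) powr r \<le> (1 / 2 ^ i) powr 1"
          using assms(1) by (intro powr_mono') (auto simp: divide_le_eq)
        then show ?thesis using assms(2) by (intro ennreal_leI mult_left_mono) auto
      qed
      also have "\<dots> \<le> ennreal (C * (\<bar>a i\<bar> / R) powr r + C * (1 / 2 ^ i))"
        using assms(2) by (intro ennreal_leI) auto
      finally show ?thesis .
    qed
    have "modular G (\<lambda>x. lin_comb a y N x / R) = (\<Sum>i<N. modular G (\<lambda>x. \<bar>a i\<bar> / R * y i x))"
      by (rule modular_lin_comb_divide) (use assms R in auto)
    also have "\<dots> \<le> (\<Sum>i<N. ennreal (C * (\<bar>a i\<bar> / R) powr r + C * (1 / 2 ^ i)))"
      by (intro sum_mono part) auto
    also have "\<dots> = ennreal (\<Sum>i<N. C * (\<bar>a i\<bar> / R) powr r + C * (1 / 2 ^ i))"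
      using assms(2) by (intro sum_ennreal) auto
    also have "(\<Sum>i<N. C * (\<bar>a i\<bar> / R) powr r + C * (1 / 2 ^ i)) = C * 1 + C * (\<Sum>i<N. 1 / 2 ^ i)"
      unfolding sum.distrib bsum[symmetric] by (simp only: sum_distrib_left)
    also have "ennreal \<dots> \<le> ennreal (max 1 (3 * C))"
      using assms(2) mult_left_mono[OF sum_half_powers_le[of N] assms(2)] by (intro ennreal_leI) auto
    finally have "modular G (\<lambda>x. lin_comb a y N x / R) \<le> ennreal (max 1 (3 * C))" .
    moreover have "mb (\<lambda>x. lin_comb a y N x / R)"
      unfolding lin_comb_def by (intro mb_divide mb_sum mb_cmult assms(3))
    ultimately have *: "(\<lambda>x. lin_comb a y N x / R) \<in> orlicz_space G" "lux_norm G (\<lambda>x. lin_comb a y N x / R) \<le> max 1 (3 * C)"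
      using modular_bound_lux[of "\<lambda>x. lin_comb a y N x / R" "max 1 (3 * C)"] by auto
    have "lux_norm G (lin_comb a y N) = R * lux_norm G (\<lambda>x. lin_comb a y N x / R)"
      using orlicz_scale(2)[OF *(1), of R] R by simp
    also have "\<dots> \<le> R * max 1 (3 * C)" using * R by (intro mult_left_mono) auto
    finally show ?thesis by (simp add: R_def mult.commute)
  qed
qed

lemma modular_stretch:
  assumes "mb f" "1 \<le> b"
  shows "ennreal b * modular G f \<le> modular G (\<lambda>x. b * f x)"
proof -
  have "modular G f = modular G (\<lambda>x. 1 / b * (b * f x))" using assms by simp
  also have "\<dots> \<le> ennreal (1 / b) * modular G (\<lambda>x. b * f x)"
    using assms by (intro modular_scale mb_cmult) auto
  finally have "ennreal b * modular G f \<le> ennreal b * (ennreal (1 / b) * modular G (\<lambda>x. b * f x))"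
    by (intro mult_left_mono) auto
  also have "\<dots> = modular G (\<lambda>x. b * f x)"
    using assms by (simp add: mult.assoc[symmetric] ennreal_mult[symmetric])
  finally show ?thesis .
qed

text \<open>If l is admissible for the combination, the normalised coefficients \<open>b i\<close>
  have modulars \<open>\<mu> i\<close> of sum at most 1. Below 1 / 2 ^ i a coefficient is
  negligible, in the window \<open>ge\<close> bounds its power by \<open>\<mu> i / c\<close>, and
  above 1 convexity makes the modular grow at least linearly, so that \<open>b i\<close> is at most
  \<open>\<mu> i / c\<close>.\<close>

lemma powr_lower_estimate:
  assumes "1 \<le> r" "0 < c" "\<And>i. y i \<in> orlicz_space G" "disjoint_seq y"
    and ge: "\<And>k t. 1 / 2 ^ k \<le> t \<Longrightarrow> t \<le> 1 \<Longrightarrow> ennreal (c * t powr r) \<le> modular G (\<lambda>x. t * y k x)"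
  shows "\<exists>c'>0. \<forall>N a. c' * (\<Sum>i<N. \<bar>a i\<bar> powr r) powr (1 / r) \<le> lux_norm G (lin_comb a y N)"
proof (intro exI conjI allI)
  \<comment> \<open>The first summand serves coefficients in the window, the second those above 1,
    where \<open>\<mu> i powr r\<close> is at most \<open>\<mu> i\<close> because
    \<open>\<mu> i\<close> is at most 1. The sum of the powers is then bounded by
    \<open>2 + A\<close>, whose r-th root is K.\<close>
  define A where "A = 1 / c + (1 / c) powr r"
  have A: "1 / c \<le> A" "(1 / c) powr r \<le> A" "0 < A" using assms(2) by (auto simp: A_def add_pos_pos)
  define K where "K = (2 + A) powr (1 / r)"
  have K: "0 < K" using A by (simp add: K_def)
  show "0 < 1 / K" using K by simp
  fix N :: nat and a :: "nat \<Rightarrow> real"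
  have y: "mb (y i)" for i using assms(3) orlicz_mb by blast
  show "1 / K * (\<Sum>i<N. \<bar>a i\<bar> powr r) powr (1 / r) \<le> lux_norm G (lin_comb a y N)"
  proof (rule lux_ge)
    show "lin_comb a y N \<in> orlicz_space G" using assms(3) by (rule orlicz_lin_comb)
    fix l :: real assume l: "0 < l" "modular G (\<lambda>x. lin_comb a y N x / l) \<le> 1"
    define b where "b i = \<bar>a i\<bar> / l" for i
    define \<mu> where "\<mu> i = enn2real (modular G (\<lambda>x. b i * y i x))" for i
    have total: "(\<Sum>i<N. modular G (\<lambda>x. b i * y i x)) \<le> 1"
      using l modular_lin_comb_divide[OF y assms(4) l(1), of a N] by (simp add: b_def)
    have one: "modular G (\<lambda>x. b i * y i x) \<le> 1" if "i < N" for i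
      using total member_le_sum[of i "{..<N}" "\<lambda>i. modular G (\<lambda>x. b i * y i x)"] that by force
    have \<mu>: "modular G (\<lambda>x. b i * y i x) = ennreal (\<mu> i)" "0 \<le> \<mu> i" "\<mu> i \<le> 1" if "i < N" for i
    proof -
      have "modular G (\<lambda>x. b i * y i x) < top" using one[OF that] by (metis ennreal_one_less_top order_le_less_trans)
      then show "modular G (\<lambda>x. b i * y i x) = ennreal (\<mu> i)" by (simp add: \<mu>_def)
      then have "ennreal (\<mu> i) \<le> ennreal 1" using one[OF that] by simp
      then show "\<mu> i \<le> 1" by simp
      show "0 \<le> \<mu> i" by (simp add: \<mu>_def)
    qed
    have "(\<Sum>i<N. ennreal (\<mu> i)) = (\<Sum>i<N. modular G (\<lambda>x. b i * y i x))"
      by (rule sum.cong[OF refl]) (rule \<mu>(1)[symmetric], simp)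
    then have "(\<Sum>i<N. ennreal (\<mu> i)) \<le> 1" using total by (rule ord_eq_le_trans)
    then have \<mu>_sum: "(\<Sum>i<N. \<mu> i) \<le> 1"
      using \<mu>(2) by (subst (asm) sum_ennreal) auto
    have part: "b i powr r \<le> 1 / 2 ^ i + A * \<mu> i" if i: "i < N" for i
    proof -
      have b0: "0 \<le> b i" using l by (simp add: b_def)
      consider "b i < 1 / 2 ^ i" | "1 / 2 ^ i \<le> b i" "b i \<le> 1" | "1 < b i" by linarith
      then show ?thesis
      proof cases
        case 1
        have "(1 / 2 ^ i :: real) \<le> 1" by (simp add: divide_le_eq)
        then have "b i \<le> 1" using 1 by linarith
        then have "b i powr r \<le> b i powr 1"
          using assms(1) b0 by (intro powr_mono') auto
        then have "b i powr r \<le> 1 / 2 ^ i" using 1(1) b0 by (simp add: less_imp_le)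
        then show ?thesis using A \<mu>(2)[OF i] by (simp add: add_increasing2)
      next
        case 2
        have "ennreal (c * b i powr r) \<le> ennreal (\<mu> i)" using ge[OF 2] \<mu>(1)[OF i] by simp
        then have "c * b i powr r \<le> \<mu> i" using \<mu>(2)[OF i] by simp
        then have "b i powr r \<le> 1 / c * \<mu> i" using assms(2) by (simp add: field_simps)
        also have "\<dots> \<le> A * \<mu> i" using A \<mu>(2)[OF i] by (intro mult_right_mono) auto
        finally show ?thesis by (simp add: add_increasing)
      next
        case 3
        have "ennreal c \<le> modular G (y i)" using ge[of i 1] by (simp add: divide_le_eq)
        then have "ennreal (b i) * ennreal c \<le> ennreal (b i) * modular G (y i)"
          by (intro mult_left_mono) auto
        also have "\<dots> \<le> ennreal (\<mu> i)" using modular_stretch[OF y, of "b i" i] 3 \<mu>(1)[OF i] by simp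
        finally have "ennreal (b i * c) \<le> ennreal (\<mu> i)" using b0 assms(2) by (simp add: ennreal_mult)
        then have bc: "b i * c \<le> \<mu> i" using \<mu>(2)[OF i] by simp
        then have "b i \<le> 1 / c * \<mu> i" using assms(2) by (simp add: field_simps)
        then have "b i powr r \<le> (1 / c * \<mu> i) powr r" using b0 assms(1) by (intro powr_mono2) auto
        also have "\<dots> = (1 / c) powr r * \<mu> i powr r" by (rule powr_mult)
        also have "\<dots> \<le> A * \<mu> i powr 1"
          using A \<mu>(2,3)[OF i] assms(1) by (intro mult_mono powr_mono') auto
        finally show ?thesis using \<mu>(2)[OF i] by (simp add: add_increasing)
      qed
    qed
    have "(\<Sum>i<N. b i powr r) \<le> (\<Sum>i<N. 1 / 2 ^ i + A * \<mu> i)" by (intro sum_mono part) auto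
    also have "\<dots> = (\<Sum>i<N. 1 / 2 ^ i) + A * (\<Sum>i<N. \<mu> i)" by (simp add: sum.distrib sum_distrib_left)
    also have "\<dots> \<le> 2 + A * 1" using A \<mu>_sum by (intro add_mono sum_half_powers_le mult_left_mono) auto
    finally have bs: "(\<Sum>i<N. b i powr r) \<le> 2 + A" by simp
    have "(\<Sum>i<N. \<bar>a i\<bar> powr r) = l powr r * (\<Sum>i<N. b i powr r)"
      using l by (simp add: b_def powr_divide sum_distrib_left)
    also have "\<dots> \<le> l powr r * (2 + A)" using bs by (intro mult_left_mono) auto
    finally have "(\<Sum>i<N. \<bar>a i\<bar> powr r) powr (1 / r) \<le> (l powr r * (2 + A)) powr (1 / r)"
      using assms(1) by (intro powr_mono2) (auto intro: sum_nonneg)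
    also have "\<dots> = l * K" using l A assms(1) by (simp add: powr_mult powr_powr K_def)
    finally show "1 / K * (\<Sum>i<N. \<bar>a i\<bar> powr r) powr (1 / r) \<le> l" using K by (simp add: field_simps)
  qed
qed

text \<open>The k-th function is tested on the k-th window only, so it suffices to pick a
  subsequence whose k-th term behaves well down to 1 / 2 ^ k, with c and C common to all k.\<close>

lemma equiv_lrI:
  assumes "1 \<le> r" "0 < c" "0 \<le> C" "\<And>i. y i \<in> orlicz_space G" "disjoint_seq y"
    and "\<And>k t. 1 / 2 ^ k \<le> t \<Longrightarrow> t \<le> 1 \<Longrightarrow> ennreal (c * t powr r) \<le> modular G (\<lambda>x. t * y k x)"
    and "\<And>k t. 1 / 2 ^ k \<le> t \<Longrightarrow> t \<le> 1 \<Longrightarrow> modular G (\<lambda>x. t * y k x) \<le> ennreal (C * t powr r)"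
  shows "equiv_lr G r y"
proof -
  obtain c' where c': "0 < c'"
    "\<forall>N a. c' * (\<Sum>i<N. \<bar>a i\<bar> powr r) powr (1 / r) \<le> lux_norm G (lin_comb a y N)"
    using powr_lower_estimate[OF assms(1,2,4,5,6)] by blast
  have "lux_norm G (lin_comb a y N) \<le> max 1 (3 * C) * (\<Sum>i<N. \<bar>a i\<bar> powr r) powr (1 / r)" for a N
    using assms by (intro powr_upper_estimate) (auto intro: orlicz_mb)
  then show ?thesis unfolding equiv_lr_def using c' by (intro exI[of _ c'] exI[of _ "max 1 (3 * C)"]) auto
qed

lemma orlicz_indicator:
  assumes "f \<in> orlicz_space G" "S \<in> sets lebesgue"
  shows "(\<lambda>x. indicator S x * f x) \<in> orlicz_space G"
    and "lux_norm G (\<lambda>x. indicator S x * f x) \<le> lux_norm G f"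
proof -
  have "mb (\<lambda>x. indicator S x * f x)" by (intro mb_indicator assms orlicz_mb)
  then show "(\<lambda>x. indicator S x * f x) \<in> orlicz_space G"
    and "lux_norm G (\<lambda>x. indicator S x * f x) \<le> lux_norm G f"
    by (rule orlicz_dominated[OF assms(1)]; simp add: indicator_def)+
qed

lemma lux_abs_mono:
  assumes "f \<in> orlicz_space G" "mb g" "\<And>x. \<bar>g x\<bar> = \<bar>f x\<bar>"
  shows "g \<in> orlicz_space G" "lux_norm G g = lux_norm G f"
proof -
  show g: "g \<in> orlicz_space G"
    by (rule orlicz_dominated(1)[OF assms(1,2)]) (simp add: assms(3))
  show "lux_norm G g = lux_norm G f"
    using orlicz_dominated(2)[OF assms(1,2)] orlicz_dominated(2)[OF g orlicz_mb[OF assms(1)]] assms(3)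
    by (simp add: order_antisym)
qed

text \<open>Tong's diagonal principle: averaging over signs, one index at a time, removes the
  off-diagonal parts without increasing the norm.\<close>
lemma lux_diagonal_le:
  fixes m :: nat
  assumes "\<And>i. i < m \<Longrightarrow> g i \<in> orlicz_space G" "e \<in> orlicz_space G"
    and "\<And>i. i < m \<Longrightarrow> S i \<in> sets lebesgue" "disjoint_family_on S {..<m}"
    and "\<And>\<theta>. (\<forall>i. \<bar>\<theta> i\<bar> = 1) \<Longrightarrow> lux_norm G (\<lambda>x. e x + (\<Sum>i<m. \<theta> i * g i x)) \<le> B"
  shows "lux_norm G (\<lambda>x. indicator (- (\<Union>i<m. S i)) x * e x + (\<Sum>i<m. indicator (S i) x * g i x)) \<le> B"
  using assms
proof (induction m arbitrary: e g)
  case 0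
  then show ?case using 0(5)[of "\<lambda>_. 1"] by simp
next
  case (Suc m)
  define T where "T = S m"
  have T: "T \<in> sets lebesgue" "- T \<in> sets lebesgue" using Suc.prems(3)[of m] by (auto simp: T_def Compl_in_sets_lebesgue)
  define e' where "e' x = indicator (- T) x * e x + indicator T x * g m x" for x
  define g' where "g' i x = indicator (- T) x * g i x" for i x
  have disj: "S i \<inter> T = {}" if "i < m" for i
    using Suc.prems(4) that unfolding disjoint_family_on_def T_def by auto
  have e': "e' \<in> orlicz_space G" unfolding e'_def
    using Suc.prems T by (intro orlicz_add(1) orlicz_indicator(1)) auto
  have g': "g' i \<in> orlicz_space G" if "i < m" for i unfolding g'_def
    using Suc.prems T that by (intro orlicz_indicator(1)) auto
  have bound: "lux_norm G (\<lambda>x. e' x + (\<Sum>i<m. \<theta> i * g' i x)) \<le> B" if \<theta>: "\<forall>i. \<bar>\<theta> i\<bar> = 1" for \<theta>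
  proof -
    define u where "u \<sigma> x = e x + (\<Sum>i<m. \<theta> i * g i x) + \<sigma> * g m x" for \<sigma> x
    have u_space: "u \<sigma> \<in> orlicz_space G" for \<sigma>
      unfolding u_def using Suc.prems
      by (intro orlicz_add(1) orlicz_sum(1) orlicz_scale(1)) auto
    have u: "lux_norm G (u \<sigma>) \<le> B" if "\<bar>\<sigma>\<bar> = 1" for \<sigma>
    proof -
      have "(\<Sum>i<Suc m. (\<theta>(m := \<sigma>)) i * g i x) = (\<Sum>i<m. \<theta> i * g i x) + \<sigma> * g m x" for x
        by (simp add: sum.lessThan_Suc)
      then have "u \<sigma> = (\<lambda>x. e x + (\<Sum>i<Suc m. (\<theta>(m := \<sigma>)) i * g i x))"
        unfolding u_def by (simp add: add.assoc)
      then show ?thesis using Suc.prems(5)[of "\<theta>(m := \<sigma>)"] \<theta> that by simp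
    qed
    \<comment> \<open>Reversing the sign of \<open>u (- 1)\<close> on T keeps its norm. In the mean
      of \<open>u 1\<close> and \<open>v\<close>, the term \<open>g m\<close> cancels off T, while
      on T everything except \<open>g m\<close> cancels.\<close>
    define v where "v x = (indicator (- T) x - indicator T x) * u (- 1) x" for x
    have "mb v" unfolding v_def left_diff_distrib
      using mb_add[OF mb_indicator[OF T(2)] mb_cmult[OF mb_indicator[OF T(1)], of _ "- 1"], of "u (-1)" "u (-1)"] 
        orlicz_mb[OF u_space] by simp
    then have v: "v \<in> orlicz_space G" "lux_norm G v = lux_norm G (u (- 1))"
      by (rule lux_abs_mono[OF u_space[of "- 1"]]; simp add: v_def indicator_def)+
    have "(\<lambda>x. e' x + (\<Sum>i<m. \<theta> i * g' i x)) = (\<lambda>x. 1/2 * u 1 x + 1/2 * v x)"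
      by (auto simp: fun_eq_iff e'_def g'_def v_def u_def indicator_def field_simps)
    then have "lux_norm G (\<lambda>x. e' x + (\<Sum>i<m. \<theta> i * g' i x)) \<le> lux_norm G (\<lambda>x. 1/2 * u 1 x) + lux_norm G (\<lambda>x. 1/2 * v x)"
      using orlicz_add(2)[OF orlicz_scale(1)[OF u_space[of 1], of "1/2"] orlicz_scale(1)[OF v(1), of "1/2"]] by simp
    also have "\<dots> = 1/2 * lux_norm G (u 1) + 1/2 * lux_norm G v"
      using orlicz_scale(2)[OF u_space[of 1], of "1/2"] orlicz_scale(2)[OF v(1), of "1/2"] by simp
    also have "\<dots> \<le> B" using u[of 1] u[of "- 1"] v by simp
    finally show ?thesis .
  qed
  have "lux_norm G (\<lambda>x. indicator (- (\<Union>i<m. S i)) x * e' x + (\<Sum>i<m. indicator (S i) x * g' i x)) \<le> B"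
    using Suc.prems(3,4) e' g' bound by (intro Suc.IH) (auto simp: disjoint_family_on_def)
  moreover have "indicator (- (\<Union>i<m. S i)) x * e' x + (\<Sum>i<m. indicator (S i) x * g' i x)
      = indicator (- (\<Union>i<Suc m. S i)) x * e x + (\<Sum>i<Suc m. indicator (S i) x * g i x)" for x
  proof -
    have "(\<Sum>i<m. indicator (S i) x * g' i x) = (\<Sum>i<m. indicator (S i) x * g i x)"
      using disj by (intro sum.cong) (auto simp: g'_def indicator_def)
    moreover have "indicator (- (\<Union>i<m. S i)) x * e' x
        = indicator (- (\<Union>i<Suc m. S i)) x * e x + indicator (S m) x * g m x"
      using disj by (auto simp: e'_def T_def indicator_def lessThan_Suc)
    ultimately show ?thesis by simp
  qed
  ultimately show ?case by simp
qed

end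

section \<open>Disjoint homogeneity from window estimates\<close>

text \<open>Used with \<open>P k\<close> an estimate on the k-th window: it supplies the growing
  windows of \<open>equiv_lrI\<close> from estimates that hold merely infinitely often.\<close>

lemma strict_mono_choice:
  fixes P :: "nat \<Rightarrow> nat \<Rightarrow> bool"
  assumes "\<And>k. \<exists>\<^sub>\<infinity>n. P k n"
  shows "\<exists>\<sigma>. strict_mono \<sigma> \<and> (\<forall>k. P k (\<sigma> k))"
proof -
  have "\<exists>\<sigma>. \<forall>k. P k (\<sigma> k) \<and> \<sigma> k < \<sigma> (Suc k)"
  proof (rule dependent_nat_choice)
    show "\<exists>n. P 0 n" using assms[of 0] by (rule INFM_EX)
    show "\<exists>m. P (Suc k) m \<and> n < m" for n k
      using assms[of "Suc k"] unfolding INFM_nat by blast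
  qed
  then show ?thesis by (auto simp: strict_mono_Suc_iff)
qed

lemma INFM_if_eventually: "eventually P sequentially \<Longrightarrow> \<exists>\<^sub>\<infinity>n. P n"
  by (intro MOST_INFM) (simp_all add: cofinite_eq_sequentially)

definition level_part :: "real set \<Rightarrow> (real \<Rightarrow> real) \<Rightarrow> real \<Rightarrow> real" where
  "level_part B f u = (if \<bar>f u\<bar> \<in> B then f u else 0)"

lemma mb_level_part:
  assumes "mb f" "B \<in> sets borel"
  shows "mb (level_part B f)"
proof -
  define h where "h y = (if \<bar>y\<bar> \<in> B then y else 0)" for y :: real
  have "(\<lambda>y::real. \<bar>y\<bar>) \<in> borel_measurable borel" by measurable
  then have B: "{y::real. \<bar>y\<bar> \<in> B} \<in> sets borel"
    using measurable_sets[OF _ assms(2), of "\<lambda>y::real. \<bar>y\<bar>" borel] by (simp add: vimage_def)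
  have "h \<in> borel_measurable borel" unfolding h_def
    using B by (intro measurable_If) auto
  moreover have "(\<lambda>x. indicator {0..1} x *\<^sub>R f x) \<in> borel_measurable lebesgue"
    using assms(1) by (simp add: set_borel_measurable_def)
  ultimately have "(\<lambda>x. h (indicator {0..1} x *\<^sub>R f x)) \<in> borel_measurable lebesgue"
    by (rule measurable_compose[rotated])
  moreover have "h (indicator {0..1} x *\<^sub>R f x) = indicator {0..1} x *\<^sub>R level_part B f x" for x
    by (auto simp: h_def level_part_def indicator_def)
  ultimately show ?thesis by (simp add: set_borel_measurable_def)
qed

context orlicz_delta2
begin

lemma modular_level_part_Un:
  assumes "mb f" "B \<in> sets borel" "C \<in> sets borel" "B \<inter> C = {}"
  shows "modular G (level_part (B \<union> C) f) = modular G (level_part B f) + modular G (level_part C f)"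
proof -
  have "level_part (B \<union> C) f = (\<lambda>u. level_part B f u + level_part C f u)" using assms(4) by (auto simp: level_part_def fun_eq_iff)
  moreover have "disjoint_fun (level_part B f) (level_part C f)"
  proof -
    have "{x \<in> {0..1}. level_part B f x \<noteq> 0 \<and> level_part C f x \<noteq> 0} = {}" using assms(4) by (auto simp: level_part_def)
    then show ?thesis unfolding disjoint_fun_def by (simp only: emeasure_empty)
  qed
  ultimately show ?thesis using modular_disjoint_add[OF mb_level_part mb_level_part] assms by simp
qed

lemma modular_level_part_le: "modular G (level_part B f) \<le> modular G f"
  by (rule modular_mono) (simp add: level_part_def)

text \<open>With \<open>support_tendsto_0\<close> this shows that bounded levels carry vanishing
  mass along a disjoint sequence, so only the behaviour of G at large arguments matters.\<close>

lemma modular_level_part_small: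
  assumes "mb f" "0 \<le> s"
  shows "modular G (level_part {..s} f) \<le> ennreal (G s) * emeasure lebesgue {u \<in> {0..1}. f u \<noteq> 0}"
proof -
  let ?S = "{u \<in> {0..1}. f u \<noteq> 0}"
  have S: "?S \<in> sets lebesgue" using mb_vimage[OF assms(1), of "- {0}"] by simp
  have "modular G (level_part {..s} f) \<le> (\<integral>\<^sup>+u. ennreal (G s) * indicator ?S u \<partial>lebesgue)"
    unfolding modular_def
    by (rule nn_integral_mono) (auto simp: level_part_def indicator_def intro!: ennreal_leI G_mono)
  also have "\<dots> = ennreal (G s) * emeasure lebesgue ?S" using S by (rule nn_integral_cmult_indicator)
  finally show ?thesis .
qed

text \<open>The part of f outside B is thrown away, which is harmless for a lower estimate; this is
  why kinds with bad constants may be ignored.\<close>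

lemma modular_level_part_scaled:
  assumes "mb f" "B \<in> sets borel" "0 \<le> t" "0 \<le> b" "\<And>s. s \<in> B \<Longrightarrow> 0 \<le> s \<Longrightarrow> b * G s \<le> G (t * s)"
  shows "ennreal b * modular G (level_part B f) \<le> modular G (\<lambda>u. t * f u)"
proof -
  have "ennreal b * modular G (level_part B f) = (\<integral>\<^sup>+u. ennreal b * (ennreal (G \<bar>level_part B f u\<bar>) * indicator {0..1} u) \<partial>lebesgue)"
    unfolding modular_def using G_measurable[OF mb_level_part[OF assms(1,2)]] by (simp add: nn_integral_cmult)
  also have "\<dots> \<le> modular G (\<lambda>u. t * f u)" unfolding modular_def
  proof (rule nn_integral_mono)
    fix u
    have "b * G \<bar>level_part B f u\<bar> \<le> G \<bar>t * f u\<bar>"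
      using assms(3) assms(5)[of "\<bar>f u\<bar>"] by (auto simp: level_part_def abs_mult)
    then have "ennreal b * ennreal (G \<bar>level_part B f u\<bar>) \<le> ennreal (G \<bar>t * f u\<bar>)"
      using assms(4) by (simp add: ennreal_mult[symmetric] ennreal_leI)
    then show "ennreal b * (ennreal (G \<bar>level_part B f u\<bar>) * indicator {0..1} u) \<le> ennreal (G \<bar>t * f u\<bar>) * indicator {0..1} u"
      by (auto simp: indicator_def)
  qed
  finally show ?thesis .
qed

lemma modular_scaled_upper:
  assumes "mb f" "0 \<le> t" "0 \<le> b" "\<And>s. 0 \<le> s \<Longrightarrow> G (t * s) \<le> b * G s"
  shows "modular G (\<lambda>u. t * f u) \<le> ennreal b * modular G f"
proof -
  have "modular G (\<lambda>u. t * f u) \<le> (\<integral>\<^sup>+u. ennreal b * (ennreal (G \<bar>f u\<bar>) * indicator {0..1} u) \<partial>lebesgue)"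
    unfolding modular_def
  proof (rule nn_integral_mono)
    fix u
    have "G \<bar>t * f u\<bar> \<le> b * G \<bar>f u\<bar>" using assms(2) assms(4)[of "\<bar>f u\<bar>"] by (simp add: abs_mult)
    then have "ennreal (G \<bar>t * f u\<bar>) \<le> ennreal b * ennreal (G \<bar>f u\<bar>)"
      using assms(3) by (simp add: ennreal_mult[symmetric] ennreal_leI)
    then show "ennreal (G \<bar>t * f u\<bar>) * indicator {0..1} u \<le> ennreal b * (ennreal (G \<bar>f u\<bar>) * indicator {0..1} u)"
      by (auto simp: indicator_def)
  qed
  also have "\<dots> = ennreal b * modular G f"
    unfolding modular_def using G_measurable[OF assms(1)] by (simp add: nn_integral_cmult)
  finally show ?thesis .
qed

lemma normalized_modular:
  assumes "normalized_disjoint_seq G x"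
  shows "mb (x n)" "modular G (x n) \<le> ennreal D" "ennreal (1 / D) \<le> modular G (x n)"
proof -
  have x: "x n \<in> orlicz_space G" "lux_norm G (x n) = 1"
    using assms by (auto simp: normalized_disjoint_seq_def)
  then show "mb (x n)" by (intro orlicz_mb)
  show "modular G (x n) \<le> ennreal D" using modular_at_norm(1)[OF x(1)] x(2) by simp
  have "1 \<le> ennreal D * modular G (x n)" using modular_at_norm(2)[OF x(1)] x(2) by simp
  then have "ennreal (1 / D) * 1 \<le> ennreal (1 / D) * (ennreal D * modular G (x n))" by (intro mult_left_mono) auto
  also have "\<dots> = modular G (x n)"
    using D_ge_1 by (simp add: mult.assoc[symmetric] ennreal_mult[symmetric])
  finally show "ennreal (1 / D) \<le> modular G (x n)" by simp
qed

lemma support_tendsto_0: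
  assumes "\<And>n. mb (x n)" "disjoint_seq x"
  shows "(\<lambda>n. measure lebesgue {u \<in> {0..1}. x n u \<noteq> 0}) \<longlonglongrightarrow> 0"
proof (rule measure_disjoint_tendsto_0)
  show "{u \<in> {0..1}. x n u \<noteq> 0} \<in> sets lebesgue" for n
    using mb_vimage[OF assms(1), of "- {0}" n] by simp
  show "emeasure lebesgue ({u \<in> {0..1}. x m u \<noteq> 0} \<inter> {u \<in> {0..1}. x n u \<noteq> 0}) = 0" if "m \<noteq> n" for m n
  proof -
    have "{u \<in> {0..1}. x m u \<noteq> 0} \<inter> {u \<in> {0..1}. x n u \<noteq> 0} = {u \<in> {0..1}. x m u \<noteq> 0 \<and> x n u \<noteq> 0}" by auto
    then show ?thesis using assms(2) that unfolding disjoint_seq_def disjoint_fun_def by simp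
  qed
qed auto

text \<open>Either a fixed proportion of the mass of infinitely many \<^term>\<open>x n\<close> sits on levels of one bounded
  kind, or the mass escapes to levels of ever larger kind; both alternatives give a lower power
  estimate whose constant does not depend on the window \<^term>\<open>T\<close>.\<close>
lemma power_lower_frequently:
  fixes ty :: "real \<Rightarrow> nat"
  assumes meas: "\<And>N. {s. ty s \<le> N} \<in> sets borel"
    and small: "\<And>N. \<exists>c>0. \<forall>T. \<exists>s0. \<forall>s\<ge>s0. ty s \<le> N \<longrightarrow>
      (\<forall>t. 1 / 2 ^ T \<le> t \<and> t \<le> 1 \<longrightarrow> c * t powr r * G s \<le> G (t * s))"
    and large: "\<exists>c>0. \<forall>T. \<exists>N s0. \<forall>s\<ge>s0. N < ty s \<longrightarrow>
      (\<forall>t. 1 / 2 ^ T \<le> t \<and> t \<le> 1 \<longrightarrow> c * t powr r * G s \<le> G (t * s))"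
    and x: "normalized_disjoint_seq G x"
  shows "\<exists>c>0. \<forall>T. \<exists>\<^sub>\<infinity>n. \<forall>t. 1 / 2 ^ T \<le> t \<and> t \<le> 1 \<longrightarrow> ennreal (c * t powr r) \<le> modular G (\<lambda>u. t * x n u)"
proof -
  \<comment> \<open>The total mass is at least 1 / D, that is four shares. Low levels cost at most
    one share and the kinds up to N at most two in the second case, so one share is always left; in
    the first case one of two shares is left.\<close>
  define \<eta> where "\<eta> = 1 / (4 * D)"
  have \<eta>: "0 < \<eta>" using D_ge_1 by (simp add: \<eta>_def)
  define \<mu> where "\<mu> n B = enn2real (modular G (level_part B (x n)))" for n B
  have \<mu>_eq: "modular G (level_part B (x n)) = ennreal (\<mu> n B)" for n B
  proof -
    have "modular G (level_part B (x n)) \<le> ennreal D"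
      using modular_level_part_le normalized_modular(2)[OF x] by (rule order_trans)
    then have "modular G (level_part B (x n)) < top" by (simp add: order_le_less_trans ennreal_less_top)
    then show ?thesis by (simp add: \<mu>_def)
  qed
  have \<mu>_nonneg: "0 \<le> \<mu> n B" for n B by (simp add: \<mu>_def)
  have \<mu>_Un: "\<mu> n (B \<union> C) = \<mu> n B + \<mu> n C" if "B \<in> sets borel" "C \<in> sets borel" "B \<inter> C = {}" for n B C
    using modular_level_part_Un[OF normalized_modular(1)[OF x] that, of n] \<mu>_nonneg
    by (simp add: \<mu>_eq ennreal_plus[symmetric] del: ennreal_plus)
  have \<mu>_mono: "\<mu> n B \<le> \<mu> n C" if "B \<in> sets borel" "C \<in> sets borel" "B \<subseteq> C" for n B C
    using \<mu>_Un[of B "C - B" n] that \<mu>_nonneg[of n "C - B"] by (simp add: Un_absorb1)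
  have total: "4 * \<eta> \<le> \<mu> n UNIV" for n
  proof -
    have "level_part UNIV (x n) = x n" by (auto simp: level_part_def)
    then have "ennreal (1 / D) \<le> ennreal (\<mu> n UNIV)" using normalized_modular(3)[OF x, of n] \<mu>_eq[of UNIV n] by simp
    then show ?thesis using \<mu>_nonneg[of n UNIV] by (simp add: \<eta>_def)
  qed
  have low: "eventually (\<lambda>n. \<mu> n {..s} \<le> \<eta>) sequentially" for s
  proof -
    let ?s = "max s 0"
    have "(\<lambda>n. G ?s * measure lebesgue {u \<in> {0..1}. x n u \<noteq> 0}) \<longlonglongrightarrow> G ?s * 0"
      using x by (intro tendsto_mult tendsto_const support_tendsto_0 normalized_modular(1)[OF x])
        (simp add: normalized_disjoint_seq_def)
    then have "eventually (\<lambda>n. G ?s * measure lebesgue {u \<in> {0..1}. x n u \<noteq> 0} < \<eta>) sequentially"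
      using \<eta> by (intro order_tendstoD(2)) auto
    then show ?thesis
    proof eventually_elim
      case (elim n)
      let ?S = "{u \<in> {0..1}. x n u \<noteq> 0}"
      have S: "?S \<in> lmeasurable"
        using mb_vimage[OF normalized_modular(1)[OF x], of "- {0}" n]
        by (intro bounded_set_imp_lmeasurable bounded_subset[OF bounded_closed_interval[of 0 1]]) auto
      have "ennreal (\<mu> n {..?s}) \<le> ennreal (G ?s) * emeasure lebesgue ?S"
        using modular_level_part_small[OF normalized_modular(1)[OF x], of ?s n] by (simp add: \<mu>_eq)
      also have "\<dots> = ennreal (G ?s * measure lebesgue ?S)"
        using S by (simp add: emeasure_eq_measure2 ennreal_mult)
      finally have "\<mu> n {..?s} \<le> G ?s * measure lebesgue ?S" by (simp add: mult_nonneg_nonneg)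
      moreover have "\<mu> n {..s} \<le> \<mu> n {..?s}" by (intro \<mu>_mono) auto
      ultimately show ?case using elim by simp
    qed
  qed
  have conclude: "\<forall>t. 1 / 2 ^ T \<le> t \<and> t \<le> 1 \<longrightarrow> ennreal (c * \<eta> * t powr r) \<le> modular G (\<lambda>u. t * x n u)"
    if c: "0 < c" and B: "B \<in> sets borel" "\<eta> \<le> \<mu> n B"
      and le: "\<And>s t. s \<in> B \<Longrightarrow> 1 / 2 ^ T \<le> t \<Longrightarrow> t \<le> 1 \<Longrightarrow> c * t powr r * G s \<le> G (t * s)" for T n B c
  proof (intro allI impI)
    fix t :: real assume t: "1 / 2 ^ T \<le> t \<and> t \<le> 1"
    then have "0 < t" by (meson less_le_trans zero_less_divide_1_iff zero_less_numeral zero_less_power)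
    then have "ennreal (c * t powr r) * ennreal (\<mu> n B) \<le> modular G (\<lambda>u. t * x n u)"
      using modular_level_part_scaled[OF normalized_modular(1)[OF x] B(1), of t "c * t powr r" n] le t c by (simp add: \<mu>_eq)
    moreover have "ennreal (c * \<eta> * t powr r) \<le> ennreal (c * t powr r) * ennreal (\<mu> n B)"
    proof -
      have "c * \<eta> * t powr r = c * t powr r * \<eta>" by simp
      also have "\<dots> \<le> c * t powr r * \<mu> n B" using c B(2) by (intro mult_left_mono) auto
      finally show ?thesis using c \<mu>_nonneg by (simp add: ennreal_mult[symmetric] ennreal_leI)
    qed
    ultimately show "ennreal (c * \<eta> * t powr r) \<le> modular G (\<lambda>u. t * x n u)" by simp
  qed
  show ?thesis
  proof (cases "\<exists>N. \<exists>\<^sub>\<infinity>n. 2 * \<eta> \<le> \<mu> n {s. ty s \<le> N}")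
    case True
    then obtain N where N: "\<exists>\<^sub>\<infinity>n. 2 * \<eta> \<le> \<mu> n {s. ty s \<le> N}" by blast
    obtain c where c: "0 < c" "\<And>T. \<exists>s0. \<forall>s\<ge>s0. ty s \<le> N \<longrightarrow>
      (\<forall>t. 1 / 2 ^ T \<le> t \<and> t \<le> 1 \<longrightarrow> c * t powr r * G s \<le> G (t * s))" using small by blast
    have "\<exists>\<^sub>\<infinity>n. \<forall>t. 1 / 2 ^ T \<le> t \<and> t \<le> 1 \<longrightarrow> ennreal (c * \<eta> * t powr r) \<le> modular G (\<lambda>u. t * x n u)" for T
    proof -
      obtain s0 where s0: "\<And>s. s \<ge> s0 \<Longrightarrow> ty s \<le> N \<Longrightarrow>
        (\<forall>t. 1 / 2 ^ T \<le> t \<and> t \<le> 1 \<longrightarrow> c * t powr r * G s \<le> G (t * s))" using c(2) by blast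
      have "\<exists>\<^sub>\<infinity>n. 2 * \<eta> \<le> \<mu> n {s. ty s \<le> N} \<and> \<mu> n {..s0} \<le> \<eta>"
        using N low[of s0] by (intro INFM_conjI) (simp_all add: cofinite_eq_sequentially)
      then show ?thesis
      proof (rule INFM_mono)
        fix n assume n: "2 * \<eta> \<le> \<mu> n {s. ty s \<le> N} \<and> \<mu> n {..s0} \<le> \<eta>"
        let ?B = "{s. ty s \<le> N} - {..s0}"
        have "\<mu> n {s. ty s \<le> N} \<le> \<mu> n (?B \<union> {..s0})" using meas by (intro \<mu>_mono) auto
        also have "\<dots> = \<mu> n ?B + \<mu> n {..s0}" using meas by (intro \<mu>_Un) auto
        finally have "\<eta> \<le> \<mu> n ?B" using n by simp
        then show "\<forall>t. 1 / 2 ^ T \<le> t \<and> t \<le> 1 \<longrightarrow> ennreal (c * \<eta> * t powr r) \<le> modular G (\<lambda>u. t * x n u)"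
          using meas s0 by (intro conclude[OF c(1), of ?B]) auto
      qed
    qed
    then show ?thesis using c(1) \<eta> by (intro exI[of _ "c * \<eta>"]) auto
  next
    case False
    \<comment> \<open>The thresholds N and s0 depend on T, but c does not. The negated case
      hypothesis makes the mass on kinds up to any such N eventually less than two shares.\<close>
    obtain c where c: "0 < c" "\<And>T. \<exists>N s0. \<forall>s\<ge>s0. N < ty s \<longrightarrow>
      (\<forall>t. 1 / 2 ^ T \<le> t \<and> t \<le> 1 \<longrightarrow> c * t powr r * G s \<le> G (t * s))" using large by blast
    have "\<exists>\<^sub>\<infinity>n. \<forall>t. 1 / 2 ^ T \<le> t \<and> t \<le> 1 \<longrightarrow> ennreal (c * \<eta> * t powr r) \<le> modular G (\<lambda>u. t * x n u)" for T
    proof -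
      obtain N s0 where s0: "\<And>s. s \<ge> s0 \<Longrightarrow> N < ty s \<Longrightarrow>
        (\<forall>t. 1 / 2 ^ T \<le> t \<and> t \<le> 1 \<longrightarrow> c * t powr r * G s \<le> G (t * s))" using c(2) by blast
      have "eventually (\<lambda>n. \<mu> n {s. ty s \<le> N} < 2 * \<eta>) sequentially"
        using False by (simp add: frequently_def cofinite_eq_sequentially not_le)
      then have "eventually (\<lambda>n. \<forall>t. 1 / 2 ^ T \<le> t \<and> t \<le> 1 \<longrightarrow>
          ennreal (c * \<eta> * t powr r) \<le> modular G (\<lambda>u. t * x n u)) sequentially"
        using low[of s0]
      proof eventually_elim
        case (elim n)
        let ?B = "UNIV - ({s. ty s \<le> N} \<union> {..s0})"
        let ?E = "{..s0} - {s. ty s \<le> N}"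
        have "UNIV = ?B \<union> ({s. ty s \<le> N} \<union> ?E)" by auto
        then have "\<mu> n UNIV = \<mu> n (?B \<union> ({s. ty s \<le> N} \<union> ?E))" by simp
        also have "\<dots> = \<mu> n ?B + \<mu> n ({s. ty s \<le> N} \<union> ?E)" using meas by (intro \<mu>_Un) auto
        also have "\<mu> n ({s. ty s \<le> N} \<union> ?E) = \<mu> n {s. ty s \<le> N} + \<mu> n ?E" using meas by (intro \<mu>_Un) auto
        also have "\<mu> n ?E \<le> \<mu> n {..s0}" using meas by (intro \<mu>_mono) auto
        finally have "\<eta> \<le> \<mu> n ?B" using elim total[of n] by simp
        then show ?case using meas s0 by (intro conclude[OF c(1), of ?B]) auto
      qed
      then show ?thesis
        by (rule INFM_if_eventually)
    qed
    then show ?thesis using c(1) \<eta> by (intro exI[of _ "c * \<eta>"]) auto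
  qed
qed

text \<open>The upper estimate is uniform because every level satisfies \<open>upper\<close>. The
  lower constant comes from \<open>power_lower_frequently\<close> and may depend on the sequence,
  which \<open>r_DH\<close> permits.\<close>

lemma r_DH_if:
  fixes ty :: "real \<Rightarrow> nat"
  assumes r: "1 \<le> r" and C: "0 \<le> C"
    and upper: "\<And>t s. 0 \<le> t \<Longrightarrow> t \<le> 1 \<Longrightarrow> 0 \<le> s \<Longrightarrow> G (t * s) \<le> C * t powr r * G s"
    and meas: "\<And>N. {s. ty s \<le> N} \<in> sets borel"
    and small: "\<And>N. \<exists>c>0. \<forall>T. \<exists>s0. \<forall>s\<ge>s0. ty s \<le> N \<longrightarrow>
      (\<forall>t. 1 / 2 ^ T \<le> t \<and> t \<le> 1 \<longrightarrow> c * t powr r * G s \<le> G (t * s))"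
    and large: "\<exists>c>0. \<forall>T. \<exists>N s0. \<forall>s\<ge>s0. N < ty s \<longrightarrow>
      (\<forall>t. 1 / 2 ^ T \<le> t \<and> t \<le> 1 \<longrightarrow> c * t powr r * G s \<le> G (t * s))"
  shows "r_DH G r"
  unfolding r_DH_def
proof (intro allI impI)
  fix x assume x: "normalized_disjoint_seq G x"
  obtain c where c: "0 < c" "\<And>T. \<exists>\<^sub>\<infinity>n. \<forall>t. 1 / 2 ^ T \<le> t \<and> t \<le> 1 \<longrightarrow>
      ennreal (c * t powr r) \<le> modular G (\<lambda>u. t * x n u)"
    using power_lower_frequently[OF meas small large x] by blast
  obtain \<sigma> where \<sigma>: "strict_mono \<sigma>" "\<And>k. \<forall>t. 1 / 2 ^ k \<le> t \<and> t \<le> 1 \<longrightarrow>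
      ennreal (c * t powr r) \<le> modular G (\<lambda>u. t * x (\<sigma> k) u)"
    using strict_mono_choice[of "\<lambda>k n. \<forall>t. 1 / 2 ^ k \<le> t \<and> t \<le> 1 \<longrightarrow>
      ennreal (c * t powr r) \<le> modular G (\<lambda>u. t * x n u)"] c(2) by blast
  have "equiv_lr G r (x \<circ> \<sigma>)"
  proof (rule equiv_lrI[OF r c(1), of "C * D"])
    show "0 \<le> C * D" using C D_ge_1 by simp
    show "(x \<circ> \<sigma>) i \<in> orlicz_space G" for i using x by (simp add: normalized_disjoint_seq_def)
    show "disjoint_seq (x \<circ> \<sigma>)"
      using x strict_mono_eq[OF \<sigma>(1)] by (simp add: normalized_disjoint_seq_def disjoint_seq_def)
    fix k and t :: real assume t: "1 / 2 ^ k \<le> t" "t \<le> 1"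
    then show "ennreal (c * t powr r) \<le> modular G (\<lambda>u. t * (x \<circ> \<sigma>) k u)" using \<sigma>(2)[of k] by simp
    have t0: "0 \<le> t" using t by (meson order_trans zero_le_divide_1_iff zero_le_numeral zero_le_power)
    have "modular G (\<lambda>u. t * x (\<sigma> k) u) \<le> ennreal (C * t powr r) * modular G (x (\<sigma> k))"
      using upper t t0 C by (intro modular_scaled_upper normalized_modular(1)[OF x]) auto
    also have "\<dots> \<le> ennreal (C * t powr r) * ennreal D"
      using normalized_modular(2)[OF x] by (intro mult_left_mono) auto
    also have "\<dots> = ennreal (C * D * t powr r)" using C D_ge_1 by (simp add: ennreal_mult[symmetric] mult_ac)
    finally show "modular G (\<lambda>u. t * (x \<circ> \<sigma>) k u) \<le> ennreal (C * D * t powr r)" by simp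
  qed
  then show "\<exists>\<sigma>. strict_mono \<sigma> \<and> equiv_lr G r (x \<circ> \<sigma>)" using \<sigma>(1) by blast
qed

section \<open>Normalised indicators\<close>

lemma modular_indicator:
  assumes "S \<in> sets lebesgue" "S \<subseteq> {0..1}"
  shows "modular G (\<lambda>u. c * indicator S u) = ennreal (G \<bar>c\<bar> * measure lebesgue S)"
proof -
  have S: "S \<in> lmeasurable"
    using assms by (intro bounded_set_imp_lmeasurable bounded_subset[OF bounded_closed_interval[of 0 1]]) auto
  have "modular G (\<lambda>u. c * indicator S u) = (\<integral>\<^sup>+u. ennreal (G \<bar>c\<bar>) * indicator S u \<partial>lebesgue)"
    unfolding modular_def using assms(2) by (intro nn_integral_cong) (auto simp: indicator_def)
  also have "\<dots> = ennreal (G \<bar>c\<bar>) * emeasure lebesgue S" using assms(1) by (rule nn_integral_cmult_indicator)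
  also have "\<dots> = ennreal (G \<bar>c\<bar> * measure lebesgue S)" using S by (simp add: emeasure_eq_measure2 ennreal_mult)
  finally show ?thesis .
qed

lemma mb_one: "mb (\<lambda>x. 1)"
  unfolding set_borel_measurable_def by (simp add: borel_measurable_indicator)

lemma mb_const_indicator: "S \<in> sets lebesgue \<Longrightarrow> mb (\<lambda>u. c * indicator S u)"
  using mb_cmult[OF mb_indicator[OF _ mb_one]] by simp

lemma normalized_indicator:
  assumes "S \<in> sets lebesgue" "S \<subseteq> {0..1}" "0 < measure lebesgue S"
  defines "s \<equiv> 1 / lux_norm G (indicator S)"
  shows "0 < s" "G s * measure lebesgue S \<le> D" "1 / D \<le> G s * measure lebesgue S"
    "indicator S \<in> orlicz_space G"
proof -
  let ?f = "indicator S :: real \<Rightarrow> real" and ?m = "measure lebesgue S"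
  have mod_eq: "modular G (\<lambda>u. ?f u / l) = ennreal (G (1 / l) * ?m)" if "0 < l" for l
    using modular_indicator[OF assms(1,2), of "1 / l"] that by simp
  have "modular G (\<lambda>u. 1 * ?f u) \<le> ennreal (max 1 (G 1 * ?m))"
    unfolding modular_indicator[OF assms(1,2)] by (intro ennreal_leI) auto
  then show f: "?f \<in> orlicz_space G"
    using modular_bound_lux(1)[of ?f] mb_const_indicator[OF assms(1), of 1] by simp
  \<comment> \<open>Positivity of the norm is needed before \<open>modular_at_norm\<close> applies:
    at a height b with \<open>G b * ?m\<close> at least 2 the modular exceeds 1, so no l below 1 / b
    is admissible.\<close>
  obtain b where b: "b \<ge> 1" "2 / ?m \<le> G b" using G_large by blast
  have "1 / b \<le> lux_norm G ?f"
  proof (rule lux_ge[OF f])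
    fix l :: real assume l: "0 < l" "modular G (\<lambda>x. ?f x / l) \<le> 1"
    then have "G (1 / l) * ?m \<le> 1" using mod_eq by simp
    moreover have "2 \<le> G b * ?m" using b assms(3) by (simp add: field_simps)
    ultimately have "G (1 / l) * ?m < G b * ?m" by linarith
    then have "G (1 / l) < G b" using assms(3) by (simp add: mult_less_cancel_right)
    then have "\<not> b \<le> 1 / l" using G_mono[of b "1 / l"] b by auto
    then show "1 / b \<le> l" using l b by (simp add: field_simps)
  qed
  then have pos: "0 < lux_norm G ?f" using b by (meson less_le_trans zero_less_divide_1_iff zero_less_one)
  then show "0 < s" by (simp add: s_def)
  have eq: "modular G (\<lambda>u. ?f u / lux_norm G ?f) = ennreal (G s * ?m)" using mod_eq[OF pos] by (simp add: s_def)
  have nn: "0 \<le> G s * ?m" using pos by (simp add: s_def)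
  show "G s * ?m \<le> D" using modular_at_norm(1)[OF f pos] D_ge_1 by (simp add: eq)
  have "ennreal 1 \<le> ennreal (D * (G s * ?m))"
    using modular_at_norm(2)[OF f pos] D_ge_1 nn unfolding eq by (simp add: ennreal_mult[symmetric])
  then have "1 \<le> D * (G s * ?m)" using D_ge_1 nn by (subst (asm) ennreal_le_iff) auto
  then show "1 / D \<le> G s * ?m" using D_ge_1 by (simp add: field_simps)
qed

text \<open>The n-th normalised indicator has the single level \<open>s n\<close>, which tends to
  infinity because the measures tend to 0. Either some bound on its kind recurs infinitely often, or
  the kinds eventually exceed every bound; in both cases one C serves all windows along a
  subsequence.\<close>

lemma restricted_r_DH_if:
  fixes ty :: "real \<Rightarrow> nat"
  assumes r: "1 \<le> r" and c: "0 < c"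
    and lower: "\<And>t s. 0 \<le> t \<Longrightarrow> t \<le> 1 \<Longrightarrow> 0 \<le> s \<Longrightarrow> c * t powr r * G s \<le> G (t * s)"
    and small: "\<And>N. \<exists>C\<ge>0. \<forall>T. \<exists>s0. \<forall>s\<ge>s0. ty s \<le> N \<longrightarrow>
      (\<forall>t. 1 / 2 ^ T \<le> t \<and> t \<le> 1 \<longrightarrow> G (t * s) \<le> C * t powr r * G s)"
    and large: "\<exists>C\<ge>0. \<forall>T. \<exists>N s0. \<forall>s\<ge>s0. N < ty s \<longrightarrow>
      (\<forall>t. 1 / 2 ^ T \<le> t \<and> t \<le> 1 \<longrightarrow> G (t * s) \<le> C * t powr r * G s)"
  shows "restricted_r_DH G r"
  unfolding restricted_r_DH_def
proof (intro allI impI, elim conjE)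
  fix A :: "nat \<Rightarrow> real set"
  assume A: "\<forall>n. A n \<in> sets lebesgue \<and> A n \<subseteq> {0..1} \<and> 0 < emeasure lebesgue (A n)"
    and disj: "disjoint_family A"
  define m where "m n = measure lebesgue (A n)" for n
  have A': "A n \<in> sets lebesgue" "A n \<subseteq> {0..1}" for n using A by auto
  have lm: "A n \<in> lmeasurable" for n
    using A' by (intro bounded_set_imp_lmeasurable bounded_subset[OF bounded_closed_interval[of 0 1]]) auto
  have m_pos: "0 < m n" for n
  proof -
    have "0 < emeasure lebesgue (A n)" using A by blast
    then show ?thesis using lm[of n] by (simp add: m_def emeasure_eq_measure2)
  qed
  have m_lim: "m \<longlonglongrightarrow> 0" unfolding m_def
    using A' disj by (intro measure_disjoint_tendsto_0) (auto simp: disjoint_family_on_def)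
  define s where "s n = 1 / lux_norm G (indicator (A n))" for n
  have s: "0 < s n" "G (s n) * m n \<le> D" "1 / D \<le> G (s n) * m n" "indicator (A n) \<in> orlicz_space G" for n
    using normalized_indicator[OF A', of n] m_pos[of n] unfolding s_def m_def by auto
  have s_large: "eventually (\<lambda>n. s0 \<le> s n) sequentially" for s0
  proof -
    have "(\<lambda>n. G (max 0 s0) * m n) \<longlonglongrightarrow> G (max 0 s0) * 0" by (intro tendsto_mult tendsto_const m_lim)
    then have "eventually (\<lambda>n. G (max 0 s0) * m n < 1 / D) sequentially"
      using D_ge_1 by (intro order_tendstoD(2)) auto
    then show ?thesis
    proof eventually_elim
      case (elim n)
      show ?case
      proof (rule ccontr)
        assume "\<not> s0 \<le> s n"
        then have "G (s n) * m n \<le> G (max 0 s0) * m n"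
          using s(1)[of n] m_pos[of n] by (intro mult_right_mono G_mono) auto
        then show False using elim s(3)[of n] by linarith
      qed
    qed
  qed
  have "\<exists>C\<ge>0. \<forall>T. \<exists>\<^sub>\<infinity>n. \<forall>t. 1 / 2 ^ T \<le> t \<and> t \<le> 1 \<longrightarrow> G (t * s n) \<le> C * t powr r * G (s n)"
  proof (cases "\<exists>N. \<exists>\<^sub>\<infinity>n. ty (s n) \<le> N")
    case True
    then obtain N where N: "\<exists>\<^sub>\<infinity>n. ty (s n) \<le> N" by blast
    obtain C where C: "0 \<le> C" "\<And>T. \<exists>s0. \<forall>s\<ge>s0. ty s \<le> N \<longrightarrow>
      (\<forall>t. 1 / 2 ^ T \<le> t \<and> t \<le> 1 \<longrightarrow> G (t * s) \<le> C * t powr r * G s)" using small by blast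
    have "\<exists>\<^sub>\<infinity>n. \<forall>t. 1 / 2 ^ T \<le> t \<and> t \<le> 1 \<longrightarrow> G (t * s n) \<le> C * t powr r * G (s n)" for T
    proof -
      obtain s0 where s0: "\<And>s. s \<ge> s0 \<Longrightarrow> ty s \<le> N \<Longrightarrow>
        (\<forall>t. 1 / 2 ^ T \<le> t \<and> t \<le> 1 \<longrightarrow> G (t * s) \<le> C * t powr r * G s)" using C(2) by blast
      have "\<exists>\<^sub>\<infinity>n. ty (s n) \<le> N \<and> s0 \<le> s n"
        using N s_large[of s0] by (intro INFM_conjI) (simp_all add: cofinite_eq_sequentially)
      then show ?thesis by (rule INFM_mono) (use s0 in blast)
    qed
    then show ?thesis using C(1) by blast
  next
    case False
    obtain C where C: "0 \<le> C" "\<And>T. \<exists>N s0. \<forall>s\<ge>s0. N < ty s \<longrightarrow>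
      (\<forall>t. 1 / 2 ^ T \<le> t \<and> t \<le> 1 \<longrightarrow> G (t * s) \<le> C * t powr r * G s)" using large by blast
    have "\<exists>\<^sub>\<infinity>n. \<forall>t. 1 / 2 ^ T \<le> t \<and> t \<le> 1 \<longrightarrow> G (t * s n) \<le> C * t powr r * G (s n)" for T
    proof -
      obtain N s0 where s0: "\<And>s. s \<ge> s0 \<Longrightarrow> N < ty s \<Longrightarrow>
        (\<forall>t. 1 / 2 ^ T \<le> t \<and> t \<le> 1 \<longrightarrow> G (t * s) \<le> C * t powr r * G s)" using C(2) by blast
      have "eventually (\<lambda>n. N < ty (s n)) sequentially"
        using False by (simp add: frequently_def cofinite_eq_sequentially not_le)
      then have "eventually (\<lambda>n. \<forall>t. 1 / 2 ^ T \<le> t \<and> t \<le> 1 \<longrightarrow> G (t * s n) \<le> C * t powr r * G (s n)) sequentially"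
        using s_large[of s0] by eventually_elim (use s0 in blast)
      then show ?thesis by (rule INFM_if_eventually)
    qed
    then show ?thesis using C(1) by blast
  qed
  then obtain C where C: "0 \<le> C" "\<And>T. \<exists>\<^sub>\<infinity>n. \<forall>t. 1 / 2 ^ T \<le> t \<and> t \<le> 1 \<longrightarrow> G (t * s n) \<le> C * t powr r * G (s n)"
    by blast
  obtain \<sigma> where \<sigma>: "strict_mono \<sigma>"
    "\<And>k. \<forall>t. 1 / 2 ^ k \<le> t \<and> t \<le> 1 \<longrightarrow> G (t * s (\<sigma> k)) \<le> C * t powr r * G (s (\<sigma> k))"
    using strict_mono_choice[of "\<lambda>k n. \<forall>t. 1 / 2 ^ k \<le> t \<and> t \<le> 1 \<longrightarrow>
      G (t * s n) \<le> C * t powr r * G (s n)"] C(2) by blast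
  define y where "y k u = indicator (A (\<sigma> k)) u / lux_norm G (indicator (A (\<sigma> k)))" for k and u :: real
  have y: "y k = (\<lambda>u. s (\<sigma> k) * indicator (A (\<sigma> k)) u)" for k by (simp add: y_def s_def fun_eq_iff)
  have "equiv_lr G r y"
  proof (rule equiv_lrI[OF r, of "c / D" "C * D"])
    show "0 < c / D" "0 \<le> C * D" using c C(1) D_ge_1 by auto
    show "y i \<in> orlicz_space G" for i unfolding y by (intro orlicz_scale s)
    have "disjoint_fun (y i) (y j)" if "i \<noteq> j" for i j
    proof -
      have "A (\<sigma> i) \<inter> A (\<sigma> j) = {}"
        using disj that strict_mono_eq[OF \<sigma>(1)] by (auto simp: disjoint_family_on_def)
      then have "{u \<in> {0..1}. y i u \<noteq> 0 \<and> y j u \<noteq> 0} = {}" by (auto simp: y indicator_def)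
      then show ?thesis unfolding disjoint_fun_def by (simp only: emeasure_empty)
    qed
    then show "disjoint_seq y" by (simp add: disjoint_seq_def)
    fix k and t :: real assume t: "1 / 2 ^ k \<le> t" "t \<le> 1"
    have t0: "0 \<le> t" using t by (meson order_trans zero_le_divide_1_iff zero_le_numeral zero_le_power)
    let ?s = "s (\<sigma> k)" and ?m = "m (\<sigma> k)"
    have mod_eq: "modular G (\<lambda>u. t * y k u) = ennreal (G (t * ?s) * ?m)"
      using modular_indicator[OF A', of "t * ?s" "\<sigma> k"] s(1)[of "\<sigma> k"] t0 by (simp add: y m_def mult.assoc)
    have "c / D * t powr r = c * t powr r * (1 / D)" by simp
    also have "\<dots> \<le> c * t powr r * (G ?s * ?m)" using s(3)[of "\<sigma> k"] c by (intro mult_left_mono) auto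
    also have "\<dots> \<le> G (t * ?s) * ?m"
      using mult_right_mono[OF lower[OF t0 t(2), of ?s], of ?m] s(1)[of "\<sigma> k"] m_pos[of "\<sigma> k"] by (simp add: mult.assoc)
    finally show "ennreal (c / D * t powr r) \<le> modular G (\<lambda>u. t * y k u)" unfolding mod_eq by (rule ennreal_leI)
    have "G (t * ?s) * ?m \<le> (C * t powr r * G ?s) * ?m"
      using \<sigma>(2)[of k] t m_pos[of "\<sigma> k"] by (intro mult_right_mono) auto
    also have "\<dots> = C * t powr r * (G ?s * ?m)" by simp
    also have "\<dots> \<le> C * t powr r * D" using s(2)[of "\<sigma> k"] C(1) by (intro mult_left_mono) auto
    finally show "modular G (\<lambda>u. t * y k u) \<le> ennreal (C * D * t powr r)"
      unfolding mod_eq by (intro ennreal_leI) (simp add: mult_ac)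
  qed
  then show "\<exists>\<sigma>. strict_mono \<sigma> \<and>
      equiv_lr G r (\<lambda>k t. indicator (A (\<sigma> k)) t / lux_norm G (indicator (A (\<sigma> k))))"
    using \<sigma>(1) unfolding y_def by blast
qed

end

section \<open>Failure of DH and DC\<close>

lemma sum_halves: "K < n \<Longrightarrow> (\<Sum>N\<in>{K<..<n}. 1 / 2 ^ (N + 1)) + 1 / 2 ^ n = (1 / 2 ^ (K + 1) :: real)"
proof (induction n)
  case (Suc n)
  show ?case
  proof (cases "K = n")
    case False
    then have "K < n" using Suc.prems by simp
    moreover then have "{K<..<Suc n} = insert n {K<..<n}" by auto
    ultimately show ?thesis using Suc.IH by simp
  next
    case True
    then have "{K<..<Suc n} = {}" by auto
    then show ?thesis using True by simp
  qed
qed simp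

lemma sum_halves_0: "(\<Sum>N<n. 1 / 2 ^ (N + 1)) + 1 / 2 ^ n = (1 :: real)"
  by (induction n) (auto simp: field_simps)

text \<open>A geometric law truncated at n, with the leftover 1 / 2 ^ n placed on N = n: the total
  over N up to n is exactly 1, each fixed N keeps a share independent of n from below, and the tails
  are small uniformly in n.\<close>

definition weight :: "nat \<Rightarrow> nat \<Rightarrow> real" where
  "weight N n = (if N < n then 1 / 2 ^ (N + 1) else 1 / 2 ^ n)"

lemma weight_bounds: "0 < weight N n" "weight N n \<le> 1"
  using one_le_power[of "2::real" "N + 1"] one_le_power[of "2::real" n]
  unfolding weight_def by (auto simp: divide_le_eq simp del: power_Suc)

lemma weight_ge: "N \<le> n \<Longrightarrow> 1 / 2 ^ (N + 1) \<le> weight N n"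
  by (auto simp: weight_def divide_le_eq field_simps)

lemma weight_sum: "(\<Sum>N\<le>n. weight N n) = 1"
proof -
  have "(\<Sum>N\<le>n. weight N n) = (\<Sum>N<n. 1 / 2 ^ (N + 1)) + 1 / 2 ^ n"
    by (simp add: lessThan_Suc_atMost[symmetric] weight_def)
  then show ?thesis using sum_halves_0 by simp
qed

lemma weight_tail: "(\<Sum>N\<in>{K<..n}. weight N n) \<le> 1 / 2 ^ (K + 1)"
proof (cases "K < n")
  case True
  then have "{K<..n} = insert n {K<..<n}" by auto
  then have "(\<Sum>N\<in>{K<..n}. weight N n) = (\<Sum>N\<in>{K<..<n}. 1 / 2 ^ (N + 1)) + 1 / 2 ^ n"
    by (simp add: weight_def)
  then show ?thesis using sum_halves[OF True] by simp
qed simp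

definition dyadic_cell :: "nat \<Rightarrow> real set" where
  "dyadic_cell i = {1 / 2 ^ (i + 1)..<1 / 2 ^ i}"

lemma dyadic_cell_disjoint: "i \<noteq> j \<Longrightarrow> dyadic_cell i \<inter> dyadic_cell j = {}"
proof -
  have *: "dyadic_cell i \<inter> dyadic_cell j = {}" if "i < j" for i j
  proof -
    have "(2::real) ^ (i + 1) \<le> 2 ^ j" using that by (intro power_increasing) auto
    then have "(1::real) / 2 ^ j \<le> 1 / 2 ^ (i + 1)" by (intro divide_left_mono) auto
    then show ?thesis by (auto simp: dyadic_cell_def)
  qed
  assume "i \<noteq> j"
  then show ?thesis using *[of i j] *[of j i] by (cases i j rule: linorder_cases) auto
qed

lemma dyadic_cell_unit: "dyadic_cell i \<subseteq> {0..1}"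
proof -
  have "(1::real) / 2 ^ i \<le> 1" by (simp add: divide_le_eq)
  moreover have "(0::real) \<le> 1 / 2 ^ (i + 1)" by simp
  ultimately have "0 \<le> x \<and> x \<le> 1" if "1 / 2 ^ (i + 1) \<le> x" "x < 1 / 2 ^ i" for x :: real
    using that by linarith
  then show ?thesis unfolding dyadic_cell_def by auto
qed

text \<open>The region reserved for the n-th function, whatever weights are used. The diagonal
  argument cuts along zones, so it needs no knowledge of exact supports.\<close>

definition zone :: "nat \<Rightarrow> real set" where
  "zone n = (\<Union>N\<le>n. dyadic_cell (prod_encode (N, n)))"

lemma zone_disjoint: "m \<noteq> n \<Longrightarrow> zone m \<inter> zone n = {}"
proof -
  assume "m \<noteq> n"
  then have "dyadic_cell (prod_encode (M, m)) \<inter> dyadic_cell (prod_encode (N, n)) = {}" for M N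
    by (intro dyadic_cell_disjoint) simp
  then show ?thesis unfolding zone_def by blast
qed

lemma zone_measurable: "zone n \<in> sets lebesgue"
  unfolding zone_def dyadic_cell_def by auto

context orlicz_delta2
begin

text \<open>No factor D is lost here: by \<open>modular_stretch\<close>, dividing by some l < 1
  raises a modular of 1 strictly above 1.\<close>

lemma lux_eq_1:
  assumes "mb f" "modular G f = 1"
  shows "f \<in> orlicz_space G" "lux_norm G f = 1"
proof -
  show f: "f \<in> orlicz_space G" using orlicz_spaceI[OF assms(1), of 1] assms(2) by simp
  have "lux_norm G f \<le> 1" using lux_le[of 1 f] assms(2) by simp
  moreover have "1 \<le> lux_norm G f"
  proof (rule lux_ge[OF f])
    fix l :: real assume l: "0 < l" "modular G (\<lambda>x. f x / l) \<le> 1"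
    show "1 \<le> l"
    proof (rule ccontr)
      assume "\<not> 1 \<le> l"
      then have gt: "1 < 1 / l" using l by simp
      have "ennreal (1 / l) * modular G f \<le> modular G (\<lambda>x. 1 / l * f x)"
        using gt by (intro modular_stretch[OF assms(1)]) simp
      then have "ennreal (1 / l) \<le> modular G (\<lambda>x. f x / l)" using assms(2) by simp
      also have "\<dots> \<le> ennreal 1" using l(2) by simp
      finally have "1 / l \<le> 1" by (subst (asm) ennreal_le_iff) auto
      then show False using gt by simp
    qed
  qed
  ultimately show "lux_norm G f = 1" by simp
qed

lemma modular_double_power: "mb f \<Longrightarrow> modular G (\<lambda>x. 2 ^ j * f x) \<le> ennreal (D ^ j) * modular G f"
proof (induction j)
  case (Suc j)
  have "modular G (\<lambda>x. 2 ^ Suc j * f x) = modular G (\<lambda>x. 2 * (2 ^ j * f x))" by (simp add: mult.assoc)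
  also have "\<dots> \<le> ennreal D * modular G (\<lambda>x. 2 ^ j * f x)" using Suc by (intro modular_double mb_cmult)
  also have "\<dots> \<le> ennreal D * (ennreal (D ^ j) * modular G f)" using Suc by (intro mult_left_mono) auto
  finally show ?case using D_ge_1 by (simp add: mult.assoc[symmetric] ennreal_mult[symmetric])
qed simp

lemma lin_comb_unit: "k < N \<Longrightarrow> lin_comb (\<lambda>i. if i = k then 1 else 0) X N = X k"
  unfolding lin_comb_def by (auto simp: if_distrib[of "\<lambda>a. a * _"] sum.delta cong: if_cong)

end

text \<open>The factor \<open>4 ^ (N + 1)\<close> is chosen to outweigh the share \<open>1 / 2 ^ (N + 1)\<close> of the \<open>N\<close>-th levels
  in the mixtures; the lower bound on \<open>G (s N n)\<close> makes the supports fit into disjoint dyadic cells.\<close>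
locale nonuniform_levels = orlicz_delta2 +
  fixes r :: real and \<tau> C :: "nat \<Rightarrow> real" and s :: "nat \<Rightarrow> nat \<Rightarrow> real"
  assumes r: "1 \<le> r"
    and \<tau>: "0 < \<tau> N" "\<tau> N \<le> 1"
    and C: "0 \<le> C N"
    and s: "0 < s N n" "2 ^ (prod_encode (N, n) + 1) \<le> G (s N n)"
    and bad: "4 ^ (N + 1) * \<tau> N powr r * G (s N n) \<le> G (\<tau> N * s N n)"
    and good: "1 / 2 ^ n \<le> t \<Longrightarrow> t \<le> 1 \<Longrightarrow> G (t * s N n) \<le> C N * t powr r * G (s N n)"
begin

lemma Gs_pos: "0 < G (s N n)" using G_pos s(1) by blast

text \<open>Sits at the left end of the cell with code i of (N, n). The length makes height
  \<open>s N n\<close> on it have modular \<open>w N n\<close>; for weights up to 1 it fits, since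
  the cell has length 1 / 2 ^ (i + 1) and \<open>G (s N n)\<close> is at least the
  reciprocal.\<close>

definition piece :: "(nat \<Rightarrow> nat \<Rightarrow> real) \<Rightarrow> nat \<Rightarrow> nat \<Rightarrow> real set" where
  "piece w N n = {1 / 2 ^ (prod_encode (N, n) + 1)..<1 / 2 ^ (prod_encode (N, n) + 1) + w N n / G (s N n)}"

definition steps :: "(nat \<Rightarrow> nat \<Rightarrow> real) \<Rightarrow> nat set \<Rightarrow> nat \<Rightarrow> real \<Rightarrow> real" where
  "steps w I n u = (\<Sum>N\<in>I. s N n * indicator (piece w N n) u)"

lemma piece_subset:
  assumes "w N n \<le> 1"
  shows "piece w N n \<subseteq> dyadic_cell (prod_encode (N, n))"
proof -
  let ?i = "prod_encode (N, n)"
  have "w N n / G (s N n) \<le> 1 / 2 ^ (?i + 1)"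
    using assms s(2)[of N n] Gs_pos[of N n] by (intro frac_le) auto
  moreover have "1 / 2 ^ (?i + 1) + 1 / 2 ^ (?i + 1) = (1 / 2 ^ ?i :: real)" by simp
  ultimately have "1 / 2 ^ (?i + 1) + w N n / G (s N n) \<le> 1 / 2 ^ ?i" by linarith
  then show ?thesis unfolding piece_def dyadic_cell_def
    by (intro subsetI) (auto simp del: power_Suc intro: less_le_trans)
qed

lemma piece_measurable: "piece w N n \<in> sets lebesgue"
  unfolding piece_def by simp

lemma steps_mb: "mb (steps w I n)"
  unfolding steps_def by (intro mb_sum mb_const_indicator piece_measurable)

lemma steps_support:
  assumes "\<And>N. w N n \<le> 1" "I \<subseteq> {..n}" "u \<notin> zone n"
  shows "steps w I n u = 0"
proof -
  have "u \<notin> piece w N n" if "N \<in> I" for N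
    using piece_subset[of w N n, OF assms(1)] assms(2,3) that unfolding zone_def by blast
  then show ?thesis unfolding steps_def by simp
qed

lemma modular_steps:
  assumes "finite I" "\<And>N. 0 \<le> w N n" "\<And>N. w N n \<le> 1" "0 \<le> t"
  shows "modular G (\<lambda>u. t * steps w I n u) = (\<Sum>N\<in>I. ennreal (w N n * (G (t * s N n) / G (s N n))))"
proof -
  have sub: "piece w N n \<subseteq> {0..1}" for N
    using piece_subset[of w N n, OF assms(3)] dyadic_cell_unit by blast
  have meas: "measure lebesgue (piece w N n) = w N n / G (s N n)" for N
  proof -
    have "0 \<le> w N n / G (s N n)" using assms(2) Gs_pos[of N n] by simp
    then show ?thesis unfolding piece_def by simp
  qed
  have "modular G (\<lambda>u. t * steps w I n u) = modular G (\<lambda>u. \<Sum>N\<in>I. (t * s N n) * indicator (piece w N n) u)"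
    by (simp add: steps_def sum_distrib_left mult.assoc)
  also have "\<dots> = (\<Sum>N\<in>I. modular G (\<lambda>u. (t * s N n) * indicator (piece w N n) u))"
  proof (rule modular_disjoint_sum[OF assms(1)])
    show "mb (\<lambda>u. (t * s N n) * indicator (piece w N n) u)" for N
      by (intro mb_const_indicator piece_measurable)
    fix M N assume "M \<in> I" "N \<in> I" "M \<noteq> N"
    then have "dyadic_cell (prod_encode (M, n)) \<inter> dyadic_cell (prod_encode (N, n)) = {}"
      by (intro dyadic_cell_disjoint) simp
    then have "piece w M n \<inter> piece w N n = {}"
      using piece_subset[of w M n, OF assms(3)] piece_subset[of w N n, OF assms(3)] by blast
    then have "{u \<in> {0..1}. (t * s M n) * indicator (piece w M n) u \<noteq> 0 \<and> (t * s N n) * indicator (piece w N n) u \<noteq> 0} = {}"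
      by (auto simp: indicator_def)
    then show "disjoint_fun (\<lambda>u. (t * s M n) * indicator (piece w M n) u) (\<lambda>u. (t * s N n) * indicator (piece w N n) u)"
      unfolding disjoint_fun_def by (simp only: emeasure_empty)
  qed
  also have "\<dots> = (\<Sum>N\<in>I. ennreal (w N n * (G (t * s N n) / G (s N n))))"
  proof (rule sum.cong[OF refl])
    fix N
    have "0 \<le> t * s N n" using assms(4) s(1)[of N n] by simp
    then show "modular G (\<lambda>u. (t * s N n) * indicator (piece w N n) u) = ennreal (w N n * (G (t * s N n) / G (s N n)))"
      using modular_indicator[OF piece_measurable sub, of "t * s N n" N] by (simp add: meas mult.commute)
  qed
  finally show ?thesis .
qed

lemma modular_steps_1:
  assumes "finite I" "\<And>N. 0 \<le> w N n" "\<And>N. w N n \<le> 1"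
  shows "modular G (steps w I n) = ennreal (\<Sum>N\<in>I. w N n)"
proof -
  have "G (s N n) / G (s N n) = 1" for N using Gs_pos[of N n] by simp
  then show ?thesis
    using modular_steps[of I w n 1] assms by (simp add: sum_ennreal)
qed

lemma steps_disjoint:
  assumes "\<And>N n. w N n \<le> 1" "\<And>n. I n \<subseteq> {..n}" "strict_mono \<sigma>"
  shows "disjoint_seq (\<lambda>k. steps w (I (\<sigma> k)) (\<sigma> k))"
  unfolding disjoint_seq_def
proof (intro allI impI)
  fix j k :: nat assume "j \<noteq> k"
  then have "zone (\<sigma> j) \<inter> zone (\<sigma> k) = {}" using strict_mono_eq[OF assms(3)] by (intro zone_disjoint) simp
  then have "steps w (I (\<sigma> j)) (\<sigma> j) u = 0 \<or> steps w (I (\<sigma> k)) (\<sigma> k) u = 0" for u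
    using steps_support[of w "\<sigma> j" "I (\<sigma> j)" u, OF assms(1,2)]
      steps_support[of w "\<sigma> k" "I (\<sigma> k)" u, OF assms(1,2)] by blast
  then have "{u \<in> {0..1}. steps w (I (\<sigma> j)) (\<sigma> j) u \<noteq> 0 \<and> steps w (I (\<sigma> k)) (\<sigma> k) u \<noteq> 0} = {}"
    by auto
  then show "disjoint_fun (steps w (I (\<sigma> j)) (\<sigma> j)) (steps w (I (\<sigma> k)) (\<sigma> k))"
    unfolding disjoint_fun_def by (simp only: emeasure_empty)
qed

text \<open>With the types bounded by K, the constants \<open>C N\<close> add up to one finite S. As
  \<open>\<sigma> k\<close> is at least k, the window of \<open>good\<close> at
  \<open>\<sigma> k\<close> contains the k-th window.\<close>

lemma steps_upper_estimate:
  assumes "\<And>N n. 0 \<le> w N n" "\<And>N n. w N n \<le> 1" "\<And>n. I n \<subseteq> {..n}" "\<And>n. I n \<subseteq> {..K}" "strict_mono \<sigma>"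
  shows "\<exists>C'\<ge>0. \<forall>a m. lux_norm G (lin_comb a (\<lambda>k. steps w (I (\<sigma> k)) (\<sigma> k)) m)
           \<le> C' * (\<Sum>i<m. \<bar>a i\<bar> powr r) powr (1 / r)"
proof -
  define S where "S = (\<Sum>N\<le>K. C N)"
  have S: "0 \<le> S" unfolding S_def using C by (simp add: sum_nonneg)
  have "lux_norm G (lin_comb a (\<lambda>k. steps w (I (\<sigma> k)) (\<sigma> k)) m)
       \<le> max 1 (3 * S) * (\<Sum>i<m. \<bar>a i\<bar> powr r) powr (1 / r)" for a m
  proof (rule powr_upper_estimate[OF r S steps_mb steps_disjoint[OF assms(2,3,5)]])
    fix k and t :: real assume t: "1 / 2 ^ k \<le> t" "t \<le> 1"
    let ?n = "\<sigma> k"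
    have "(2::real) ^ k \<le> 2 ^ ?n" using strict_mono_imp_increasing[OF assms(5)] by (intro power_increasing) auto
    then have "(1::real) / 2 ^ ?n \<le> 1 / 2 ^ k" by (intro divide_left_mono) auto
    then have tn: "1 / 2 ^ ?n \<le> t" using t by simp
    have t0: "0 < t" using t(1) by (meson less_le_trans zero_less_divide_1_iff zero_less_numeral zero_less_power)
    have fin: "finite (I ?n)" using assms(4) finite_subset by blast
    have "modular G (\<lambda>u. t * steps w (I ?n) ?n u) = (\<Sum>N\<in>I ?n. ennreal (w N ?n * (G (t * s N ?n) / G (s N ?n))))"
      using t0 by (intro modular_steps fin assms) auto
    also have "\<dots> \<le> (\<Sum>N\<in>I ?n. ennreal (C N * t powr r))"
    proof (intro sum_mono ennreal_leI)
      fix N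
      have "w N ?n * (G (t * s N ?n) / G (s N ?n)) \<le> 1 * (C N * t powr r)"
        using good[OF tn t(2), of N] assms(1,2) C Gs_pos[of N ?n] t0 s(1)[of N ?n]
        by (intro mult_mono) (auto simp: divide_le_eq less_imp_le)
      then show "w N ?n * (G (t * s N ?n) / G (s N ?n)) \<le> C N * t powr r" by simp
    qed
    also have "\<dots> = ennreal (\<Sum>N\<in>I ?n. C N * t powr r)" using C by (intro sum_ennreal) auto
    also have "\<dots> \<le> ennreal (\<Sum>N\<le>K. C N * t powr r)"
      using assms(4) C by (intro ennreal_leI sum_mono2) auto
    finally show "modular G (\<lambda>u. t * steps w (I (\<sigma> k)) (\<sigma> k) u) \<le> ennreal (S * t powr r)"
      by (simp add: S_def sum_distrib_right)
  qed
  then show ?thesis by (intro exI[of _ "max 1 (3 * S)"]) auto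
qed

section \<open>Mixtures of all types and the two negative results\<close>

definition mix :: "nat \<Rightarrow> real \<Rightarrow> real" where
  "mix n = steps weight {..n} n"

lemma mix_norm: "mix n \<in> orlicz_space G" "lux_norm G (mix n) = 1"
proof -
  have "modular G (mix n) = ennreal (\<Sum>N\<le>n. weight N n)"
    unfolding mix_def using weight_bounds by (intro modular_steps_1) (auto simp: less_imp_le)
  then have "modular G (mix n) = 1" by (simp add: weight_sum)
  then show "mix n \<in> orlicz_space G" "lux_norm G (mix n) = 1"
    using lux_eq_1[of "mix n"] steps_mb unfolding mix_def by auto
qed

lemma mix_disjoint: "strict_mono \<sigma> \<Longrightarrow> disjoint_seq (mix \<circ> \<sigma>)"
  using steps_disjoint[of weight "\<lambda>n. {..n}" \<sigma>] weight_bounds by (simp add: mix_def comp_def)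

text \<open>Take about \<open>1 / \<tau> N powr r\<close> equal coefficients
  \<open>\<tau> N\<close>: their l_r norm lies between 1 and 2, while the levels of type N alone
  contribute their share 1 / 2 ^ (N + 1) times the gain 4 ^ (N + 1), which pushes the modular to at
  least 2 ^ N. The bound B would keep it below a constant independent of N.\<close>

lemma mix_no_upper_estimate:
  assumes "strict_mono \<sigma>"
    and upper: "\<And>a m. lux_norm G (lin_comb a (mix \<circ> \<sigma>) m) \<le> B * (\<Sum>i<m. \<bar>a i\<bar> powr r) powr (1 / r)"
  shows False
proof -
  \<comment> \<open>A norm of at most 2 |B| < 2 ^ j gives, after j doublings, a modular of at most D
    ^ j; N is then chosen to beat this.\<close>
  obtain j where j: "2 * \<bar>B\<bar> < 2 ^ j" using real_arch_pow[of 2 "2 * \<bar>B\<bar>"] by auto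
  obtain N where N: "D ^ j < 2 ^ N" using real_arch_pow[of 2 "D ^ j"] by auto
  define t where "t = \<tau> N"
  have t: "0 < t" "t \<le> 1" using \<tau> by (auto simp: t_def)
  define m where "m = nat \<lceil>1 / t powr r\<rceil>"
  have tr: "0 < t powr r" "t powr r \<le> 1" using t r by (auto simp: powr_le1)
  have "1 / t powr r \<le> real m" "real m \<le> 1 / t powr r + 1"
    unfolding m_def using tr by (simp_all add: ceiling_correct le_of_int_ceiling of_nat_nat)
  then have m: "1 \<le> real m * t powr r" "real m * t powr r \<le> 2"
    using tr by (simp_all add: field_simps)
  \<comment> \<open>The support starts at N so that \<open>\<sigma> i\<close> is at least N, which
    puts type N with weight at least 1 / 2 ^ (N + 1) into every mixture used.\<close>
  define a where "a i = (if N \<le> i then t else 0)" for i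
  let ?M = "N + m"
  have "(\<Sum>i<?M. \<bar>a i\<bar> powr r) = (\<Sum>i\<in>{N..<?M}. t powr r)"
  proof -
    have "(\<Sum>i<?M. \<bar>a i\<bar> powr r) = (\<Sum>i\<in>{N..<?M}. \<bar>a i\<bar> powr r)"
      by (rule sum.mono_neutral_right) (auto simp: a_def)
    also have "\<dots> = (\<Sum>i\<in>{N..<?M}. t powr r)" using t by (intro sum.cong) (auto simp: a_def)
    finally show ?thesis .
  qed
  then have asum: "(\<Sum>i<?M. \<bar>a i\<bar> powr r) = real m * t powr r" by simp
  have "(real m * t powr r) powr (1 / r) \<le> 2 powr (1 / r)" using m r by (intro powr_mono2) auto
  also have "\<dots> \<le> 2 powr 1" using r by (intro powr_mono) auto
  finally have R: "(\<Sum>i<?M. \<bar>a i\<bar> powr r) powr (1 / r) \<le> 2" unfolding asum by simp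
  let ?f = "lin_comb a (mix \<circ> \<sigma>) ?M"
  have f: "?f \<in> orlicz_space G" using mix_norm(1) by (intro orlicz_lin_comb) simp
  have "lux_norm G ?f \<le> \<bar>B\<bar> * 2"
  proof -
    have "lux_norm G ?f \<le> B * (\<Sum>i<?M. \<bar>a i\<bar> powr r) powr (1 / r)" by (rule upper)
    also have "\<dots> \<le> \<bar>B\<bar> * 2" using R by (intro mult_mono) auto
    finally show ?thesis .
  qed
  then have "modular G (\<lambda>u. ?f u / 2 ^ j) \<le> 1" using lux_less[OF f, of "2 ^ j"] j by simp
  then have "ennreal (D ^ j) * modular G (\<lambda>u. ?f u / 2 ^ j) \<le> ennreal (D ^ j) * 1" by (intro mult_left_mono) auto
  then have "modular G (\<lambda>u. 2 ^ j * (?f u / 2 ^ j)) \<le> ennreal (D ^ j)"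
    using modular_double_power[OF mb_divide[OF orlicz_mb[OF f]], of j "2 ^ j"] by simp
  then have le: "modular G ?f \<le> ennreal (D ^ j)" by simp
  have part: "ennreal (2 ^ (N + 1) * t powr r) \<le> modular G (\<lambda>u. \<bar>a i\<bar> * (mix \<circ> \<sigma>) i u)" if "i \<in> {N..<?M}" for i
  proof -
    have ai: "\<bar>a i\<bar> = t" using that t by (simp add: a_def)
    have Ni: "N \<le> \<sigma> i" using that strict_mono_imp_increasing[OF assms(1), of i] by simp
    let ?g = "\<lambda>N. ennreal (weight N (\<sigma> i) * (G (t * s N (\<sigma> i)) / G (s N (\<sigma> i))))"
    have "2 ^ (N + 1) * t powr r = 1 / 2 ^ (N + 1) * (4 ^ (N + 1) * t powr r)"
      using power_mult_distrib[of "2::real" 2 "N + 1"] by simp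
    also have "\<dots> \<le> weight N (\<sigma> i) * (G (t * s N (\<sigma> i)) / G (s N (\<sigma> i)))"
      using bad[of N "\<sigma> i"] Gs_pos[of N "\<sigma> i"] weight_ge[OF Ni]
      by (intro mult_mono) (auto simp: t_def le_divide_eq less_imp_le[OF weight_bounds(1)])
    finally have "ennreal (2 ^ (N + 1) * t powr r) \<le> ?g N" by (rule ennreal_leI)
    also have "\<dots> \<le> (\<Sum>N\<in>{..\<sigma> i}. ?g N)" using Ni by (intro member_le_sum) auto
    also have "\<dots> = modular G (\<lambda>u. t * steps weight {..\<sigma> i} (\<sigma> i) u)"
      using t weight_bounds by (intro modular_steps[symmetric]) (auto simp: less_imp_le)
    finally show ?thesis by (simp add: ai mix_def)
  qed
  have "2 ^ N \<le> 2 ^ (N + 1) * (real m * t powr r)"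
    using mult_mono[OF power_increasing[of N "N + 1" "2::real"] m(1)] by simp
  then have "ennreal (2 ^ N) \<le> ennreal (2 ^ (N + 1) * (real m * t powr r))" by (rule ennreal_leI)
  also have "\<dots> = ennreal (\<Sum>i\<in>{N..<?M}. 2 ^ (N + 1) * t powr r)" by (simp add: mult_ac)
  also have "\<dots> = (\<Sum>i\<in>{N..<?M}. ennreal (2 ^ (N + 1) * t powr r))" by (rule sum_ennreal[symmetric]) simp
  also have "\<dots> \<le> (\<Sum>i\<in>{N..<?M}. modular G (\<lambda>u. \<bar>a i\<bar> * (mix \<circ> \<sigma>) i u))" by (intro sum_mono part)
  also have "\<dots> \<le> (\<Sum>i<?M. modular G (\<lambda>u. \<bar>a i\<bar> * (mix \<circ> \<sigma>) i u))" by (intro sum_mono2) auto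
  also have "\<dots> = modular G ?f"
    using mix_norm(1) by (intro modular_lin_comb[symmetric] mix_disjoint[OF assms(1)]) (auto intro: orlicz_mb)
  also note le
  finally have "(2::real) ^ N \<le> D ^ j" using D_ge_1 by simp
  then show False using N by simp
qed

text \<open>The comparison sequence uses type 0 alone, so \<open>steps_upper_estimate\<close>
  applies to it; an equivalence would pass its upper estimate on to the mixtures.\<close>

lemma not_DH: "\<not> DH G"
proof
  assume DH: "DH G"
  define w where "w N n = (if N = 0 then 1 else 0 :: real)" for N n :: nat
  define y where "y n = steps w {0} n" for n
  have w: "0 \<le> w N n" "w N n \<le> 1" for N n by (auto simp: w_def)
  have "modular G (y n) = 1" for n
    using modular_steps_1[of "{0}" w n] w by (simp add: y_def w_def)
  then have y: "y n \<in> orlicz_space G" "lux_norm G (y n) = 1" for n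
    using lux_eq_1[of "y n"] steps_mb unfolding y_def by auto
  have "disjoint_seq y"
    using steps_disjoint[of w "\<lambda>_. {0}" id] w by (simp add: y_def[abs_def] strict_mono_id)
  then have "normalized_disjoint_seq G y" using y by (simp add: normalized_disjoint_seq_def)
  moreover have "normalized_disjoint_seq G mix"
    using mix_norm mix_disjoint[of id] by (simp add: normalized_disjoint_seq_def strict_mono_id)
  ultimately obtain \<sigma> where \<sigma>: "strict_mono \<sigma>" "equiv_seq G (mix \<circ> \<sigma>) (y \<circ> \<sigma>)"
    using DH unfolding DH_def by blast
  then obtain c where c: "0 < c" "\<And>N a. lux_norm G (lin_comb a (mix \<circ> \<sigma>) N) \<le> c * lux_norm G (lin_comb a (y \<circ> \<sigma>) N)"
    unfolding equiv_seq_def by blast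
  obtain C' where C': "\<And>a m. lux_norm G (lin_comb a (y \<circ> \<sigma>) m) \<le> C' * (\<Sum>i<m. \<bar>a i\<bar> powr r) powr (1 / r)"
    using steps_upper_estimate[of w "\<lambda>_. {0}" 0 \<sigma>] w \<sigma>(1) by (auto simp: y_def comp_def)
  have "lux_norm G (lin_comb a (mix \<circ> \<sigma>) m) \<le> (c * C') * (\<Sum>i<m. \<bar>a i\<bar> powr r) powr (1 / r)" for a m
    using order_trans[OF c(2)[of a m] mult_left_mono[OF C'[of a m]]] c(1) by (simp add: mult.assoc)
  then show False by (rule mix_no_upper_estimate[OF \<sigma>(1)])
qed

text \<open>Each mixture \<open>X k\<close> splits into the truncation \<open>z k\<close> and a
  remainder \<open>\<rho> k\<close> so small that its image under P has norm at most 1/4. As P fixes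
  \<open>X k\<close>, the function \<open>P (z k)\<close> is \<open>X k\<close> minus
  \<open>P (\<rho> k)\<close>, and on the zone of k this is \<open>(1 - c) * X k\<close> up to a
  small error, with |c| at most 1/2. The diagonal of P thus carries the upper estimate from z over
  to X.\<close>

lemma not_DC: "\<not> DC G"
proof
  assume "DC G"
  then obtain \<sigma> where \<sigma>: "strict_mono \<sigma>" and compl: "complemented G (closed_span G (mix \<circ> \<sigma>))"
    using mix_norm(1) mix_disjoint[of id] unfolding DC_def by (auto simp: strict_mono_id)
  define X where "X = mix \<circ> \<sigma>"
  define Y where "Y = closed_span G X"
  obtain P M0 where P: "\<And>f. f \<in> orlicz_space G \<Longrightarrow> P f \<in> Y"
      "\<And>f. f \<in> orlicz_space G \<Longrightarrow> lux_norm G (P f) \<le> M0 * lux_norm G f"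
    and P_lin: "\<And>f g a b. f \<in> orlicz_space G \<Longrightarrow> g \<in> orlicz_space G \<Longrightarrow>
        lux_norm G (\<lambda>t. P (\<lambda>s. a * f s + b * g s) t - (a * P f t + b * P g t)) = 0"
    and P_id: "\<And>g. g \<in> Y \<Longrightarrow> lux_norm G (\<lambda>t. P g t - g t) = 0"
    using compl unfolding complemented_def X_def[symmetric] Y_def[symmetric] by blast
  have Y: "f \<in> orlicz_space G" if "f \<in> Y" for f using that by (simp add: Y_def closed_span_def)
  have PO: "P f \<in> orlicz_space G" if "f \<in> orlicz_space G" for f using that P(1) Y by blast
  define M where "M = max 1 M0"
  have M: "1 \<le> M" by (simp add: M_def)
  have PM: "lux_norm G (P f) \<le> M * lux_norm G f" if "f \<in> orlicz_space G" for f
    using P(2)[OF that] mult_right_mono[of M0 M "lux_norm G f"] lux_nonneg[OF that] by (auto simp: M_def intro: order_trans)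
  \<comment> \<open>j makes \<open>M / 2 ^ j\<close> less than 1/4; K makes the tail weight
    \<open>1 / 2 ^ (K + 1)\<close> less than \<open>1 / D ^ j\<close>, so that the remainder has
    norm at most \<open>1 / 2 ^ j\<close>.\<close>
  obtain j where j: "4 * M < 2 ^ j" using real_arch_pow[of 2 "4 * M"] by auto
  obtain K where K: "D ^ j < 2 ^ K" using real_arch_pow[of 2 "D ^ j"] by auto
  define z where "z k = steps weight {..min K (\<sigma> k)} (\<sigma> k)" for k
  define \<rho> where "\<rho> k = steps weight {K<..\<sigma> k} (\<sigma> k)" for k
  have w: "0 \<le> weight N n" "weight N n \<le> 1" for N n using weight_bounds[of N n] by auto
  have X_split: "X k = (\<lambda>u. z k u + \<rho> k u)" for k
  proof
    fix u
    have eq: "{..\<sigma> k} = {..min K (\<sigma> k)} \<union> {K<..\<sigma> k}" by auto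
    show "X k u = z k u + \<rho> k u"
      unfolding X_def z_def \<rho>_def comp_def mix_def steps_def
      by (subst eq, rule sum.union_disjoint) auto
  qed
  have XO: "X k \<in> orlicz_space G" "lux_norm G (X k) = 1" for k using mix_norm by (auto simp: X_def)
  have XY: "X k \<in> Y" for k
  proof -
    have "lux_norm G (\<lambda>t. X k t - lin_comb (\<lambda>i. if i = k then 1 else 0) X (Suc k) t) = 0"
      by (simp add: lin_comb_unit)
    then have "\<exists>N a. lux_norm G (\<lambda>t. X k t - lin_comb a X N t) < \<epsilon>" if "0 < \<epsilon>" for \<epsilon>
      using that by (intro exI[of _ "Suc k"] exI[of _ "\<lambda>i. if i = k then 1 else 0"]) simp
    then show ?thesis unfolding Y_def closed_span_def using XO by blast
  qed
  have \<rho>_small: "\<rho> k \<in> orlicz_space G" "lux_norm G (\<rho> k) \<le> 1 / 2 ^ j" for k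
  proof -
    have "modular G (\<rho> k) = ennreal (\<Sum>N\<in>{K<..\<sigma> k}. weight N (\<sigma> k))"
      unfolding \<rho>_def by (intro modular_steps_1 w) auto
    also have "\<dots> \<le> ennreal (1 / 2 ^ (K + 1))" by (intro ennreal_leI weight_tail)
    finally have "ennreal (D ^ j) * modular G (\<rho> k) \<le> ennreal (D ^ j) * ennreal (1 / 2 ^ (K + 1))"
      by (intro mult_left_mono) auto
    also have "\<dots> = ennreal (D ^ j * (1 / 2 ^ (K + 1)))" using D_ge_1 by (intro ennreal_mult[symmetric]) auto
    also have "\<dots> \<le> ennreal 1"
    proof (rule ennreal_leI)
      have "D ^ j \<le> 2 * 2 ^ K" using K zero_le_power[of "2::real" K] by linarith
      then show "D ^ j * (1 / 2 ^ (K + 1)) \<le> 1" by (simp add: divide_le_eq)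
    qed
    finally have "modular G (\<lambda>u. 2 ^ j * \<rho> k u) \<le> 1"
      using modular_double_power[of "\<rho> k" j] steps_mb by (simp add: \<rho>_def)
    then have le: "modular G (\<lambda>u. \<rho> k u / (1 / 2 ^ j)) \<le> 1" by (simp add: mult.commute)
    show "\<rho> k \<in> orlicz_space G" by (rule orlicz_spaceI[OF _ _ le]) (auto simp: \<rho>_def steps_mb)
    show "lux_norm G (\<rho> k) \<le> 1 / 2 ^ j" by (rule lux_le[OF _ le]) simp
  qed
  have z_eq: "z k = (\<lambda>u. 1 * X k u + (- 1) * \<rho> k u)" for k unfolding X_split by auto
  have zO: "z k \<in> orlicz_space G" for k
    unfolding z_eq by (intro orlicz_add orlicz_scale XO \<rho>_small)
  obtain C' where C': "0 \<le> C'" "\<And>a m. lux_norm G (lin_comb a z m) \<le> C' * (\<Sum>i<m. \<bar>a i\<bar> powr r) powr (1 / r)"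
    using steps_upper_estimate[of weight "\<lambda>n. {..min K n}" K \<sigma>] w \<sigma> unfolding z_def by auto
  define S where "S k = zone (\<sigma> k)" for k
  have S: "S k \<in> sets lebesgue" for k unfolding S_def by (rule zone_measurable)
  have S_disj: "S i \<inter> S k = {}" if "i \<noteq> k" for i k
    using that strict_mono_eq[OF \<sigma>] unfolding S_def by (intro zone_disjoint) simp
  have X_zero: "X k u = 0" if "u \<notin> S k" for k u
    using that w unfolding X_def S_def mix_def comp_def by (intro steps_support) auto
  have lin_at: "lin_comb b X N u = (if k < N then b k else 0) * X k u" if "u \<in> S k" for b N k u
  proof -
    have "X i u = 0" if "i \<noteq> k" for i using X_zero S_disj that \<open>u \<in> S k\<close> by blast
    then have "lin_comb b X N u = (\<Sum>i<N. if i = k then b k * X k u else 0)"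
      unfolding lin_comb_def by (intro sum.cong) auto
    then show ?thesis by simp
  qed
  \<comment> \<open>\<open>complemented\<close> grants linearity for two terms and up to norm zero,
    so it is extended by induction; the empty combination is settled by boundedness at the zero
    function.\<close>
  have P_lin_comb: "lux_norm G (\<lambda>u. P (lin_comb b z m) u - lin_comb b (\<lambda>k. P (z k)) m u) = 0" for b m
  proof (induction m)
    case 0
    have "lux_norm G (P (\<lambda>u. 0)) \<le> M * 0" using PM[OF orlicz_zero] by simp
    then have "lux_norm G (P (\<lambda>u. 0)) = 0" using lux_nonneg[OF PO[OF orlicz_zero]] by simp
    then show ?case by (simp add: lin_comb_def)
  next
    case (Suc m)
    let ?f = "lin_comb b z m" and ?g = "lin_comb b (\<lambda>k. P (z k)) m"
    have fO: "?f \<in> orlicz_space G" and gO: "?g \<in> orlicz_space G"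
      using zO PO by (auto intro: orlicz_lin_comb)
    have Sf: "lin_comb b z (Suc m) = (\<lambda>u. 1 * ?f u + b m * z m u)" by (simp add: lin_comb_def fun_eq_iff)
    have Sg: "lin_comb b (\<lambda>k. P (z k)) (Suc m) = (\<lambda>u. ?g u + b m * P (z m) u)" by (simp add: lin_comb_def fun_eq_iff)
    have SO: "(\<lambda>u. 1 * ?f u + b m * z m u) \<in> orlicz_space G" by (intro orlicz_add orlicz_scale fO zO)
    define d1 where "d1 u = P (\<lambda>u. 1 * ?f u + b m * z m u) u - (1 * P ?f u + b m * P (z m) u)" for u
    define d2 where "d2 u = P ?f u - ?g u" for u
    have d1: "d1 \<in> orlicz_space G" "lux_norm G d1 = 0"
      unfolding d1_def using P_lin[OF fO zO[of m], of 1 "b m"] by (auto intro!: orlicz_diff(1) orlicz_add(1) orlicz_scale(1) PO fO zO SO[simplified])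
    have d2: "d2 \<in> orlicz_space G" "lux_norm G d2 = 0"
      unfolding d2_def using Suc by (auto intro!: orlicz_diff(1) PO fO gO)
    have eq: "(\<lambda>u. P (lin_comb b z (Suc m)) u - lin_comb b (\<lambda>k. P (z k)) (Suc m) u) = (\<lambda>u. d1 u + d2 u)"
      unfolding Sf Sg d1_def d2_def by (simp add: fun_eq_iff)
    show ?case unfolding eq
      using orlicz_add[OF d1(1) d2(1)] d1(2) d2(2) lux_nonneg[OF orlicz_add(1)[OF d1(1) d2(1)]] by simp
  qed
  have "lux_norm G (lin_comb a X m) \<le> (2 * (M * C' + 1)) * (\<Sum>i<m. \<bar>a i\<bar> powr r) powr (1 / r)" for a m
  proof -
    define R where "R = (\<Sum>i<m. \<bar>a i\<bar> powr r) powr (1 / r)"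
    have R: "\<bar>a i\<bar> \<le> R" if "i < m" for i
    proof -
      have "\<bar>a i\<bar> = (\<bar>a i\<bar> powr r) powr (1 / r)" using r by (simp add: powr_powr)
      also have "\<dots> \<le> R" unfolding R_def
        using r that by (intro powr_mono2 member_le_sum) auto
      finally show ?thesis .
    qed
    \<comment> \<open>Elements of the closed span are only approximated by combinations of X. The
      tolerance depends on m so that m errors, with coefficients of modulus at most R, add up to at
      most R.\<close>
    define e where "e = 1 / (4 * real (m + 1))"
    have e: "0 < e" "real m * e \<le> 1" "e \<le> 1 / 4" by (auto simp: e_def field_simps)
    define Q where "Q k c err \<longleftrightarrow> \<bar>c\<bar> \<le> 1 / 2 \<and> err \<in> orlicz_space G \<and> lux_norm G err \<le> e \<and>
        (\<forall>u. indicator (S k) u * P (z k) u = (1 - c) * X k u + err u)" for k c err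
    have "\<exists>c err. Q k c err" for k
    proof -
      let ?Pr = "P (\<rho> k)"
      have PrO: "?Pr \<in> orlicz_space G" using PO \<rho>_small by blast
      have "?Pr \<in> Y" using P(1) \<rho>_small by blast
      \<comment> \<open>On \<open>S k\<close> every other \<open>X i\<close> vanishes, so the
        approximation of \<open>P (\<rho> k)\<close> reduces there to a multiple of
        \<open>X k\<close>; c is that coefficient, 0 if the combination stops before k.\<close>
      then obtain N b where b: "lux_norm G (\<lambda>u. ?Pr u - lin_comb b X N u) < e"
        using e(1) unfolding Y_def closed_span_def by blast
      define c where "c = (if k < N then b k else 0)"
      define d where "d u = ?Pr u - lin_comb b X N u" for u
      have dO: "d \<in> orlicz_space G" unfolding d_def by (intro orlicz_diff(1) PrO orlicz_lin_comb XO)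
      define d' where "d' u = indicator (S k) u * d u" for u
      have d': "d' \<in> orlicz_space G" "lux_norm G d' \<le> e"
        using orlicz_indicator[OF dO S[of k]] b unfolding d'_def d_def by auto
      define D1 where "D1 u = P (\<lambda>s. 1 * X k s + (- 1) * \<rho> k s) u - (1 * P (X k) u + (- 1) * ?Pr u)" for u
      define D2 where "D2 u = P (X k) u - X k u" for u
      have D1: "D1 \<in> orlicz_space G" "lux_norm G D1 = 0"
        unfolding D1_def using P_lin[OF XO(1)[of k] \<rho>_small(1)[of k], of 1 "- 1"]
        by (auto intro!: orlicz_diff(1) PO XO(1) PrO orlicz_add(1)
            zO[of k, unfolded z_eq, simplified])
      have D2: "D2 \<in> orlicz_space G" "lux_norm G D2 = 0"
        unfolding D2_def using P_id[OF XY] by (auto intro!: orlicz_diff(1) PO XO)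
      define D3 where "D3 u = indicator (S k) u * (D1 u + D2 u)" for u
      have D3: "D3 \<in> orlicz_space G" "lux_norm G D3 \<le> 0"
        using orlicz_indicator[OF orlicz_add(1)[OF D1(1) D2(1)] S[of k]] orlicz_add(2)[OF D1(1) D2(1)] D1(2) D2(2)
        unfolding D3_def by auto
      have PrS: "indicator (S k) u * ?Pr u = c * X k u + d' u" for u
        using lin_at[of u k b N] X_zero[of u k] by (auto simp: d'_def d_def c_def indicator_def)
      have "\<bar>c\<bar> = lux_norm G (\<lambda>u. c * X k u)" using orlicz_scale(2)[OF XO(1), of c k] XO(2) by simp
      also have "(\<lambda>u. c * X k u) = (\<lambda>u. indicator (S k) u * ?Pr u - d' u)" unfolding PrS by simp
      also have "lux_norm G \<dots> \<le> lux_norm G (\<lambda>u. indicator (S k) u * ?Pr u) + lux_norm G d'"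
        by (intro orlicz_diff(2) orlicz_indicator(1) PrO S d')
      also have "\<dots> \<le> lux_norm G ?Pr + e"
        using orlicz_indicator(2)[OF PrO S[of k]] d'(2) by (intro add_mono)
      also have "lux_norm G ?Pr \<le> M * (1 / 2 ^ j)"
        using PM[OF \<rho>_small(1), of k] \<rho>_small(2)[of k] M by (meson mult_left_mono order_trans zero_le_one)
      also have "M * (1 / 2 ^ j) \<le> 1 / 4" using j by (simp add: field_simps)
      finally have c: "\<bar>c\<bar> \<le> 1 / 2" using e(3) by simp
      have eq: "indicator (S k) u * P (z k) u = (1 - c) * X k u + (D3 u - d' u)" for u
      proof -
        have "P (z k) u = D1 u + D2 u + X k u - ?Pr u"
          unfolding D1_def D2_def z_eq by simp
        then have "indicator (S k) u * P (z k) u = D3 u + indicator (S k) u * X k u - indicator (S k) u * ?Pr u"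
          by (simp add: D3_def distrib_left right_diff_distrib)
        moreover have "indicator (S k) u * X k u = X k u" using X_zero[of u k] by (auto simp: indicator_def)
        ultimately show ?thesis unfolding PrS by (simp add: algebra_simps)
      qed
      have "(\<lambda>u. D3 u - d' u) \<in> orlicz_space G" "lux_norm G (\<lambda>u. D3 u - d' u) \<le> e"
        using orlicz_diff[OF D3(1) d'(1)] D3(2) d'(2) by auto
      then have "Q k c (\<lambda>u. D3 u - d' u)" using c eq unfolding Q_def by simp
      then show ?thesis by blast
    qed
    then obtain c where "\<forall>k. \<exists>err. Q k (c k) err" using choice[of "\<lambda>k c. \<exists>err. Q k c err"] by blast
    then obtain err where Q: "\<forall>k. Q k (c k) (err k)" using choice[of "\<lambda>k err. Q k (c k) err"] by blast
    then have c: "\<bar>c k\<bar> \<le> 1 / 2" and err: "err k \<in> orlicz_space G" "lux_norm G (err k) \<le> e"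
      and PS: "indicator (S k) u * P (z k) u = (1 - c k) * X k u + err k u" for k u
      unfolding Q_def by blast+
    \<comment> \<open>The diagonal principle with the zero function as e. Signs do not change the
      l_r norm of the coefficients, so its hypothesis follows from boundedness of P and the upper
      estimate of z.\<close>
    have "lux_norm G (\<lambda>u. indicator (- (\<Union>i<m. S i)) u * 0 + (\<Sum>i<m. indicator (S i) u * (a i * P (z i) u))) \<le> M * (C' * R)"
    proof (rule lux_diagonal_le)
      show "(\<lambda>u. a i * P (z i) u) \<in> orlicz_space G" for i by (intro orlicz_scale PO zO)
      show "disjoint_family_on S {..<m}" using S_disj by (auto simp: disjoint_family_on_def)
      fix \<theta> :: "nat \<Rightarrow> real" assume \<theta>: "\<forall>i. \<bar>\<theta> i\<bar> = 1"
      let ?b = "\<lambda>i. \<theta> i * a i"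
      have bz: "lin_comb ?b z m \<in> orlicz_space G" by (intro orlicz_lin_comb zO)
      have Pbz: "lin_comb ?b (\<lambda>k. P (z k)) m \<in> orlicz_space G" by (intro orlicz_lin_comb PO zO)
      have eq: "(\<lambda>u. 0 + (\<Sum>i<m. \<theta> i * (a i * P (z i) u)))
          = (\<lambda>u. P (lin_comb ?b z m) u - (P (lin_comb ?b z m) u - lin_comb ?b (\<lambda>k. P (z k)) m u))"
        by (simp add: lin_comb_def fun_eq_iff mult.assoc)
      have "lux_norm G (\<lambda>u. 0 + (\<Sum>i<m. \<theta> i * (a i * P (z i) u))) \<le> lux_norm G (P (lin_comb ?b z m)) + 0"
        unfolding eq using orlicz_diff(2)[OF PO[OF bz] orlicz_diff(1)[OF PO[OF bz] Pbz]] P_lin_comb[of ?b m] by simp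
      also have "\<dots> \<le> M * lux_norm G (lin_comb ?b z m)" unfolding add_0_right by (rule PM[OF bz])
      also have "\<dots> \<le> M * (C' * (\<Sum>i<m. \<bar>?b i\<bar> powr r) powr (1 / r))"
        by (rule mult_left_mono[OF C'(2)]) (use M in simp)
      also have "\<dots> = M * (C' * R)" using \<theta> by (simp add: R_def abs_mult)
      finally show "lux_norm G (\<lambda>u. 0 + (\<Sum>i<m. \<theta> i * (a i * P (z i) u))) \<le> M * (C' * R)" .
    qed (auto intro: S)
    then have diag: "lux_norm G (\<lambda>u. \<Sum>i<m. a i * (indicator (S i) u * P (z i) u)) \<le> M * (C' * R)"
      by (simp add: mult.left_commute)
    define F where "F = lin_comb (\<lambda>i. a i * (1 - c i)) X m"
    define E where "E u = (\<Sum>i<m. a i * err i u)" for u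
    have FO: "F \<in> orlicz_space G" unfolding F_def by (intro orlicz_lin_comb XO)
    have EO: "E \<in> orlicz_space G" "lux_norm G E \<le> R"
    proof -
      have "lux_norm G E \<le> (\<Sum>i<m. lux_norm G (\<lambda>u. a i * err i u))"
        unfolding E_def by (intro orlicz_sum orlicz_scale err) auto
      also have "\<dots> \<le> (\<Sum>i<m. R * e)"
        using R err e by (intro sum_mono) (auto simp: orlicz_scale(2)[OF err(1)] intro!: mult_mono lux_nonneg order_trans[OF abs_ge_zero R])
      also have "\<dots> = R * (real m * e)" by simp
      also have "\<dots> \<le> R * 1" using e by (intro mult_left_mono) (auto simp: R_def)
      finally show "lux_norm G E \<le> R" by simp
      show "E \<in> orlicz_space G" unfolding E_def by (intro orlicz_sum orlicz_scale err) auto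
    qed
    have "(\<lambda>u. \<Sum>i<m. a i * (indicator (S i) u * P (z i) u)) = (\<lambda>u. F u + E u)"
      unfolding PS F_def E_def lin_comb_def by (simp add: sum.distrib[symmetric] algebra_simps)
    then have FE: "lux_norm G (\<lambda>u. F u + E u) \<le> M * (C' * R)" using diag by simp
    have "lux_norm G F \<le> lux_norm G (\<lambda>u. F u + E u) + lux_norm G E"
      using orlicz_diff(2)[OF orlicz_add(1)[OF FO EO(1)] EO(1)] by simp
    also have "\<dots> \<le> M * (C' * R) + R" using FE EO by (intro add_mono)
    finally have F_le: "lux_norm G F \<le> (M * C' + 1) * R" by (simp add: algebra_simps)
    \<comment> \<open>Each u lies in at most one \<open>S k\<close>, where F differs from the
      combination by the factor \<open>1 - c k\<close> of modulus at least 1/2.\<close>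
    have "lux_norm G (lin_comb a X m) \<le> lux_norm G (\<lambda>u. 2 * F u)"
    proof (rule orlicz_dominated(2)[OF orlicz_scale(1)[OF FO]])
      show "mb (lin_comb a X m)" by (intro orlicz_mb orlicz_lin_comb XO)
      fix u :: real
      show "\<bar>lin_comb a X m u\<bar> \<le> \<bar>2 * F u\<bar>"
      proof (cases "\<exists>k. u \<in> S k")
        case True
        then obtain k where k: "u \<in> S k" by blast
        have "1 = 2 * (1 - 1 / 2 :: real)" by simp
        also have "\<dots> \<le> 2 * (1 - c k)" using abs_le_D1[OF c[of k]] by (intro mult_left_mono diff_left_mono) auto
        also have "\<dots> \<le> 2 * \<bar>1 - c k\<bar>" by (intro mult_left_mono abs_ge_self) auto
        finally have "1 \<le> 2 * \<bar>1 - c k\<bar>" .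
        then have "\<bar>a k * X k u\<bar> * 1 \<le> \<bar>a k * X k u\<bar> * (2 * \<bar>1 - c k\<bar>)" by (intro mult_left_mono) auto
        then show ?thesis unfolding F_def lin_at[OF k] by (auto simp: abs_mult mult_ac)
      next
        case False
        then have "X i u = 0" for i using X_zero by blast
        then show ?thesis by (simp add: lin_comb_def F_def)
      qed
    qed
    also have "\<dots> = 2 * lux_norm G F" using orlicz_scale(2)[OF FO, of 2] by simp
    also have "\<dots> \<le> 2 * ((M * C' + 1) * R)" using F_le by simp
    finally show ?thesis unfolding R_def by (simp only: mult.assoc)
  qed
  then show False unfolding X_def by (rule mix_no_upper_estimate[OF \<sigma>])
qed

end

text \<open>The order of quantifiers is what matters: \<tau> and C depend on B only, so for B = 4 ^
  (N + 1) they become sequences in N, while for each n there is a level as high as the layout of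
  cells demands that is good on the n-th window.\<close>

lemma (in orlicz_delta2) not_DH_not_DC:
  assumes "1 \<le> r"
    and bad: "\<And>B. \<exists>\<tau>>0. \<tau> \<le> 1 \<and> (\<exists>C\<ge>0. \<forall>T s0. \<exists>s\<ge>s0. B * \<tau> powr r * G s \<le> G (\<tau> * s) \<and>
     (\<forall>t. 1 / 2 ^ T \<le> t \<and> t \<le> 1 \<longrightarrow> G (t * s) \<le> C * t powr r * G s))"
  shows "\<not> DH G" "\<not> DC G"
proof -
  have "\<forall>N. \<exists>\<tau> C. 0 < \<tau> \<and> \<tau> \<le> 1 \<and> 0 \<le> C \<and> (\<forall>T s0. \<exists>s\<ge>s0. 4 ^ (N + 1) * \<tau> powr r * G s \<le> G (\<tau> * s) \<and>
     (\<forall>t. 1 / 2 ^ T \<le> t \<and> t \<le> 1 \<longrightarrow> G (t * s) \<le> C * t powr r * G s))"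
    using bad by meson
  then obtain \<tau> C where \<tau>C: "\<And>N. 0 < \<tau> N" "\<And>N. \<tau> N \<le> 1" "\<And>N. 0 \<le> C N"
    and ex: "\<And>N T s0. \<exists>s\<ge>s0. 4 ^ (N + 1) * \<tau> N powr r * G s \<le> G (\<tau> N * s) \<and>
     (\<forall>t. 1 / 2 ^ T \<le> t \<and> t \<le> 1 \<longrightarrow> G (t * s) \<le> C N * t powr r * G s)"
    by metis
  have "\<exists>s. 0 < s \<and> 2 ^ (prod_encode (N, n) + 1) \<le> G s \<and> 4 ^ (N + 1) * \<tau> N powr r * G s \<le> G (\<tau> N * s) \<and>
     (\<forall>t. 1 / 2 ^ n \<le> t \<and> t \<le> 1 \<longrightarrow> G (t * s) \<le> C N * t powr r * G s)" for N n
  proof -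
    obtain s0 where s0: "s0 \<ge> 1" "2 ^ (prod_encode (N, n) + 1) \<le> G s0" using G_large by blast
    obtain s where s: "s \<ge> s0" "4 ^ (N + 1) * \<tau> N powr r * G s \<le> G (\<tau> N * s)"
      "\<forall>t. 1 / 2 ^ n \<le> t \<and> t \<le> 1 \<longrightarrow> G (t * s) \<le> C N * t powr r * G s" using ex by blast
    have "2 ^ (prod_encode (N, n) + 1) \<le> G s" using s0 s(1) G_mono[of s0 s] by linarith
    moreover have "0 < s" using s0 s(1) by linarith
    ultimately show ?thesis using s by blast
  qed
  then obtain s where "\<And>N n. 0 < s N n \<and> 2 ^ (prod_encode (N, n) + 1) \<le> G (s N n) \<and>
     4 ^ (N + 1) * \<tau> N powr r * G (s N n) \<le> G (\<tau> N * s N n) \<and>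
     (\<forall>t. 1 / 2 ^ n \<le> t \<and> t \<le> 1 \<longrightarrow> G (t * s N n) \<le> C N * t powr r * G (s N n))"
    by metis
  then interpret nonuniform_levels G D r \<tau> C s
    using \<tau>C assms(1) by unfold_locales auto
  show "\<not> DH G" "\<not> DC G" by (rule not_DH not_DC)+
qed

section \<open>A function with sparse slow ramps\<close>

text \<open>The dyadic block \<open>[2 ^ j, 2 ^ (j + 1))\<close> has a kind \<open>N \<le> j\<close> and begins with a ramp of slope
  \<open>1 / (N + 1)\<close> and length \<open>(N + 1)\<^sup>2\<close>; as \<open>prod_decode\<close> is a bijection, every kind occurs infinitely often.\<close>

definition block :: "nat \<Rightarrow> nat" where
  "block i = (LEAST j. i < 2 ^ Suc j)"

definition kind :: "nat \<Rightarrow> nat" where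
  "kind i = fst (prod_decode (block i))"

text \<open>The guard takes effect at i = 0, where \<open>block 0\<close> is 0 and truncated
  subtraction would place 0 inside a ramp. In early blocks the ramp may be cut off by the end of the
  block.\<close>

definition incr :: "nat \<Rightarrow> real" where
  "incr i = (if 2 ^ block i \<le> i \<and> i - 2 ^ block i < (kind i + 1) ^ 2 then 1 / real (kind i + 1) else 0)"

text \<open>The binary logarithm of the slowly varying factor. For n up to 0 it is 0, so near the
  origin the Orlicz function behaves like a pure power.\<close>

definition height :: "int \<Rightarrow> real" where
  "height n = (\<Sum>i<nat n. incr i)"

lemma block_eq: "2 ^ j \<le> i \<Longrightarrow> i < 2 ^ Suc j \<Longrightarrow> block i = j"
  unfolding block_def
proof (rule Least_equality)
  fix y assume "2 ^ j \<le> i" "i < 2 ^ Suc y"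
  then have "(2::nat) ^ j < 2 ^ Suc y" by linarith
  then have "j < Suc y" by (rule power_less_imp_less_exp[rotated]) simp
  then show "j \<le> y" by simp
qed

lemma block_bounds: "1 \<le> i \<Longrightarrow> 2 ^ block i \<le> i \<and> i < 2 ^ Suc (block i)"
proof -
  assume "1 \<le> i"
  then obtain j where "2 ^ j \<le> i" "i < 2 ^ Suc j" using ex_power_ivl1[of 2 i] by auto
  then show ?thesis using block_eq by simp
qed

lemma incr_bounds: "0 \<le> incr i" "incr i \<le> 1"
  by (auto simp: incr_def divide_le_eq)

lemma height_nonpos: "n \<le> 0 \<Longrightarrow> height n = 0" unfolding height_def by simp

lemma height_Suc: "height n \<le> height (n + 1)" "height (n + 1) \<le> height n + 1"
proof -
  have "height (n + 1) = height n + (if 0 \<le> n then incr (nat n) else 0)"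
    unfolding height_def by (simp add: nat_add_distrib)
  then show "height n \<le> height (n + 1)" "height (n + 1) \<le> height n + 1"
    using incr_bounds[of "nat n"] by auto
qed

lemma height_mono: "m \<le> n \<Longrightarrow> height m \<le> height n"
  unfolding height_def by (intro sum_mono2) (auto simp: incr_bounds)

lemma height_diff: "T \<le> n \<Longrightarrow> height (int n) - height (int n - int T) = (\<Sum>i\<in>{n - T..<n}. incr i)"
proof -
  assume "T \<le> n"
  then have "nat (int n - int T) = n - T" by linarith
  moreover have "(\<Sum>i<n. incr i) = (\<Sum>i<n - T. incr i) + (\<Sum>i\<in>{n - T..<n}. incr i)"
    by (simp add: sum.atLeastLessThan_concat lessThan_atLeast0)
  ultimately show ?thesis by (simp add: height_def)
qed

text \<open>A ramp in block j has length at most (j + 1)^2, as its kind is at most j; so for large j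
  the block still ends with a flat stretch of length T. The offset 6 starts the induction at 7^2 <=
  2^6.\<close>

lemma quadratic_less_power: "\<exists>j0. \<forall>j\<ge>j0. (j + 1) ^ 2 + T \<le> (2::nat) ^ j"
proof -
  have "(j + 1) ^ 2 + T \<le> (2::nat) ^ j" if "j \<ge> T + 6" for j
    using that
  proof (induction j rule: dec_induct)
    case base
    show ?case
    proof (induction T)
      case (Suc T)
      have "(Suc T + 6 + 1)\<^sup>2 + Suc T \<le> 2 * ((T + 6 + 1)\<^sup>2 + T)" by (simp add: power2_eq_square algebra_simps)
      also have "\<dots> \<le> 2 * 2 ^ (T + 6)" using Suc by simp
      finally show ?case by (simp add: power_add)
    qed simp
  next
    case (step j)
    have "2 * 1 \<le> j * j" using step by (intro mult_mono) auto
    then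
    have "(Suc j + 1)\<^sup>2 + T \<le> 2 * ((j + 1)\<^sup>2 + T)" using step by (simp add: power2_eq_square algebra_simps)
    then show ?case using step by simp
  qed
  then show ?thesis by blast
qed

lemma kind_le_block: "kind i \<le> block i"
  unfolding kind_def using le_prod_encode_1[of "fst (prod_decode (block i))" "snd (prod_decode (block i))"]
  by simp

text \<open>The part of the window that reaches back beyond the start of the block of n lies in the
  flat end of the preceding block, so only one ramp can be met.\<close>

lemma no_incr_before_block:
  "\<exists>n0. \<forall>n\<ge>n0. T \<le> n \<and> (\<forall>i\<in>{n - T..<n}. i < 2 ^ block n \<longrightarrow> incr i = 0)"
proof -
  obtain j0 where j0: "\<And>j. j \<ge> j0 \<Longrightarrow> (j + 1) ^ 2 + T \<le> (2::nat) ^ j" using quadratic_less_power by blast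
  have "T \<le> n \<and> (\<forall>i\<in>{n - T..<n}. i < 2 ^ block n \<longrightarrow> incr i = 0)" if n: "n \<ge> 2 ^ Suc j0" for n
  proof -
    have n1: "1 \<le> n" using n by (meson one_le_numeral one_le_power order_trans)
    have b: "2 ^ block n \<le> n" "n < 2 ^ Suc (block n)" using block_bounds[OF n1] by auto
    then have "(2::nat) ^ Suc j0 < 2 ^ Suc (block n)" using n by linarith
    then have "Suc j0 < Suc (block n)" by (rule power_less_imp_less_exp[rotated]) simp
    then obtain j where j: "block n = Suc j" "j0 \<le> j" by (cases "block n") auto
    have jT: "(j + 1)\<^sup>2 + T \<le> 2 ^ j" using j0[OF j(2)] .
    have nj: "2 ^ j + 2 ^ j \<le> n" using b(1) j(1) by simp
    have "incr i = 0" if i: "n - T \<le> i" "i < 2 ^ block n" for i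
    proof -
      have i2: "2 ^ j + (j + 1)\<^sup>2 \<le> i" using i jT nj by linarith
      have bi: "block i = j" using i i2 j by (intro block_eq) auto
      then have "(kind i + 1)\<^sup>2 \<le> (j + 1)\<^sup>2" using kind_le_block[of i] by (intro power_mono) auto
      then have "(kind i + 1)\<^sup>2 \<le> i - 2 ^ block i" using i2 unfolding bi by linarith
      then show ?thesis by (simp add: incr_def)
    qed
    moreover have "T \<le> n" using nj jT by linarith
    ultimately show ?thesis by auto
  qed
  then show ?thesis by blast
qed

lemma block_same_kind:
  assumes "1 \<le> n" "2 ^ block n \<le> i" "i < n"
  shows "block i = block n" "kind i = kind n"
proof -
  show "block i = block n" using assms block_bounds[OF assms(1)] by (intro block_eq) auto
  then show "kind i = kind n" by (simp add: kind_def)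
qed

lemma height_diff_in_block:
  "\<exists>n0. \<forall>n\<ge>n0. T \<le> n \<and>
     height (int n) - height (int n - int T) = (\<Sum>i | i \<in> {n - T..<n} \<and> 2 ^ block n \<le> i. incr i)"
proof -
  obtain n0 where n0: "\<And>n. n \<ge> n0 \<Longrightarrow> T \<le> n \<and> (\<forall>i\<in>{n - T..<n}. i < 2 ^ block n \<longrightarrow> incr i = 0)"
    using no_incr_before_block by blast
  have "T \<le> n \<and> height (int n) - height (int n - int T) = (\<Sum>i | i \<in> {n - T..<n} \<and> 2 ^ block n \<le> i. incr i)"
    if "n \<ge> n0" for n
  proof -
    have "(\<Sum>i\<in>{n - T..<n}. incr i) = (\<Sum>i | i \<in> {n - T..<n} \<and> 2 ^ block n \<le> i. incr i)"
      using n0[OF that] by (intro sum.mono_neutral_right) auto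
    then show ?thesis using height_diff n0[OF that] by metis
  qed
  then show ?thesis by blast
qed

text \<open>However long the window, it collects at most one whole ramp:
  \<open>(kind n + 1)\<^sup>2\<close> steps of \<open>1 / (kind n + 1)\<close>.\<close>

lemma height_diff_small_kind:
  "\<exists>n0. \<forall>n\<ge>n0. kind n \<le> N \<longrightarrow> height (int n) - height (int n - int T) \<le> real N + 1"
proof -
  obtain n0 where n0: "\<And>n. n \<ge> n0 \<Longrightarrow> height (int n) - height (int n - int T)
      = (\<Sum>i | i \<in> {n - T..<n} \<and> 2 ^ block n \<le> i. incr i)"
    using height_diff_in_block by blast
  have "height (int n) - height (int n - int T) \<le> real N + 1" if n: "n \<ge> max 1 n0" "kind n \<le> N" for n
  proof -
    let ?M = "(kind n + 1)\<^sup>2"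
    have "(\<Sum>i | i \<in> {n - T..<n} \<and> 2 ^ block n \<le> i. incr i)
        \<le> (\<Sum>i | i \<in> {n - T..<n} \<and> 2 ^ block n \<le> i. if i \<in> {2 ^ block n..<2 ^ block n + ?M} then 1 / real (kind n + 1) else 0)"
    proof (rule sum_mono)
      fix i assume i: "i \<in> {i. i \<in> {n - T..<n} \<and> 2 ^ block n \<le> i}"
      then have "block i = block n" "kind i = kind n" using block_same_kind[of n i] n by auto
      then show "incr i \<le> (if i \<in> {2 ^ block n..<2 ^ block n + ?M} then 1 / real (kind n + 1) else 0)"
        using i by (auto simp: incr_def)
    qed
    also have "\<dots> \<le> (\<Sum>i\<in>{2 ^ block n..<2 ^ block n + ?M}. 1 / real (kind n + 1))"
    proof -
      have "(\<Sum>i | i \<in> {n - T..<n} \<and> 2 ^ block n \<le> i. if i \<in> {2 ^ block n..<2 ^ block n + ?M} then 1 / real (kind n + 1) else 0)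
        = (\<Sum>i\<in>{i. i \<in> {n - T..<n} \<and> 2 ^ block n \<le> i} \<inter> {2 ^ block n..<2 ^ block n + ?M}. 1 / real (kind n + 1))"
        by (subst sum.inter_restrict) auto
      also have "\<dots> \<le> (\<Sum>i\<in>{2 ^ block n..<2 ^ block n + ?M}. 1 / real (kind n + 1))"
        by (rule sum_mono2) auto
      finally show ?thesis .
    qed
    also have "\<dots> = real ((kind n + 1) * (kind n + 1)) * (1 / real (kind n + 1))"
      unfolding sum_constant power2_eq_square by simp
    also have "\<dots> = real (kind n + 1)" unfolding of_nat_mult by simp
    also have "\<dots> \<le> real N + 1" using n by simp
    finally show ?thesis using n0[of n] n by simp
  qed
  then show ?thesis by blast
qed

text \<open>The ramp is now longer than the window but so flat that T of its steps rise by less than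
  1.\<close>

lemma height_diff_large_kind:
  "\<exists>n0. \<forall>n\<ge>n0. T < kind n \<longrightarrow> height (int n) - height (int n - int T) \<le> 1"
proof -
  obtain n0 where n0: "\<And>n. n \<ge> n0 \<Longrightarrow> height (int n) - height (int n - int T)
      = (\<Sum>i | i \<in> {n - T..<n} \<and> 2 ^ block n \<le> i. incr i)"
    using height_diff_in_block by blast
  have "height (int n) - height (int n - int T) \<le> 1" if n: "n \<ge> max 1 n0" "T < kind n" for n
  proof -
    have "(\<Sum>i | i \<in> {n - T..<n} \<and> 2 ^ block n \<le> i. incr i)
        \<le> (\<Sum>i | i \<in> {n - T..<n} \<and> 2 ^ block n \<le> i. 1 / real (kind n + 1))"
    proof (rule sum_mono)
      fix i assume i: "i \<in> {i. i \<in> {n - T..<n} \<and> 2 ^ block n \<le> i}"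
      then have "block i = block n" "kind i = kind n" using block_same_kind[of n i] n by auto
      then show "incr i \<le> 1 / real (kind n + 1)" by (auto simp: incr_def)
    qed
    also have "\<dots> \<le> (\<Sum>i\<in>{n - T..<n}. 1 / real (kind n + 1))" by (rule sum_mono2) auto
    also have "\<dots> = real (n - (n - T)) / real (kind n + 1)" by simp
    also have "\<dots> \<le> 1" using n by (simp add: divide_le_eq)
    finally show ?thesis using n0[of n] n by simp
  qed
  then show ?thesis by blast
qed

lemma height_diff_unbounded:
  "\<exists>n\<ge>n0. kind n = N \<and> height (int n) - height (int n - int ((N + 1)\<^sup>2)) = real N + 1"
proof -
  let ?T = "(N + 1)\<^sup>2"
  obtain j0 where j0: "\<And>j. j \<ge> j0 \<Longrightarrow> (j + 1) ^ 2 + 1 \<le> (2::nat) ^ j" using quadratic_less_power by blast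
  \<comment> \<open>Pairing N with a large second component places a block of kind N beyond both
    thresholds; the n defined next is the end of its ramp.\<close>
  define j where "j = prod_encode (N, max n0 j0)"
  have j: "max n0 j0 \<le> j" "N \<le> j" by (auto simp: j_def le_prod_encode_1 le_prod_encode_2)
  define n where "n = 2 ^ j + ?T"
  have "?T \<le> (j + 1)\<^sup>2" using j by (intro power_mono) auto
  then have T: "?T + 1 \<le> 2 ^ j" using j0[of j] j by linarith
  have blk: "block i = j" "kind i = N" if "2 ^ j \<le> i" "i \<le> n" for i
  proof -
    show "block i = j" using that T by (intro block_eq) (auto simp: n_def)
    then show "kind i = N" by (simp add: kind_def j_def)
  qed
  have "height (int n) - height (int n - int ?T) = (\<Sum>i\<in>{n - ?T..<n}. incr i)"
    by (rule height_diff) (simp add: n_def)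
  also have "\<dots> = (\<Sum>i\<in>{2 ^ j..<2 ^ j + ?T}. 1 / real (N + 1))"
    using blk by (intro sum.cong) (auto simp: n_def incr_def)
  also have "\<dots> = real ((N + 1) * (N + 1)) * (1 / real (N + 1))"
    unfolding sum_constant power2_eq_square by simp
  also have "\<dots> = real N + 1" unfolding of_nat_mult by simp
  finally have "height (int n) - height (int n - int ?T) = real N + 1" .
  moreover have "n0 \<le> n" using j less_exp[of j] unfolding n_def by linarith
  ultimately show ?thesis using blk(2)[of n] by (auto simp: n_def)
qed

section \<open>The Orlicz function and its conjugate\<close>

locale conjugate_exponents =
  fixes p q :: real
  assumes p_gt_1: "1 < p" and conj: "1 / p + 1 / q = 1"
begin

lemma q_gt_1: "1 < q"
proof -
  have "1 / q = 1 - 1 / p" using conj by simp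
  moreover have "0 < 1 - 1 / p" "1 - 1 / p < 1" using p_gt_1 by auto
  ultimately have q: "0 < 1 / q" "1 / q < 1" by auto
  then have "0 < q" by (metis zero_less_divide_1_iff)
  then show ?thesis using q by simp
qed

lemma pq: "(p - 1) * (q - 1) = 1" "p * (q - 1) = q"
proof -
  have "p * q * (1 / p + 1 / q) = p * q" using conj by simp
  then have "q + p = p * q" using p_gt_1 q_gt_1 by (simp add: distrib_left)
  then show "(p - 1) * (q - 1) = 1" "p * (q - 1) = q" by (simp_all add: algebra_simps)
qed

text \<open>Up to a constant, the derivative intended at 2 ^ n. As \<open>height\<close> is
  nondecreasing, each step multiplies it by at least \<open>2 powr (p - 1)\<close>.\<close>

definition slope :: "int \<Rightarrow> real" where
  "slope n = 2 powr ((p - 1) * of_int n + height n)"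

text \<open>A supremum of kinked lines instead of an integral of \<open>slope\<close>: up to constants \<open>Phi t\<close> is
  \<open>t powr p * 2 powr height (log 2 t)\<close>, and its conjugate at \<open>slope n\<close> is \<open>2 ^ n * slope n\<close>.\<close>

definition Phi :: "real \<Rightarrow> real" where
  "Phi t = (SUP n. slope n * max 0 (t - 2 powr of_int n))"

definition lev :: "real \<Rightarrow> int" where
  "lev t = \<lfloor>log 2 t\<rfloor>"

text \<open>An explicit but discontinuous model of Phi, within a factor \<open>4 powr p\<close> of
  it; growth estimates are proved for the model and transferred.\<close>

definition env :: "real \<Rightarrow> real" where
  "env t = t powr p * 2 powr height (lev t)"

lemma slope_pos [simp]: "0 < slope n" by (simp add: slope_def)

lemma slope_mono: "m \<le> n \<Longrightarrow> slope m \<le> slope n"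
  unfolding slope_def using p_gt_1 height_mono[of m n]
  by (intro powr_mono add_mono mult_left_mono) auto

lemma slope_Suc: "slope (n + 1) \<le> 2 powr p * slope n"
proof -
  have "(p - 1) * of_int (n + 1) + height (n + 1) \<le> p + ((p - 1) * of_int n + height n)"
    using height_Suc(2)[of n] by (simp add: algebra_simps)
  then show ?thesis unfolding slope_def powr_add[symmetric] by (intro powr_mono) auto
qed

lemma slope_add_ge:
  assumes "x \<le> (p - 1) * real j"
  shows "2 powr x * slope n \<le> slope (n + int j)"
proof -
  have "x + ((p - 1) * of_int n + height n) \<le> (p - 1) * of_int (n + int j) + height (n + int j)"
    using height_mono[of n "n + int j"] assms by (simp add: algebra_simps)
  then show ?thesis unfolding slope_def powr_add[symmetric] by (intro powr_mono) auto
qed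

lemma slope_less: "slope n < slope (n + 1)"
proof -
  have "1 * slope n < 2 powr (p - 1) * slope n" using p_gt_1 by (intro mult_strict_right_mono) auto
  also have "\<dots> \<le> slope (n + int 1)" by (rule slope_add_ge) simp
  finally show ?thesis by simp
qed

lemma lev_bounds:
  assumes "0 < t"
  shows "2 powr of_int (lev t) \<le> t" "t < 2 powr (of_int (lev t) + 1)"
proof -
  have "of_int (lev t) \<le> log 2 t" "log 2 t < of_int (lev t) + 1" by (auto simp: lev_def)
  then show "2 powr of_int (lev t) \<le> t" "t < 2 powr (of_int (lev t) + 1)"
    using assms by (auto simp: le_log_iff log_less_iff)
qed

lemma lev_mono: "0 < s \<Longrightarrow> s \<le> t \<Longrightarrow> lev s \<le> lev t"
  unfolding lev_def by (intro floor_mono) auto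

lemma lev_ge: "2 powr of_int n \<le> t \<Longrightarrow> n \<le> lev t"
proof -
  assume a: "2 powr of_int n \<le> t"
  then have "0 < t" by (metis less_le_trans powr_gt_zero zero_neq_numeral)
  then have "of_int n \<le> log 2 t" using a by (simp add: le_log_iff)
  then show ?thesis unfolding lev_def by (simp add: le_floor_iff)
qed

lemma lev_power: "lev (2 powr of_int n) = n"
  by (simp add: lev_def)

lemma env_power: "env (2 powr of_int n) = 2 powr of_int n * slope n"
  unfolding env_def lev_power slope_def powr_powr powr_add[symmetric] by (simp add: algebra_simps)

section \<open>Growth of Phi\<close>

lemma term_le_env:
  assumes "0 < t"
  shows "slope n * max 0 (t - 2 powr of_int n) \<le> env t"
proof (cases "2 powr of_int n < t")
  case False
  then show ?thesis by (simp add: env_def)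
next
  case True
  have n: "n \<le> lev t" using True by (intro lev_ge) auto
  have "slope n \<le> t powr (p - 1) * 2 powr height (lev t)"
  proof -
    have "slope n = (2 powr of_int n) powr (p - 1) * 2 powr height n"
      by (simp add: slope_def powr_add powr_powr mult.commute)
    also have "\<dots> \<le> t powr (p - 1) * 2 powr height (lev t)"
      using True p_gt_1 height_mono[OF n] by (intro mult_mono powr_mono2 powr_mono) auto
    finally show ?thesis .
  qed
  then have "slope n * max 0 (t - 2 powr of_int n) \<le> (t powr (p - 1) * 2 powr height (lev t)) * t"
    using assms True by (intro mult_mono) auto
  also have "\<dots> = env t" using assms powr_add[of t "p - 1" 1] by (simp add: env_def)
  finally show ?thesis .
qed

lemma term_bdd: "bdd_above (range (\<lambda>n. slope n * max 0 (t - 2 powr of_int n)))"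
proof (cases "0 < t")
  case True
  then show ?thesis using term_le_env by (intro bdd_aboveI[of _ "env t"]) auto
next
  case False
  have "t - 2 powr of_int n \<le> 0" for n using False powr_ge_zero[of 2 "of_int n"] by linarith
  then show ?thesis by (intro bdd_aboveI[of _ 0]) (auto simp: max_absorb1)
qed

lemma Phi_ge_term: "slope n * (t - 2 powr of_int n) \<le> Phi t"
proof -
  have "slope n * (t - 2 powr of_int n) \<le> slope n * max 0 (t - 2 powr of_int n)"
    by (intro mult_left_mono) (auto simp: less_imp_le)
  also have "\<dots> \<le> Phi t" unfolding Phi_def by (rule cSUP_upper[OF _ term_bdd]) auto
  finally show ?thesis .
qed

lemma Phi_le_env: "0 < t \<Longrightarrow> Phi t \<le> env t"
  unfolding Phi_def by (intro cSUP_least term_le_env) auto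

lemma Phi_ge_env:
  assumes "0 < t"
  shows "env t \<le> 4 powr p * Phi t"
proof -
  \<comment> \<open>One level below t puts the kink between t / 4 and t / 2. The losses are
    \<open>4 powr (p - 1)\<close> and 2 in the slope, and 2 in the difference:
    \<open>4 powr p\<close> in all.\<close>
  let ?n = "lev t - 1"
  have t: "2 powr of_int ?n \<le> t / 2" "t / 4 \<le> 2 powr of_int ?n"
    using lev_bounds[OF assms] by (simp_all add: powr_diff powr_add)
  have "(t / 4) powr (p - 1) * 2 powr (height (lev t) - 1) \<le> slope ?n"
  proof -
    have "(t / 4) powr (p - 1) * 2 powr (height (lev t) - 1) \<le> (2 powr of_int ?n) powr (p - 1) * 2 powr height ?n"
      using t assms p_gt_1 height_Suc(2)[of ?n] by (intro mult_mono powr_mono2 powr_mono) auto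
    also have "\<dots> = slope ?n" by (simp add: slope_def powr_add powr_powr mult.commute)
    finally show ?thesis .
  qed
  then have "(t / 4) powr (p - 1) * 2 powr (height (lev t) - 1) * (t / 2) \<le> slope ?n * (t - 2 powr of_int ?n)"
    using t assms by (intro mult_mono) (auto simp: less_imp_le)
  also have "\<dots> \<le> Phi t" by (rule Phi_ge_term)
  finally have "(t / 4) powr (p - 1) * 2 powr (height (lev t) - 1) * (t / 2) \<le> Phi t" .
  moreover have "(t / 4) powr (p - 1) * 2 powr (height (lev t) - 1) * (t / 2) = env t / 4 powr p"
  proof -
    have "(t / 4) powr (p - 1) * (t / 4) = (t / 4) powr p"
      using powr_add[of "t / 4" "p - 1" 1] assms by simp
    then have 1: "(t / 4) powr (p - 1) * (t / 4) * 2 powr height (lev t) = env t / 4 powr p"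
      using assms by (simp add: env_def powr_divide)
    have 2: "2 powr height (lev t) = 2 * 2 powr (height (lev t) - 1)" by (simp add: powr_diff)
    show ?thesis unfolding 1[symmetric] unfolding 2 by simp
  qed
  ultimately have "env t / 4 powr p \<le> Phi t" by linarith
  then show ?thesis by (simp add: field_simps)
qed

lemma Phi_orlicz: "orlicz_function Phi"
  unfolding orlicz_function_def
proof (intro conjI)
  show "mono_on {0..} Phi"
  proof (rule mono_onI)
    fix s t :: real assume "s \<le> t"
    then show "Phi s \<le> Phi t" unfolding Phi_def
      by (intro cSUP_mono term_bdd) (auto intro!: mult_left_mono exI simp: less_imp_le)
  qed
  show "convex_on {0..} Phi"
  proof (rule convex_onI)
    fix u x y :: real assume u: "0 < u" "u < 1"
    have "slope n * max 0 ((1 - u) * x + u * y - 2 powr of_int n) \<le> (1 - u) * Phi x + u * Phi y" for n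
    proof -
      let ?b = "2 powr of_int n :: real"
      have "(1 - u) * x + u * y - ?b = (1 - u) * (x - ?b) + u * (y - ?b)" by (simp add: algebra_simps)
      also have "\<dots> \<le> (1 - u) * max 0 (x - ?b) + u * max 0 (y - ?b)"
        using u by (intro add_mono mult_left_mono) auto
      finally have "max 0 ((1 - u) * x + u * y - ?b) \<le> (1 - u) * max 0 (x - ?b) + u * max 0 (y - ?b)"
        using u by (simp add: add_nonneg_nonneg)
      then have "slope n * max 0 ((1 - u) * x + u * y - ?b)
          \<le> slope n * ((1 - u) * max 0 (x - ?b) + u * max 0 (y - ?b))"
        by (intro mult_left_mono) (auto simp: less_imp_le)
      also have "\<dots> = (1 - u) * (slope n * max 0 (x - ?b)) + u * (slope n * max 0 (y - ?b))"
        by (simp add: algebra_simps)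
      also have "\<dots> \<le> (1 - u) * Phi x + u * Phi y"
        unfolding Phi_def using u by (intro add_mono mult_left_mono cSUP_upper term_bdd) auto
      finally show ?thesis .
    qed
    then show "Phi ((1 - u) *\<^sub>R x + u *\<^sub>R y) \<le> (1 - u) * Phi x + u * Phi y"
      unfolding Phi_def[of "(1 - u) *\<^sub>R x + u *\<^sub>R y"] by (intro cSUP_least) auto
  qed (simp add: convex_real_interval)
  have "max 0 (0 - 2 powr of_int n) = (0::real)" for n by (simp add: max_def)
  then show "Phi 0 = 0" unfolding Phi_def by simp
  show "filterlim Phi at_top at_top"
  proof (rule filterlim_at_top_mono)
    show "filterlim (\<lambda>t::real. t - 1) at_top at_top"
      using filterlim_tendsto_add_at_top[OF tendsto_const[of "-1"] filterlim_ident] by simp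
    show "\<forall>\<^sub>F t in at_top. t - 1 \<le> Phi t"
      using Phi_ge_term[of 0] by (intro always_eventually) (auto simp: slope_def height_nonpos)
  qed
qed

lemma Phi_nonneg: "0 \<le> t \<Longrightarrow> 0 \<le> Phi t"
  using Phi_orlicz unfolding orlicz_function_def mono_on_def by force

lemma Phi_double:
  assumes "0 \<le> t"
  shows "Phi (2 * t) \<le> (2 powr (p + 1) * 4 powr p) * Phi t"
proof (cases "t = 0")
  case True
  then show ?thesis using Phi_orlicz by (simp add: orlicz_function_def)
next
  case False
  then have t: "0 < t" using assms by simp
  have "lev (2 * t) = lev t + 1" using t by (simp add: lev_def log_mult)
  then have "env (2 * t) \<le> (2 powr p * t powr p) * 2 powr (1 + height (lev t))"
    unfolding env_def using t height_Suc(2)[of "lev t"] by (intro mult_mono powr_mono) (auto simp: powr_mult)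
  also have "\<dots> = 2 powr (p + 1) * env t" by (simp add: env_def powr_add)
  also have "\<dots> \<le> 2 powr (p + 1) * (4 powr p * Phi t)" using Phi_ge_env[OF t] by (intro mult_left_mono) auto
  finally show ?thesis using Phi_le_env[of "2 * t"] t by simp
qed

lemma Phi_upper:
  assumes "0 \<le> t" "t \<le> 1" "0 \<le> s"
  shows "Phi (t * s) \<le> 4 powr p * t powr p * Phi s"
proof (cases "t * s = 0")
  case True
  then show ?thesis using Phi_orlicz Phi_nonneg[OF assms(3)] by (auto simp: orlicz_function_def)
next
  case False
  then have ts: "0 < t" "0 < s" using assms by auto
  have "t * s \<le> s" using ts assms by (simp add: mult_le_cancel_right1)
  then have "lev (t * s) \<le> lev s" using ts by (intro lev_mono) auto
  then have "env (t * s) \<le> (t powr p * s powr p) * 2 powr height (lev s)"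
    unfolding env_def using ts by (intro mult_mono powr_mono height_mono) (auto simp: powr_mult)
  also have "\<dots> = t powr p * env s" by (simp add: env_def)
  also have "\<dots> \<le> t powr p * (4 powr p * Phi s)" using Phi_ge_env ts by (intro mult_left_mono) auto
  finally show ?thesis using Phi_le_env[of "t * s"] ts by (simp add: mult_ac)
qed

text \<open>A factor t of at least 1 / 2 ^ T lowers the level by at most T, so the loss against
  \<open>t powr p\<close> is governed by the drop of \<open>height\<close> over a window of length
  T.\<close>

lemma Phi_lower:
  assumes "1 / 2 ^ T \<le> t" "t \<le> 1" "0 < s" "height (lev s) - height (lev s - int T) \<le> C"
  shows "1 / (4 powr p * 2 powr C) * t powr p * Phi s \<le> Phi (t * s)"
proof -
  have t: "0 < t" using assms(1) by (meson less_le_trans zero_less_divide_1_iff zero_less_numeral zero_less_power)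
  have "2 powr of_int (lev s - int T) \<le> t * s"
  proof -
    have "2 powr of_int (lev s - int T) = 1 / 2 ^ T * (2 powr of_int (lev s) :: real)" by (simp add: powr_diff powr_realpow)
    also have "\<dots> \<le> t * s" using assms lev_bounds[of s] t by (intro mult_mono) auto
    finally show ?thesis .
  qed
  then have "lev s - int T \<le> lev (t * s)" by (rule lev_ge)
  then have "height (lev s) - C \<le> height (lev (t * s))" using assms(4) height_mono by force
  then have h: "2 powr height (lev s) / 2 powr C \<le> 2 powr height (lev (t * s))"
    unfolding powr_diff[symmetric] by (intro powr_mono) auto
  have "t powr p * env s / 2 powr C = (t * s) powr p * (2 powr height (lev s) / 2 powr C)"
    using t assms(3) by (simp add: env_def powr_mult)
  also have "\<dots> \<le> env (t * s)" unfolding env_def by (intro mult_left_mono h) auto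
  finally have "t powr p * env s / 2 powr C \<le> 4 powr p * Phi (t * s)"
    using Phi_ge_env[of "t * s"] t assms(3) by simp
  moreover have "t powr p * Phi s / 2 powr C \<le> t powr p * env s / 2 powr C"
    using Phi_le_env[OF assms(3)] by (intro divide_right_mono mult_left_mono) auto
  ultimately show ?thesis by (simp add: field_simps)
qed

section \<open>The Young conjugate and its index function\<close>

definition Psi :: "real \<Rightarrow> real" where "Psi = young_conjugate Phi"

text \<open>A single line of slope a and kink b below Phi bounds the conjugate by a b at every
  argument up to a.\<close>

lemma young_term_le:
  assumes "u \<le> slope n" "0 < t"
  shows "u * t - Phi t \<le> 2 powr of_int n * slope n"
proof -
  have "u * t - Phi t \<le> slope n * t - Phi t" using assms by (simp add: mult_right_mono)
  also have "\<dots> \<le> slope n * t - slope n * (t - 2 powr of_int n)" using Phi_ge_term[of n t] by simp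
  finally show ?thesis by (simp add: algebra_simps)
qed

text \<open>A number of levels over which the slope is certain to double.\<close>

definition J :: nat where "J = nat \<lceil>1 / (p - 1)\<rceil>"

lemma J: "1 \<le> (p - 1) * real J"
proof -
  have "1 / (p - 1) \<le> real J" unfolding J_def by linarith
  then show ?thesis using p_gt_1 by (simp add: field_simps)
qed

text \<open>The slopes run from 0 to infinity because they at least double every J levels. The
  search starts at a level a with slope at most v and stops at the first level whose slope exceeds
  v.\<close>

lemma slope_index:
  assumes "0 < v"
  shows "\<exists>n. slope n \<le> v \<and> v < slope (n + 1)"
proof -
  obtain k :: nat where k: "v < 2 ^ k" using real_arch_pow[of 2 v] by auto
  obtain j :: nat where j: "1 / v < 2 ^ j" using real_arch_pow[of 2 "1 / v"] by auto
  have mJ: "real m \<le> (p - 1) * real (m * J)" for m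
    using mult_left_mono[OF J, of "real m"] by (simp add: mult_ac)
  have s0: "slope 0 = 1" by (simp add: slope_def height_nonpos)
  define a where "a = - int (j * J)"
  have "2 powr real j * slope a \<le> slope 0" using slope_add_ge[OF mJ[of j], of a] by (simp add: a_def)
  then have "2 ^ j * slope a \<le> 1" by (simp add: s0 powr_realpow)
  then have a: "slope a \<le> v" using j assms
    by (smt (verit) slope_pos field_simps mult_le_cancel_left_pos mult_strict_right_mono)
  have "2 powr real k * slope 0 \<le> slope (int (k * J))" using slope_add_ge[OF mJ[of k], of 0] by simp
  then have "v < slope (a + int (k * J + j * J))" using k s0 by (simp add: a_def powr_realpow)
  then have ex: "\<exists>i. v < slope (a + int i)" by blast
  define i where "i = (LEAST i. v < slope (a + int i))"
  have i: "v < slope (a + int i)" unfolding i_def using ex by (rule LeastI_ex)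
  have "i \<noteq> 0" using i a by (intro notI) simp
  then obtain i' where i': "i = Suc i'" by (cases i) auto
  have "\<not> v < slope (a + int i')" using not_less_Least[of i' "\<lambda>i. v < slope (a + int i)"] i' by (simp add: i_def)
  then show ?thesis using i i' by (intro exI[of _ "a + int i'"]) (auto simp: algebra_simps)
qed

lemma young_bdd: "bdd_above {u * t - Phi t | t. 0 < t}"
proof -
  \<comment> \<open>The claim is for every real u; \<open>max 1 u\<close> supplies the positive
    argument that \<open>slope_index\<close> requires.\<close>
  have "\<exists>n. slope n \<le> max 1 u \<and> max 1 u < slope (n + 1)" by (rule slope_index) simp
  then obtain n where "max 1 u < slope (n + 1)" by blast
  then have "\<And>t. 0 < t \<Longrightarrow> u * t - Phi t \<le> 2 powr of_int (n + 1) * slope (n + 1)"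
    by (intro young_term_le) auto
  then show ?thesis by (intro bdd_aboveI) auto
qed

lemma Psi_ge: "0 < t \<Longrightarrow> u * t - Phi t \<le> Psi u"
  unfolding Psi_def young_conjugate_def by (rule cSup_upper[OF _ young_bdd]) auto

lemma Psi_least: "(\<And>t. 0 < t \<Longrightarrow> u * t - Phi t \<le> b) \<Longrightarrow> Psi u \<le> b"
  unfolding Psi_def young_conjugate_def by (rule cSup_least) (auto intro: exI[of _ 1])

lemma Psi_orlicz: "orlicz_function Psi"
  unfolding orlicz_function_def
proof (intro conjI)
  show "mono_on {0..} Psi"
  proof (rule mono_onI)
    fix s t :: real assume st: "s \<le> t"
    show "Psi s \<le> Psi t"
    proof (rule Psi_least)
      fix x :: real assume "0 < x"
      then show "s * x - Phi x \<le> Psi t" using Psi_ge[of x t] mult_right_mono[OF st, of x] by linarith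
    qed
  qed
  show "convex_on {0..} Psi"
  proof (rule convex_onI)
    fix u x y :: real assume u: "0 < u" "u < 1"
    show "Psi ((1 - u) *\<^sub>R x + u *\<^sub>R y) \<le> (1 - u) * Psi x + u * Psi y"
    proof (rule Psi_least)
      fix t :: real assume t: "0 < t"
      have "((1 - u) *\<^sub>R x + u *\<^sub>R y) * t - Phi t = (1 - u) * (x * t - Phi t) + u * (y * t - Phi t)"
        by (simp add: algebra_simps)
      also have "\<dots> \<le> (1 - u) * Psi x + u * Psi y"
        using u Psi_ge[OF t] by (intro add_mono mult_left_mono) auto
      finally show "((1 - u) *\<^sub>R x + u *\<^sub>R y) * t - Phi t \<le> (1 - u) * Psi x + u * Psi y" .
    qed
  qed (simp add: convex_real_interval)
  show "Psi 0 = 0"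
  proof (rule antisym)
    show "Psi 0 \<le> 0" using Phi_nonneg by (intro Psi_least) auto
    show "0 \<le> Psi 0"
    \<comment> \<open>The supremum runs over t > 0, so the value 0 is approached by -Phi t as t
      tends to 0. Below t = 1 the height is 0 and Phi t is at most \<open>t powr p\<close>.\<close>
    proof (rule field_le_epsilon)
      fix e :: real assume e: "0 < e"
      define t where "t = min e (1 / 2)"
      have t: "0 < t" "t < 1" "t \<le> e" using e by (auto simp: t_def)
      have "log 2 t < 0" using t by simp
      then have "lev t \<le> 0" unfolding lev_def by linarith
      then have "env t = t powr p" by (simp add: env_def height_nonpos)
      also have "\<dots> \<le> t powr 1" using t p_gt_1 by (intro powr_mono') auto
      finally have "Phi t \<le> e" using Phi_le_env[OF t(1)] t by simp
      then show "0 \<le> Psi 0 + e" using Psi_ge[OF t(1), of 0] by simp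
    qed
  qed
  show "filterlim Psi at_top at_top"
  proof (rule filterlim_at_top_mono)
    show "filterlim (\<lambda>t::real. t - Phi 1) at_top at_top"
      using filterlim_tendsto_add_at_top[OF tendsto_const[of "- Phi 1"] filterlim_ident] by simp
    show "\<forall>\<^sub>F t in at_top. t - Phi 1 \<le> Psi t"
      using Psi_ge[of 1] by (intro always_eventually) auto
  qed
qed

lemma Psi_nonneg: "0 \<le> t \<Longrightarrow> 0 \<le> Psi t"
  using Psi_orlicz unfolding orlicz_function_def mono_on_def by force

text \<open>The generalised inverse of \<open>slope\<close>, playing for Psi the role of
  \<open>lev\<close> for Phi. At v up to 0 no index qualifies and the value is arbitrary.\<close>

definition idx :: "real \<Rightarrow> int" where
  "idx v = (SOME n. slope n \<le> v \<and> v < slope (n + 1))"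

lemma idx: "0 < v \<Longrightarrow> slope (idx v) \<le> v" "0 < v \<Longrightarrow> v < slope (idx v + 1)"
  using someI_ex[OF slope_index] unfolding idx_def by auto

lemma idx_le: "0 < v \<Longrightarrow> v < slope (n + 1) \<Longrightarrow> idx v \<le> n"
  using idx(1)[of v] slope_mono[of "n + 1" "idx v"] by linarith

lemma idx_ge: "0 < v \<Longrightarrow> slope n \<le> v \<Longrightarrow> n \<le> idx v"
  using idx(2)[of v] slope_mono[of "idx v + 1" n] by linarith

lemma Psi_upper:
  assumes "0 < v"
  shows "Psi v \<le> 2 powr (p + 1) * (2 powr of_int (idx v) * v)"
proof (rule Psi_least)
  fix t :: real assume t: "0 < t"
  have "v * t - Phi t \<le> 2 powr of_int (idx v + 1) * slope (idx v + 1)"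
    using idx(2)[OF assms] t by (intro young_term_le) auto
  also have "\<dots> \<le> 2 powr of_int (idx v + 1) * (2 powr p * v)"
    using slope_Suc[of "idx v"] idx(1)[OF assms]
    by (intro mult_left_mono) (auto intro: order_trans mult_left_mono)
  also have "\<dots> = 2 powr (p + 1) * (2 powr of_int (idx v) * v)" by (simp add: powr_add)
  finally show "v * t - Phi t \<le> 2 powr (p + 1) * (2 powr of_int (idx v) * v)" .
qed

text \<open>The test point is t = 2 ^ (idx v - J): J levels down the slope has at least halved, so
  Phi t is at most t v / 2 and half of t v survives.\<close>

lemma Psi_lower:
  assumes "0 < v"
  shows "2 powr of_int (idx v) * v \<le> 2 ^ (J + 1) * Psi v"
proof -
  let ?n = "idx v - int J"
  have "2 powr 1 * slope ?n \<le> slope (?n + int J)" by (rule slope_add_ge[OF J])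
  then have "2 * slope ?n \<le> v" using idx(1)[OF assms] by simp
  then have "2 powr of_int ?n * (v / 2) \<le> 2 powr of_int ?n * (v - slope ?n)" by (intro mult_left_mono) auto
  also have "\<dots> = v * 2 powr of_int ?n - env (2 powr of_int ?n)" 
    unfolding env_power by (simp only: algebra_simps)
  also have "\<dots> \<le> v * 2 powr of_int ?n - Phi (2 powr of_int ?n)" using Phi_le_env[of "2 powr of_int ?n"] by simp
  also have "\<dots> \<le> Psi v" by (rule Psi_ge) simp
  finally have "2 powr of_int ?n * (v / 2) \<le> Psi v" .
  then show ?thesis by (simp add: powr_diff powr_realpow field_simps)
qed

lemma Psi_double:
  assumes "0 \<le> v"
  shows "Psi (2 * v) \<le> (2 powr (p + 1) * 2 ^ (J + 1) * 2 ^ (J + 1)) * Psi v"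
proof (cases "v = 0")
  case True
  then show ?thesis using Psi_orlicz by (simp add: orlicz_function_def)
next
  case False
  then have v: "0 < v" using assms by simp
  \<comment> \<open>Doubling v moves its index by at most J.\<close>
  have "2 powr 1 * slope (idx v + 1) \<le> slope (idx v + 1 + int J)" by (rule slope_add_ge[OF J])
  then have "2 * v < slope (idx v + int J + 1)" using idx(2)[OF v] by (simp add: algebra_simps)
  then have "idx (2 * v) \<le> idx v + int J" using v by (intro idx_le) auto
  then have "2 powr of_int (idx (2 * v)) \<le> (2 powr of_int (idx v + int J) :: real)" by (intro powr_mono) auto
  also have "\<dots> = 2 ^ J * 2 powr of_int (idx v)" by (simp add: powr_add powr_realpow)
  finally have "2 powr of_int (idx (2 * v)) * (2 * v) \<le> (2 ^ J * 2 powr of_int (idx v)) * (2 * v)"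
    using v by (intro mult_right_mono) auto
  also have "\<dots> = 2 ^ (J + 1) * (2 powr of_int (idx v) * v)" by simp
  also have "\<dots> \<le> 2 ^ (J + 1) * (2 ^ (J + 1) * Psi v)" using Psi_lower[OF v] by (intro mult_left_mono) auto
  finally have le: "2 powr of_int (idx (2 * v)) * (2 * v) \<le> 2 ^ (J + 1) * (2 ^ (J + 1) * Psi v)" .
  have "Psi (2 * v) \<le> 2 powr (p + 1) * (2 powr of_int (idx (2 * v)) * (2 * v))"
    using v by (intro Psi_upper) simp
  also have "\<dots> \<le> 2 powr (p + 1) * (2 ^ (J + 1) * (2 ^ (J + 1) * Psi v))"
    by (intro mult_left_mono le) auto
  finally show ?thesis by (simp only: mult.assoc)
qed

text \<open>The ratio \<theta> of the two slopes agrees with t up to \<open>2 powr p\<close>.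
  Raising it to q - 1 turns (p - 1) times the index difference into the index difference itself,
  since (p - 1)(q - 1) = 1, and leaves the height drop as \<open>2 powr d\<close>; the error becomes
  \<open>2 powr q\<close> since p (q - 1) = q.\<close>

lemma power_index_compare:
  assumes "0 < t" "t \<le> 1" "0 < s"
  defines "d \<equiv> (q - 1) * (height (idx s) - height (idx (t * s)))"
  shows "2 powr of_int (idx (t * s)) \<le> 2 powr q * t powr (q - 1) * 2 powr d * 2 powr of_int (idx s)"
    and "t powr (q - 1) * 2 powr d * 2 powr of_int (idx s) \<le> 2 powr q * 2 powr of_int (idx (t * s))"
proof -
  define \<theta> where "\<theta> = slope (idx (t * s)) / slope (idx s)"
  have \<theta>: "0 < \<theta>" by (simp add: \<theta>_def)
  have ts: "0 < t * s" using assms by simp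
  have "\<theta> powr (q - 1) = 2 powr ((p - 1) * (q - 1) * (of_int (idx (t * s)) - of_int (idx s)) - d)"
    unfolding \<theta>_def slope_def powr_diff[symmetric] powr_powr d_def by (simp add: algebra_simps)
  then have key: "\<theta> powr (q - 1) * 2 powr d * 2 powr of_int (idx s) = 2 powr of_int (idx (t * s))"
    unfolding pq(1) by (simp add: powr_diff)
  have "slope (idx (t * s)) \<le> t * slope (idx s + 1)"
    using idx(1)[OF ts] idx(2)[OF assms(3)] assms(1) by (smt (verit) mult_less_cancel_left_pos)
  also have "\<dots> \<le> t * (2 powr p * slope (idx s))" using slope_Suc assms(1) by (intro mult_left_mono) auto
  finally have 1: "\<theta> \<le> 2 powr p * t" by (simp add: \<theta>_def field_simps)
  have "t * slope (idx s) \<le> slope (idx (t * s) + 1)"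
    using idx(2)[OF ts] idx(1)[OF assms(3)] assms(1) by (smt (verit) mult_left_mono)
  also have "\<dots> \<le> 2 powr p * slope (idx (t * s))" by (rule slope_Suc)
  finally have 2: "t \<le> 2 powr p * \<theta>" by (simp add: \<theta>_def field_simps)
  have mult: "(2 powr p * x) powr (q - 1) = 2 powr q * x powr (q - 1)" if "0 < x" for x
    using that by (simp add: powr_mult powr_powr pq(2))
  have "\<theta> powr (q - 1) \<le> 2 powr q * t powr (q - 1)"
    using powr_mono2[OF _ _ 1, of "q - 1"] q_gt_1 \<theta> mult[OF assms(1)] by simp
  then have "\<theta> powr (q - 1) * (2 powr d * 2 powr of_int (idx s)) \<le> 2 powr q * t powr (q - 1) * (2 powr d * 2 powr of_int (idx s))"
    by (intro mult_right_mono) auto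
  then show "2 powr of_int (idx (t * s)) \<le> 2 powr q * t powr (q - 1) * 2 powr d * 2 powr of_int (idx s)"
    unfolding key[symmetric] by (simp only: mult.assoc)
  have "t powr (q - 1) \<le> 2 powr q * \<theta> powr (q - 1)"
    using powr_mono2[OF _ _ 2, of "q - 1"] q_gt_1 assms(1) mult[OF \<theta>] by simp
  then have "t powr (q - 1) * (2 powr d * 2 powr of_int (idx s)) \<le> 2 powr q * \<theta> powr (q - 1) * (2 powr d * 2 powr of_int (idx s))"
    by (intro mult_right_mono) auto
  then show "t powr (q - 1) * 2 powr d * 2 powr of_int (idx s) \<le> 2 powr q * 2 powr of_int (idx (t * s))"
    unfolding key[symmetric] by (simp only: mult.assoc)
qed

definition K0 :: real where "K0 = 2 powr (p + 1) * 2 powr q * 2 ^ (J + 1)"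

lemma K0: "0 < K0" by (simp add: K0_def)

text \<open>The height drop that makes Phi (t s) small relative to \<open>t powr p\<close> makes Psi
  (t s) large relative to \<open>t powr q\<close>: this is the reversal under conjugation,
  quantified by d.\<close>

lemma Psi_compare:
  assumes "0 < t" "t \<le> 1" "0 < s"
  defines "d \<equiv> (q - 1) * (height (idx s) - height (idx (t * s)))"
  shows "Psi (t * s) \<le> K0 * (t powr q * 2 powr d * Psi s)"
    and "t powr q * 2 powr d * Psi s \<le> K0 * Psi (t * s)"
proof -
  have ts: "0 < t * s" using assms by simp
  have tq: "t powr (q - 1) * t = t powr q" using powr_add[of t "q - 1" 1] assms(1) by simp
  have "Psi (t * s) \<le> 2 powr (p + 1) * (2 powr of_int (idx (t * s)) * (t * s))" by (rule Psi_upper[OF ts])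
  also have "\<dots> \<le> 2 powr (p + 1) * ((2 powr q * t powr (q - 1) * 2 powr d * 2 powr of_int (idx s)) * (t * s))"
    using ts unfolding d_def
    by (intro mult_left_mono mult_right_mono power_index_compare(1) assms) auto
  also have "\<dots> = 2 powr (p + 1) * 2 powr q * ((t powr (q - 1) * t) * 2 powr d) * (2 powr of_int (idx s) * s)" by (simp only: mult_ac)
  also have "\<dots> = 2 powr (p + 1) * 2 powr q * (t powr q * 2 powr d) * (2 powr of_int (idx s) * s)" unfolding tq by simp
  also have "\<dots> \<le> 2 powr (p + 1) * 2 powr q * (t powr q * 2 powr d) * (2 ^ (J + 1) * Psi s)"
    using Psi_lower[OF assms(3)] by (intro mult_left_mono) auto
  finally show "Psi (t * s) \<le> K0 * (t powr q * 2 powr d * Psi s)" by (simp add: K0_def mult_ac)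
  have "t powr q * 2 powr d * Psi s \<le> t powr q * 2 powr d * (2 powr (p + 1) * (2 powr of_int (idx s) * s))"
    using Psi_upper[OF assms(3)] by (intro mult_left_mono) auto
  also have "\<dots> = 2 powr (p + 1) * ((t powr (q - 1) * 2 powr d * 2 powr of_int (idx s)) * (t * s))"
    unfolding tq[symmetric] by (simp only: mult_ac)
  also have "\<dots> \<le> 2 powr (p + 1) * ((2 powr q * 2 powr of_int (idx (t * s))) * (t * s))"
    using ts unfolding d_def
    by (intro mult_left_mono mult_right_mono power_index_compare(2) assms) auto
  also have "\<dots> = 2 powr (p + 1) * 2 powr q * (2 powr of_int (idx (t * s)) * (t * s))" by simp
  also have "\<dots> \<le> 2 powr (p + 1) * 2 powr q * (2 ^ (J + 1) * Psi (t * s))"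
    using Psi_lower[OF ts] by (intro mult_left_mono) auto
  finally show "t powr q * 2 powr d * Psi s \<le> K0 * Psi (t * s)" by (simp add: K0_def mult_ac)
qed

text \<open>Going down J levels at least halves the slope, so T halvings of s cost at most T J
  indices; windows are longer for Psi by the factor J.\<close>

lemma idx_scaled_ge:
  assumes "1 / 2 ^ T \<le> t" "0 < s"
  shows "idx s - int (T * J) \<le> idx (t * s)"
proof (rule idx_ge)
  have t: "0 < t" using assms(1) by (meson less_le_trans zero_less_divide_1_iff zero_less_numeral zero_less_power)
  show "0 < t * s" using t assms(2) by simp
  have "real T \<le> (p - 1) * real (T * J)" using mult_left_mono[OF J, of "real T"] by (simp add: mult_ac)
  from slope_add_ge[OF this, of "idx s - int (T * J)"]
  have "2 ^ T * slope (idx s - int (T * J)) \<le> slope (idx s)" by (simp add: powr_realpow)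
  then have "slope (idx s - int (T * J)) \<le> 1 / 2 ^ T * slope (idx s)" by (simp add: field_simps)
  also have "\<dots> \<le> t * s" using assms idx(1)[OF assms(2)] t by (intro mult_mono) (auto simp: less_imp_le)
  finally show "slope (idx s - int (T * J)) \<le> t * s" .
qed

lemma Psi_power_lower:
  assumes "0 \<le> t" "t \<le> 1" "0 \<le> s"
  shows "1 / K0 * t powr q * Psi s \<le> Psi (t * s)"
proof (cases "t * s = 0")
  case True
  then show ?thesis using Psi_orlicz by (auto simp: orlicz_function_def)
next
  case False
  then have ts: "0 < t" "0 < s" using assms by auto
  have "t * s \<le> s" using ts assms by (simp add: mult_le_cancel_right1)
  then have "t * s < slope (idx s + 1)" using idx(2)[OF ts(2)] by (rule le_less_trans)
  then have "idx (t * s) \<le> idx s" using ts by (intro idx_le) auto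
  then have "0 \<le> (q - 1) * (height (idx s) - height (idx (t * s)))"
    using q_gt_1 height_mono by (intro mult_nonneg_nonneg) auto
  then have "2 powr 0 \<le> 2 powr ((q - 1) * (height (idx s) - height (idx (t * s))))" by (intro powr_mono) auto
  moreover have "0 \<le> Psi s" using Psi_nonneg assms by simp
  ultimately have "t powr q * 1 * Psi s \<le> t powr q * 2 powr ((q - 1) * (height (idx s) - height (idx (t * s)))) * Psi s"
    by (intro mult_right_mono mult_left_mono) auto
  also have "\<dots> \<le> K0 * Psi (t * s)" by (rule Psi_compare(2)[OF ts(1) assms(2) ts(2)])
  finally show ?thesis using K0 by (simp add: field_simps)
qed

lemma Psi_power_upper:
  assumes "1 / 2 ^ T \<le> t" "t \<le> 1" "0 < s" "height (idx s) - height (idx s - int (T * J)) \<le> C"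
  shows "Psi (t * s) \<le> K0 * 2 powr ((q - 1) * C) * t powr q * Psi s"
proof -
  have t: "0 < t" using assms(1) by (meson less_le_trans zero_less_divide_1_iff zero_less_numeral zero_less_power)
  have "height (idx s) - height (idx (t * s)) \<le> C"
    using assms(4) height_mono[OF idx_scaled_ge[OF assms(1,3)]] by simp
  then have "2 powr ((q - 1) * (height (idx s) - height (idx (t * s)))) \<le> 2 powr ((q - 1) * C)"
    using q_gt_1 by (intro powr_mono mult_left_mono) auto
  moreover have "0 \<le> Psi s" using Psi_nonneg assms by simp
  ultimately have "K0 * (t powr q * 2 powr ((q - 1) * (height (idx s) - height (idx (t * s)))) * Psi s)
      \<le> K0 * (t powr q * 2 powr ((q - 1) * C) * Psi s)"
    using K0 by (intro mult_left_mono mult_right_mono) auto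
  then show ?thesis using Psi_compare(1)[OF t assms(2,3)] by (simp add: mult_ac)
qed

section \<open>Window estimates for each kind\<close>

lemma idx_tendsto: "\<exists>s0>0. \<forall>s\<ge>s0. n \<le> idx s"
  using idx_ge[of _ n] slope_pos[of n] by (intro exI[of _ "slope n"]) (auto intro: less_le_trans)

lemma lev_tendsto: "\<exists>s0>0. \<forall>s\<ge>s0. n \<le> lev s"
  using lev_ge[of n] by (intro exI[of _ "2 powr of_int n"]) auto

lemma height_window_small:
  "\<exists>n0. \<forall>n\<ge>n0. kind (nat n) \<le> N \<longrightarrow> height n - height (n - int T) \<le> real N + 1"
proof -
  obtain n0 where n0: "\<And>n. n \<ge> n0 \<Longrightarrow> kind n \<le> N \<Longrightarrow> height (int n) - height (int n - int T) \<le> real N + 1"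
    using height_diff_small_kind by blast
  have "height n - height (n - int T) \<le> real N + 1" if "n \<ge> int n0" "kind (nat n) \<le> N" for n
    using n0[of "nat n"] that by (simp add: le_nat_iff)
  then show ?thesis by blast
qed

lemma height_window_large:
  "\<exists>n0. \<forall>n\<ge>n0. T < kind (nat n) \<longrightarrow> height n - height (n - int T) \<le> 1"
proof -
  obtain n0 where n0: "\<And>n. n \<ge> n0 \<Longrightarrow> T < kind n \<Longrightarrow> height (int n) - height (int n - int T) \<le> 1"
    using height_diff_large_kind by blast
  have "height n - height (n - int T) \<le> 1" if "n \<ge> int n0" "T < kind (nat n)" for n
    using n0[of "nat n"] that by (simp add: le_nat_iff)
  then show ?thesis by blast
qed

lemma Phi_small_kind:
  "\<exists>c>0. \<forall>T. \<exists>s0. \<forall>s\<ge>s0. kind (nat (lev s)) \<le> N \<longrightarrow>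
     (\<forall>t. 1 / 2 ^ T \<le> t \<and> t \<le> 1 \<longrightarrow> c * t powr p * Phi s \<le> Phi (t * s))"
proof (rule exI[of _ "1 / (4 powr p * 2 powr (real N + 1))"], intro conjI allI)
  fix T
  obtain n0 where n0: "\<And>n. n \<ge> n0 \<Longrightarrow> kind (nat n) \<le> N \<Longrightarrow> height n - height (n - int T) \<le> real N + 1"
    using height_window_small by blast
  obtain s0 where "0 < s0" "\<And>s. s \<ge> s0 \<Longrightarrow> n0 \<le> lev s" using lev_tendsto by blast
  then show "\<exists>s0. \<forall>s\<ge>s0. kind (nat (lev s)) \<le> N \<longrightarrow>
     (\<forall>t. 1 / 2 ^ T \<le> t \<and> t \<le> 1 \<longrightarrow> 1 / (4 powr p * 2 powr (real N + 1)) * t powr p * Phi s \<le> Phi (t * s))"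
    using n0 by (intro exI[of _ s0]) (auto intro!: Phi_lower[simplified])
qed simp

lemma Phi_large_kind:
  "\<exists>c>0. \<forall>T. \<exists>N s0. \<forall>s\<ge>s0. N < kind (nat (lev s)) \<longrightarrow>
     (\<forall>t. 1 / 2 ^ T \<le> t \<and> t \<le> 1 \<longrightarrow> c * t powr p * Phi s \<le> Phi (t * s))"
proof (rule exI[of _ "1 / (4 powr p * 2 powr 1)"], intro conjI allI)
  fix T
  obtain n0 where n0: "\<And>n. n \<ge> n0 \<Longrightarrow> T < kind (nat n) \<Longrightarrow> height n - height (n - int T) \<le> 1"
    using height_window_large by blast
  obtain s0 where "0 < s0" "\<And>s. s \<ge> s0 \<Longrightarrow> n0 \<le> lev s" using lev_tendsto by blast
  then show "\<exists>N s0. \<forall>s\<ge>s0. N < kind (nat (lev s)) \<longrightarrow>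
     (\<forall>t. 1 / 2 ^ T \<le> t \<and> t \<le> 1 \<longrightarrow> 1 / (4 powr p * 2 powr 1) * t powr p * Phi s \<le> Phi (t * s))"
    using n0 by (intro exI[of _ T] exI[of _ s0] allI impI Phi_lower) auto
qed simp

lemma Psi_small_kind:
  "\<exists>C\<ge>0. \<forall>T. \<exists>s0. \<forall>s\<ge>s0. kind (nat (idx s)) \<le> N \<longrightarrow>
     (\<forall>t. 1 / 2 ^ T \<le> t \<and> t \<le> 1 \<longrightarrow> Psi (t * s) \<le> C * t powr q * Psi s)"
proof (rule exI[of _ "K0 * 2 powr ((q - 1) * (real N + 1))"], intro conjI allI)
  fix T
  obtain n0 where n0: "\<And>n. n \<ge> n0 \<Longrightarrow> kind (nat n) \<le> N \<Longrightarrow> height n - height (n - int (T * J)) \<le> real N + 1"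
    using height_window_small by blast
  obtain s0 where "0 < s0" "\<And>s. s \<ge> s0 \<Longrightarrow> n0 \<le> idx s" using idx_tendsto by blast
  then show "\<exists>s0. \<forall>s\<ge>s0. kind (nat (idx s)) \<le> N \<longrightarrow>
     (\<forall>t. 1 / 2 ^ T \<le> t \<and> t \<le> 1 \<longrightarrow> Psi (t * s) \<le> K0 * 2 powr ((q - 1) * (real N + 1)) * t powr q * Psi s)"
    using n0 by (intro exI[of _ s0] allI impI Psi_power_upper[where T = T]) auto
qed (use K0 in simp)

lemma Psi_large_kind:
  "\<exists>C\<ge>0. \<forall>T. \<exists>N s0. \<forall>s\<ge>s0. N < kind (nat (idx s)) \<longrightarrow>
     (\<forall>t. 1 / 2 ^ T \<le> t \<and> t \<le> 1 \<longrightarrow> Psi (t * s) \<le> C * t powr q * Psi s)"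
proof (rule exI[of _ "K0 * 2 powr ((q - 1) * 1)"], intro conjI allI)
  fix T
  obtain n0 where n0: "\<And>n. n \<ge> n0 \<Longrightarrow> T * J < kind (nat n) \<Longrightarrow> height n - height (n - int (T * J)) \<le> 1"
    using height_window_large by blast
  obtain s0 where "0 < s0" "\<And>s. s \<ge> s0 \<Longrightarrow> n0 \<le> idx s" using idx_tendsto by blast
  then show "\<exists>N s0. \<forall>s\<ge>s0. N < kind (nat (idx s)) \<longrightarrow>
     (\<forall>t. 1 / 2 ^ T \<le> t \<and> t \<le> 1 \<longrightarrow> Psi (t * s) \<le> K0 * 2 powr ((q - 1) * 1) * t powr q * Psi s)"
    using n0 by (intro exI[of _ "T * J"] exI[of _ s0] allI impI Psi_power_upper[where T = T]) auto
qed (use K0 in simp)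

text \<open>From the top of a ramp of kind N, descending the whole ramp collects the height drop N +
  1 and hence a gain \<open>2 powr ((q - 1) * (N + 1))\<close> in \<open>Psi_compare\<close>, which
  for large N beats K0 B. The factor \<tau> depends on N alone, and ramps of kind N recur
  arbitrarily far out.\<close>

lemma Psi_bad_levels:
  "\<exists>\<tau>>0. \<tau> \<le> 1 \<and> (\<exists>C\<ge>0. \<forall>T s0. \<exists>s\<ge>s0. B * \<tau> powr q * Psi s \<le> Psi (\<tau> * s) \<and>
     (\<forall>t. 1 / 2 ^ T \<le> t \<and> t \<le> 1 \<longrightarrow> Psi (t * s) \<le> C * t powr q * Psi s))"
proof -
  obtain N :: nat where "log 2 (max 1 (K0 * B)) / (q - 1) \<le> real N" using real_arch_simple by blast
  then have "log 2 (max 1 (K0 * B)) \<le> (q - 1) * (real N + 1)" using q_gt_1 by (simp add: field_simps)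
  then have "2 powr log 2 (max 1 (K0 * B)) \<le> 2 powr ((q - 1) * (real N + 1))" by (intro powr_mono) auto
  then have N: "K0 * B \<le> 2 powr ((q - 1) * (real N + 1))" by simp
  define W where "W = (N + 1)\<^sup>2"
  \<comment> \<open>Descending W levels divides the slope by \<open>2 powr ((p - 1) * W)\<close>
    and, through the height, by \<open>2 powr (N + 1)\<close>; as N + 1 is at most W, the factor
    \<open>2 powr (p * W)\<close> covers both.\<close>
  define \<tau> where "\<tau> = 2 powr (- p * real W)"
  have "\<tau> \<le> 2 powr 0" unfolding \<tau>_def using p_gt_1 by (intro powr_mono) auto
  then have \<tau>: "0 < \<tau>" "\<tau> \<le> 1" by (auto simp: \<tau>_def)
  obtain C where C: "0 \<le> C" "\<And>T. \<exists>s0. \<forall>s\<ge>s0. kind (nat (idx s)) \<le> N \<longrightarrow>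
     (\<forall>t. 1 / 2 ^ T \<le> t \<and> t \<le> 1 \<longrightarrow> Psi (t * s) \<le> C * t powr q * Psi s)"
    using Psi_small_kind[of N] by blast
  have "\<exists>s\<ge>s0. B * \<tau> powr q * Psi s \<le> Psi (\<tau> * s) \<and>
     (\<forall>t. 1 / 2 ^ T \<le> t \<and> t \<le> 1 \<longrightarrow> Psi (t * s) \<le> C * t powr q * Psi s)" for T s0
  proof -
    obtain s1 where s1: "\<And>s. s \<ge> s1 \<Longrightarrow> kind (nat (idx s)) \<le> N \<Longrightarrow>
       (\<forall>t. 1 / 2 ^ T \<le> t \<and> t \<le> 1 \<longrightarrow> Psi (t * s) \<le> C * t powr q * Psi s)" using C(2) by blast
    define n0 where "n0 = nat (idx (max 1 (max s0 s1)) + 1)"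
    obtain n where n: "n \<ge> n0" "kind n = N" "height (int n) - height (int n - int W) = real N + 1"
      using height_diff_unbounded[of n0 N] unfolding W_def by blast
    define s where "s = slope (int n)"
    have s: "0 < s" by (simp add: s_def)
    have "max 1 (max s0 s1) \<le> slope (idx (max 1 (max s0 s1)) + 1)"
      by (rule less_imp_le[OF idx(2)]) simp
    also have "\<dots> \<le> s" unfolding s_def using n(1) by (intro slope_mono) (auto simp: n0_def)
    finally have large: "s0 \<le> s" "s1 \<le> s" by auto
    have idx_s: "idx s = int n"
    proof (rule antisym)
      have "s < slope (int n + 1)" unfolding s_def by (rule slope_less)
      then show "idx s \<le> int n" using s by (intro idx_le)
      show "int n \<le> idx s" using s by (intro idx_ge) (simp_all add: s_def)
    qed
    have "\<tau> * s \<le> slope (int n - int W)"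
    proof -
      have "- p * real W + ((p - 1) * of_int (int n) + height (int n))
        \<le> (p - 1) * of_int (int n - int W) + height (int n - int W)"
      proof -
        have "real N + 1 \<le> real W" unfolding W_def by (simp add: power2_eq_square)
        then have "height (int n) - height (int n - int W) \<le> real W" using n(3) by linarith
        then show ?thesis by (simp add: algebra_simps)
      qed
      then show ?thesis unfolding \<tau>_def s_def slope_def powr_add[symmetric] by (intro powr_mono) auto
    qed
    also have "\<dots> < slope (int n - int W + 1)" by (rule slope_less)
    finally have "idx (\<tau> * s) \<le> int n - int W" using \<tau> s by (intro idx_le) auto
    then have "real N + 1 \<le> height (idx s) - height (idx (\<tau> * s))"
      using height_mono n(3) unfolding idx_s by fastforce
    then have "K0 * B \<le> 2 powr ((q - 1) * (height (idx s) - height (idx (\<tau> * s))))"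
      using N q_gt_1 by (smt (verit) powr_mono mult_left_mono)
    moreover have "0 \<le> Psi s" using Psi_nonneg s by simp
    ultimately have "\<tau> powr q * (K0 * B) * Psi s \<le> \<tau> powr q * 2 powr ((q - 1) * (height (idx s) - height (idx (\<tau> * s)))) * Psi s"
      by (intro mult_left_mono mult_right_mono) auto
    also have "\<dots> \<le> K0 * Psi (\<tau> * s)" by (rule Psi_compare(2)[OF \<tau> s])
    finally have "K0 * (B * \<tau> powr q * Psi s) \<le> K0 * Psi (\<tau> * s)" by (simp add: mult_ac)
    then have "B * \<tau> powr q * Psi s \<le> Psi (\<tau> * s)" using K0 by simp
    then show ?thesis using large s1[of s] n(2) idx_s by (intro exI[of _ s]) auto
  qed
  then show ?thesis using \<tau> C(1) by blast
qed

lemma lev_measurable: "{s. kind (nat (lev s)) \<le> N} \<in> sets borel"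
proof -
  have "(\<lambda>s. lev s) \<in> borel \<rightarrow>\<^sub>M count_space UNIV" unfolding lev_def by measurable
  then have "(\<lambda>s. lev s) -` {n. kind (nat n) \<le> N} \<inter> space borel \<in> sets borel"
    by (rule measurable_sets) simp
  then show ?thesis by (simp add: vimage_def)
qed

end

theorem mainTheorem15:
  fixes p q :: real
  assumes "1 < p" and "1 / p + 1 / q = 1"
  shows "\<exists>\<Phi>. orlicz_function \<Phi>
           \<and> (\<forall>u\<ge>0. bdd_above {u * t - \<Phi> t | t. t > 0})
           \<and> orlicz_function (young_conjugate \<Phi>)
           \<and> r_DH \<Phi> p
           \<and> restricted_r_DH (young_conjugate \<Phi>) q
           \<and> \<not> DH (young_conjugate \<Phi>)
           \<and> \<not> DC (young_conjugate \<Phi>)"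
proof -
  interpret conjugate_exponents p q by unfold_locales (rule assms)+
  interpret \<Phi>: orlicz_delta2 Phi "2 powr (p + 1) * 4 powr p"
    by unfold_locales (rule Phi_orlicz, rule Phi_double)
  interpret \<Psi>: orlicz_delta2 Psi "2 powr (p + 1) * 2 ^ (J + 1) * 2 ^ (J + 1)"
    by unfold_locales (rule Psi_orlicz, rule Psi_double)
  have q: "1 \<le> q" using q_gt_1 by simp
  have "r_DH Phi p"
    by (rule \<Phi>.r_DH_if[where C = "4 powr p" and ty = "\<lambda>s. kind (nat (lev s))"])
      (use p_gt_1 Phi_upper lev_measurable Phi_small_kind Phi_large_kind in auto)
  moreover have "restricted_r_DH Psi q"
    by (rule \<Psi>.restricted_r_DH_if[where c = "1 / K0" and ty = "\<lambda>s. kind (nat (idx s))"])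
      (use q K0 Psi_power_lower Psi_small_kind Psi_large_kind in auto)
  moreover have "\<not> DH Psi" "\<not> DC Psi"
    by (rule \<Psi>.not_DH_not_DC[OF q Psi_bad_levels])+
  ultimately show ?thesis
    unfolding Psi_def
    by (intro exI[of _ Phi] conjI allI impI young_bdd Phi_orlicz Psi_orlicz[unfolded Psi_def])
qed

end
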